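(* Let $d \geq 2$ and let $\mathcal{B}(0,1)$ be the closed Euclidean unit ball of $\mathbb{R}^d$. The function $$\mu : \mathcal{P} \to \mathcal{C}\left(\mathcal{B}(0,1), \mathbb{R}\right), \qquad p \mapsto \left( x \mapsto \mu_p(x) \right)$$ is continuous, where $\mathcal{C}(\mathcal{B}(0,1),\mathbb{R})$ is equipped with the norm $\|f\|_\infty = \sup_{x \in \mathcal{B}(0,1)} |f(x)|$.
   Context: Let $\mathcal{P} = \{(p_1,p_2,\ldots) \in [0,1]^{\mathbb{N}^*} : \sum_{i \geq 1} p_i = 1\}$, where $\mathbb{N}^*=\{1,2,\ldots\}$. The $L_1$-norm $\|\cdot\|_1$, the supremum norm $|p| = \sup_i p_i$ and pointwise convergence induce the same topology on $\mathcal{P}$; this is the topology used on $\mathcal{P}$. Fix $d\ge 2$. $\mathbb{Z}^d$ is endowed with the set of edges $\mathbb{E}^d$ of all pairs $\{u,v\}$ with $u,v\in\mathbb{Z}^d$, $\|u-v\|_1 = 1$. For $p \in \mathcal{P}$, let $(X_u)_{u \in \mathbb{Z}^d}$ be i.i.d. with law $\sum_{i\geq 1} p_i \delta_i$ (a random coloring). Each edge $\{u,v\}$ gets the passage time $t(\{u,v\}) = \mathbf{1}_{\{X_u \neq X_v\}}$. A path $\gamma$ is a finite nearest-neighbour sequence of vertices (together with the edges between consecutive ones), and its passage time $T(\gamma)$ is the sum of $t(e)$ over its successive edges. For $u,v \in \mathbb{Z}^d$, $T_p(u,v)$ is the infimum of $T(\gamma)$ over all paths $\gamma$ from $u$ to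 $v$. For $x,y \in \mathbb{R}^d$, $T_p(x,y) := T_p(x^\star, y^\star)$, where $x^\star$ is the site of $\mathbb{Z}^d$ nearest to $x$ (ties broken by a deterministic rule). For each $p\in\mathcal{P}$ and $x \in \mathbb{R}^d$, it is known that there is a constant $\mu_p(x)$ such that $\lim_{n\to\infty} T_p(0,nx)/n = \mu_p(x)$ almost surely, and that $\mu_p$ is a seminorm on $\mathbb{R}^d$ (hence continuous). This defines $\mu_p$. *)

theory Defs
  imports "HOL-Probability.Probability"
begin

(* Colors are the positive integers. A sequence (p_1, p_2, ...) is a function on nat whose
   unused value at 0 is pinned to 0, so that the product topology on nat \<Rightarrow> real induces on
   this set the topology of pointwise convergence of (p_i)_{i \<ge> 1}. *)
definition color_seqs :: "(nat \<Rightarrow> real) set" where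
  "color_seqs = {p. p 0 = 0 \<and> (\<forall>i\<ge>1. 0 \<le> p i \<and> p i \<le> 1) \<and> (p has_sum 1) {1..}}"

definition color_law :: "(nat \<Rightarrow> real) \<Rightarrow> nat measure" where
  "color_law p = point_measure {1..} (\<lambda>i. ennreal (p i))"

(* Canonical realization of the i.i.d. family: a coloring \<omega> assigns the color X_u = \<omega> u to u. *)
definition coloring_measure :: "(nat \<Rightarrow> real) \<Rightarrow> (int ^ 'd \<Rightarrow> nat) measure" where
  "coloring_measure p = (\<Pi>\<^sub>M u\<in>UNIV. color_law p)"

definition lattice_adj :: "int ^ 'd \<Rightarrow> int ^ 'd \<Rightarrow> bool" where
  "lattice_adj u v \<longleftrightarrow> (\<Sum>i\<in>UNIV. \<bar>u $ i - v $ i\<bar>) = 1"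

definition lattice_paths :: "int ^ 'd \<Rightarrow> int ^ 'd \<Rightarrow> (int ^ 'd) list set" where
  "lattice_paths u v = {\<gamma>. \<gamma> \<noteq> [] \<and> hd \<gamma> = u \<and> last \<gamma> = v \<and> successively lattice_adj \<gamma>}"

definition edge_time :: "('v \<Rightarrow> nat) \<Rightarrow> 'v \<Rightarrow> 'v \<Rightarrow> real" where
  "edge_time \<omega> u v = (if \<omega> u \<noteq> \<omega> v then 1 else 0)"

definition path_time :: "('v \<Rightarrow> nat) \<Rightarrow> 'v list \<Rightarrow> real" where
  "path_time \<omega> \<gamma> = (\<Sum>k<length \<gamma> - 1. edge_time \<omega> (\<gamma> ! k) (\<gamma> ! Suc k))"

definition site_time :: "(int ^ 'd \<Rightarrow> nat) \<Rightarrow> int ^ 'd \<Rightarrow> int ^ 'd \<Rightarrow> real" where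
  "site_time \<omega> u v = (INF \<gamma>\<in>lattice_paths u v. path_time \<omega> \<gamma>)"

(* The tie-breaking rule for the nearest site is to round half-integer coordinates up. *)
definition nearest_site :: "real ^ 'd \<Rightarrow> int ^ 'd" where
  "nearest_site x = (\<chi> i. round (x $ i))"

lemma nearest_site_minimal:
  fixes x :: "real ^ 'd" and z :: "int ^ 'd"
  shows "dist x (\<chi> i. of_int (nearest_site x $ i)) \<le> dist x (\<chi> i. of_int (z $ i))"
  unfolding dist_vec_def
  by (rule L2_set_mono) (simp_all add: nearest_site_def dist_real_def round_diff_minimal)

definition passage_time :: "(int ^ 'd \<Rightarrow> nat) \<Rightarrow> real ^ 'd \<Rightarrow> real ^ 'd \<Rightarrow> real" where
  "passage_time \<omega> x y = site_time \<omega> (nearest_site x) (nearest_site y)"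

definition time_const :: "(nat \<Rightarrow> real) \<Rightarrow> real ^ 'd \<Rightarrow> real" where
  "time_const p x = (THE c. AE \<omega> in coloring_measure p.
     (\<lambda>n. passage_time \<omega> 0 (real n *\<^sub>R x) / real n) \<longlonglongrightarrow> c)"

end

theory Submission
  imports Defs
begin

text \<open>Write \<open>T\<close> for \<^const>\<open>site_time\<close> and \<open>\<gamma>\<^sub>p(z)\<close> for the infimum over \<open>n\<close> of the mean of
\<open>T(0, n z) / n\<close> (\<open>time_rate\<close>). The proof has two halves: the time constant exists and is approximated by
finitely many rates \<open>\<gamma>\<^sub>p(z)\<close>, uniformly in \<open>p\<close> and in the direction; and each rate depends
continuously on \<open>p\<close>.

\<^bold>\<open>Existence.\<close> Passage times are subadditive, translation invariant in law and bounded by the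
\<open>l1\<close> distance. The upper bound \<open>limsup T(0, n z) / n \<le> \<gamma>(z)\<close> (\<open>limsup_le_time_rate\<close>) follows by
concatenating paths that are confined to finite boxes: far apart boxes are independent, so a strong law for
bounded independent variables applies. The lower bound (\<open>liminf_ge_time_rate\<close>) is the covering
argument of Katznelson and Weiss: if slow growth occurred infinitely often with positive probability, short fast
stretches would start near almost every point of the line, and gluing them greedily would make the mean of \<open>T(0, L z)\<close>
smaller than \<open>L \<gamma>(z)\<close>. For a real vector \<open>x\<close> one compares \<open>n x\<close> with multiples of the
lattice vector nearest to \<open>K x\<close>; the error is at most \<open>d / K\<close> whatever \<open>p\<close> and \<open>x\<close> are
(\<open>passage_time_rate\<close>). For fixed \<open>K\<close> the unit ball meets finitely many such lattice vectors, so
uniform continuity on the ball reduces to continuity of \<open>\<gamma>\<^sub>p(z)\<close> in \<open>p\<close> for each \<open>z\<close>.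

\<^bold>\<open>Continuity of the rate.\<close> Let \<open>p\<close> be close to \<open>q\<close>, and couple two colorings \<open>X\<close>, \<open>Y\<close> with
these color laws so that they differ at a given site with small probability (\<open>coupling_exists\<close>). Upper
semicontinuity is easy, because the rate is an infimum of means of functions that almost depend on finitely many colors.
For lower semicontinuity only the case \<open>\<gamma>\<^sub>q(z) > 0\<close> matters. An optimal path for \<open>X\<close> may be recolored
to \<open>Y\<close> at a cost of two per changed site, but it could be long and meet too many changed sites. This is excluded
as follows. By the symmetries of the lattice a rate that is positive in one direction is bounded below by a norm
(\<open>time_rate_le_axis\<close>, \<open>time_rate_ge_axis\<close>), so at a suitable scale \<open>N\<close> monochromatic paths from a block of side \<open>N\<close> to the
outside of its neighbourhood are unlikely for \<open>q\<close> (\<open>crossing_unlikely\<close>); this is an event on a finite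
box, hence it stays unlikely for \<open>p\<close>. A counting bound for connected sets of blocks
(\<open>animal_bound\<close>) shows that, outside an event of exponentially small probability, a path that visits \<open>k\<close> blocks
pays a fixed multiple of \<open>k\<close>. An optimal path to \<open>n z\<close> costs \<open>O(n)\<close>, so it visits \<open>O(n)\<close> blocks, and a
second use of the counting bound shows that few of these contain a changed site once \<open>p\<close> is close enough to
\<open>q\<close> at the fixed scale \<open>N\<close> (\<open>geodesic_comparison\<close>, \<open>rate_comparison\<close>).\<close>

section \<open>Lattice paths and passage times\<close>

definition l1 :: "int ^ 'd \<Rightarrow> real" where
  "l1 z = real_of_int (\<Sum>i\<in>UNIV. \<bar>z $ i\<bar>)"

lemma l1_nonneg [simp]: "0 \<le> l1 z"
  by (simp add: l1_def sum_nonneg flip: of_int_sum)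

lemma l1_0 [simp]: "l1 0 = 0"
  by (simp add: l1_def)

lemma l1_eq_0_iff: "l1 z = 0 \<longleftrightarrow> z = 0"
  by (simp add: l1_def sum_nonneg_eq_0_iff vec_eq_iff del: of_int_sum)

lemma l1_minus [simp]: "l1 (- z) = l1 z"
  by (simp add: l1_def)

lemma l1_minus_commute: "l1 (u - v) = l1 (v - u)"
  by (simp add: l1_def abs_minus_commute)

lemma l1_scale: "l1 (c *s z) = \<bar>real_of_int c\<bar> * l1 z"
  by (simp add: l1_def abs_mult sum_distrib_left)

lemma l1_axis [simp]: "l1 (axis i c) = \<bar>real_of_int c\<bar>"
proof -
  have "(\<Sum>j\<in>UNIV. \<bar>axis i c $ j\<bar>) = (\<Sum>j\<in>UNIV. if j = i then \<bar>c\<bar> else 0)"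
    by (rule sum.cong) (auto simp: axis_def)
  then show ?thesis by (simp add: l1_def)
qed

lemma lattice_adj_iff_l1: "lattice_adj u v \<longleftrightarrow> l1 (u - v) = 1"
  by (simp add: lattice_adj_def l1_def flip: of_int_sum of_int_abs of_int_diff)

lemma lattice_adj_commute: "lattice_adj u v \<longleftrightarrow> lattice_adj v u"
  by (simp add: lattice_adj_iff_l1 l1_minus_commute)

lemma path_time_single [simp]: "path_time \<omega> [x] = 0"
  by (simp add: path_time_def)

lemma path_time_Nil [simp]: "path_time \<omega> [] = 0"
  by (simp add: path_time_def)

lemma path_time_Cons [simp]:
  "path_time \<omega> (x # y # zs) = edge_time \<omega> x y + path_time \<omega> (y # zs)"
proof -
  have "path_time \<omega> (x # y # zs) = (\<Sum>k<Suc (length zs). edge_time \<omega> ((x # y # zs) ! k) ((y # zs) ! k))"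
    by (simp add: path_time_def)
  also have "\<dots> = edge_time \<omega> x y + (\<Sum>k<length zs. edge_time \<omega> ((y # zs) ! k) (zs ! k))"
    by (subst sum.lessThan_Suc_shift) simp
  finally show ?thesis by (simp add: path_time_def)
qed

lemma path_time_join: "path_time \<omega> (xs @ y # ys) = path_time \<omega> (xs @ [y]) + path_time \<omega> (y # ys)"
proof (induction xs)
  case (Cons x xs) then show ?case by (cases xs) auto
qed simp

lemma edge_time_nonneg [simp]: "0 \<le> edge_time \<omega> x y" and edge_time_le_1 [simp]: "edge_time \<omega> x y \<le> 1"
  by (simp_all add: edge_time_def)

lemma path_time_nonneg [simp]: "0 \<le> path_time \<omega> \<gamma>"
  by (simp add: path_time_def sum_nonneg)

lemma path_time_le_length: "path_time \<omega> \<gamma> \<le> real (length \<gamma> - 1)"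
  unfolding path_time_def by (rule order_trans[OF sum_bounded_above[where K=1]]) auto

lemma path_time_nat: "path_time \<omega> \<gamma> \<in> \<nat>"
proof -
  have "path_time \<omega> \<gamma> = of_nat (\<Sum>k<length \<gamma> - 1. if \<omega> (\<gamma> ! k) \<noteq> \<omega> (\<gamma> ! Suc k) then 1 else 0)"
    unfolding path_time_def of_nat_sum by (rule sum.cong) (auto simp: edge_time_def)
  then show ?thesis by (simp only: of_nat_in_Nats)
qed

lemma path_time_map: "path_time \<omega> (map \<phi> \<gamma>) = path_time (\<lambda>u. \<omega> (\<phi> u)) \<gamma>"
  by (simp add: path_time_def edge_time_def)

lemma path_time_cong: "(\<And>u. u \<in> set \<gamma> \<Longrightarrow> \<omega> u = \<omega>' u) \<Longrightarrow> path_time \<omega> \<gamma> = path_time \<omega>' \<gamma>"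
  unfolding path_time_def edge_time_def by (intro sum.cong refl) (auto simp: less_diff_conv)

text \<open>A site lies on at most two edges of a self-avoiding path, so recoloring it changes at most two
  passage times.\<close>

lemma path_time_recolor:
  assumes "distinct \<gamma>"
  shows "path_time \<omega>' \<gamma> \<le> path_time \<omega> \<gamma> + 2 * real (card {u \<in> set \<gamma>. \<omega> u \<noteq> \<omega>' u})"
proof -
  define b where "b u = (if \<omega> u \<noteq> \<omega>' u then 1 else 0 :: real)" for u
  have "path_time \<omega>' (x # xs) \<le> path_time \<omega> (x # xs) + b x + 2 * sum_list (map b xs)" for x xs
  proof (induction xs arbitrary: x)
    case Nil then show ?case by (simp add: b_def)
  next
    case (Cons y ys)
    have "edge_time \<omega>' x y \<le> edge_time \<omega> x y + b x + b y" by (simp add: edge_time_def b_def)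
    with Cons[of y] show ?case by simp
  qed
  moreover have "b x \<ge> 0" for x by (simp add: b_def)
  ultimately have "path_time \<omega>' (x # xs) \<le> path_time \<omega> (x # xs) + 2 * sum_list (map b (x # xs))" for x xs
    by (smt (verit, best) list.simps(9) sum_list.Cons)
  then have "path_time \<omega>' \<gamma> \<le> path_time \<omega> \<gamma> + 2 * sum_list (map b \<gamma>)"
    by (cases \<gamma>) auto
  also have "sum_list (map b \<gamma>) = sum b (set \<gamma>)"
    using assms by (simp add: sum_list_distinct_conv_sum_set)
  also have "\<dots> = real (card {u \<in> set \<gamma>. \<omega> u \<noteq> \<omega>' u})"
    by (simp add: b_def sum.If_cases Int_def)
  finally show ?thesis .
qed

lemma lattice_paths_join:
  assumes "\<alpha> \<in> lattice_paths u v" "v # \<beta> \<in> lattice_paths v w"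
  shows "\<alpha> @ \<beta> \<in> lattice_paths u w"
    "path_time \<omega> (\<alpha> @ \<beta>) = path_time \<omega> \<alpha> + path_time \<omega> (v # \<beta>)"
proof -
  obtain xs where a: "\<alpha> = xs @ [v]"
    using assms by (auto simp: lattice_paths_def) (metis append_butlast_last_id)
  show "\<alpha> @ \<beta> \<in> lattice_paths u w"
    using assms unfolding a lattice_paths_def 
    by (auto simp: successively_append_iff hd_append split: if_splits)
  show "path_time \<omega> (\<alpha> @ \<beta>) = path_time \<omega> \<alpha> + path_time \<omega> (v # \<beta>)"
    unfolding a using path_time_join[of \<omega> xs v \<beta>] by simp
qed

lemma lattice_paths_Cons: "\<gamma> \<in> lattice_paths u v \<Longrightarrow> \<exists>\<beta>. \<gamma> = u # \<beta>"
  by (cases \<gamma>) (auto simp: lattice_paths_def)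

text \<open>Correct the coordinates one unit at a time.\<close>

lemma straight_path: "\<exists>\<gamma>\<in>lattice_paths u v. real (length \<gamma> - 1) = l1 (u - v)"
proof (induction "nat \<lfloor>l1 (u - v)\<rfloor>" arbitrary: u)
  case 0
  then have "\<lfloor>l1 (u - v)\<rfloor> = 0" by (metis l1_nonneg nat_0_iff nat_le_0 order_antisym zero_le_floor)
  then have "(\<Sum>i\<in>UNIV. \<bar>(u - v) $ i\<bar>) = 0" unfolding l1_def by (simp only: floor_of_int)
  then have "l1 (u - v) = 0" unfolding l1_def by linarith
  then have "u = v" by (simp add: l1_eq_0_iff)
  then show ?case by (intro bexI[of _ "[v]"]) (auto simp: lattice_paths_def)
next
  case (Suc n)
  then have "u \<noteq> v" by (auto simp: l1_def)
  then obtain i where i: "u $ i \<noteq> v $ i" by (auto simp: vec_eq_iff)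
  define w where "w = u + axis i (sgn (v $ i - u $ i))"
  have adj: "lattice_adj u w" using i by (auto simp: lattice_adj_iff_l1 w_def sgn_if)
  have "(\<Sum>j\<in>UNIV. \<bar>(w - v) $ j\<bar>) = (\<Sum>j\<in>UNIV. \<bar>(u - v) $ j\<bar> - (if j = i then 1 else 0))"
    using i by (intro sum.cong refl) (auto simp: w_def axis_def sgn_if)
  also have "\<dots> = (\<Sum>j\<in>UNIV. \<bar>(u - v) $ j\<bar>) - 1" by (simp add: sum_subtractf)
  finally have l: "l1 (w - v) = l1 (u - v) - 1" unfolding l1_def by simp
  then have "nat \<lfloor>l1 (w - v)\<rfloor> = n" using Suc(2) by simp
  from Suc(1)[OF this[symmetric]] obtain \<gamma> where g: "\<gamma> \<in> lattice_paths w v" "real (length \<gamma> - 1) = l1 (w - v)" by auto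
  then obtain \<beta> where b: "\<gamma> = w # \<beta>" using lattice_paths_Cons by blast
  have "u # \<gamma> \<in> lattice_paths u v" using g(1) adj by (auto simp: lattice_paths_def b)
  then show ?case using g(2) l by (intro bexI[of _ "u # \<gamma>"]) (auto simp: b)
qed

text \<open>Confining paths to a finite region turns the passage time into a function of finitely many colors.
  The value is meaningful only if the region contains some path from \<open>u\<close> to \<open>v\<close>.\<close>

definition time_in :: "(int ^ 'd) set \<Rightarrow> (int ^ 'd \<Rightarrow> nat) \<Rightarrow> int ^ 'd \<Rightarrow> int ^ 'd \<Rightarrow> real" where
  "time_in S \<omega> u v = (INF \<gamma>\<in>{\<gamma>\<in>lattice_paths u v. set \<gamma> \<subseteq> S}. path_time \<omega> \<gamma>)"

lemma site_time_eq_time_in: "site_time = time_in UNIV"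
  by (simp add: fun_eq_iff site_time_def time_in_def)

lemma time_in_lower: "\<gamma> \<in> lattice_paths u v \<Longrightarrow> set \<gamma> \<subseteq> S \<Longrightarrow> time_in S \<omega> u v \<le> path_time \<omega> \<gamma>"
  unfolding time_in_def by (rule cINF_lower) (auto intro!: bdd_belowI2[where m=0])

text \<open>Path times are natural numbers, so the infimum is a minimum.\<close>

lemma time_in_attained:
  assumes "\<gamma> \<in> lattice_paths u v" "set \<gamma> \<subseteq> S"
  obtains \<delta> where "\<delta> \<in> lattice_paths u v" "set \<delta> \<subseteq> S" "path_time \<omega> \<delta> = time_in S \<omega> u v"
proof -
  define P where "P k \<longleftrightarrow> (\<exists>\<delta>. \<delta> \<in> lattice_paths u v \<and> set \<delta> \<subseteq> S \<and> path_time \<omega> \<delta> = real k)" for k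
  obtain k where "path_time \<omega> \<gamma> = real k" using path_time_nat[of \<omega> \<gamma>] by (auto elim: Nats_cases)
  then have "P k" using assms unfolding P_def by blast
  then have "P (Least P)" by (rule LeastI)
  then obtain \<delta> where d: "\<delta> \<in> lattice_paths u v" "set \<delta> \<subseteq> S" "path_time \<omega> \<delta> = real (Least P)"
    unfolding P_def by blast
  have "path_time \<omega> \<delta> \<le> path_time \<omega> \<epsilon>" if "\<epsilon> \<in> lattice_paths u v" "set \<epsilon> \<subseteq> S" for \<epsilon>
  proof -
    obtain j where j: "path_time \<omega> \<epsilon> = real j" using path_time_nat[of \<omega> \<epsilon>] by (auto elim: Nats_cases)
    then have "P j" using that unfolding P_def by blast
    then have "Least P \<le> j" by (rule Least_le)
    then show ?thesis using j d by simp
  qed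
  then have "path_time \<omega> \<delta> \<le> time_in S \<omega> u v"
    unfolding time_in_def using assms by (intro cINF_greatest) auto
  with time_in_lower[OF d(1,2), of \<omega>] show ?thesis by (intro that[of \<delta>]) (use d in auto)
qed

lemma time_in_cong:
  assumes "\<And>u. u \<in> S \<Longrightarrow> \<omega> u = \<omega>' u"
  shows "time_in S \<omega> u v = time_in S \<omega>' u v"
  unfolding time_in_def by (rule INF_cong[OF refl]) (use assms in \<open>auto intro: path_time_cong\<close>)

lemma site_time_lower: "\<gamma> \<in> lattice_paths u v \<Longrightarrow> site_time \<omega> u v \<le> path_time \<omega> \<gamma>"
  by (simp add: site_time_eq_time_in time_in_lower)

lemma site_time_attained:
  obtains \<gamma> where "\<gamma> \<in> lattice_paths u v" "path_time \<omega> \<gamma> = site_time \<omega> u v"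
  using straight_path[of u v] time_in_attained[where u=u and v=v and S=UNIV and \<omega>=\<omega>]
  by (metis site_time_eq_time_in subset_UNIV)

lemma site_time_nonneg [simp]: "0 \<le> site_time \<omega> u v"
  by (metis site_time_attained path_time_nonneg)

lemma site_time_le_time_in:
  assumes "\<gamma> \<in> lattice_paths u v" "set \<gamma> \<subseteq> S"
  shows "site_time \<omega> u v \<le> time_in S \<omega> u v"
  using time_in_attained[OF assms] by (metis site_time_lower)

lemma site_time_le_l1: "site_time \<omega> u v \<le> l1 (u - v)"
  using straight_path[of u v] path_time_le_length site_time_lower by (metis order_trans)

lemma site_time_refl [simp]: "site_time \<omega> u u = 0"
  using site_time_le_l1[of \<omega> u u] site_time_nonneg[of \<omega> u u] by simp

lemma site_time_triangle: "site_time \<omega> u w \<le> site_time \<omega> u v + site_time \<omega> v w"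
proof -
  obtain \<alpha> where a: "\<alpha> \<in> lattice_paths u v" "path_time \<omega> \<alpha> = site_time \<omega> u v" by (rule site_time_attained)
  obtain \<beta> where b: "\<beta> \<in> lattice_paths v w" "path_time \<omega> \<beta> = site_time \<omega> v w" by (rule site_time_attained)
  obtain \<beta>' where "\<beta> = v # \<beta>'" using b lattice_paths_Cons by blast
  then show ?thesis using lattice_paths_join[of \<alpha> u v \<beta>' w] site_time_lower[of "\<alpha> @ \<beta>'" u w \<omega>] a b by simp
qed

text \<open>The triangle inequality, used twice. It absorbs every rounding of an endpoint below.\<close>

lemma site_time_perturb:
  "\<bar>site_time \<omega> u v - site_time \<omega> u' v'\<bar> \<le> l1 (u - u') + l1 (v - v')"
proof -
  have "site_time \<omega> u v \<le> l1 (u - u') + site_time \<omega> u' v' + l1 (v - v')" for u v u' v'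
    using site_time_triangle[of \<omega> u v u'] site_time_triangle[of \<omega> u' v v']
      site_time_le_l1[of \<omega> u u'] site_time_le_l1[of \<omega> v' v] l1_minus_commute[of v v'] by linarith
  from this[of u v u' v'] this[of u' v' u v] show ?thesis
    by (simp add: l1_minus_commute[of u' u] l1_minus_commute[of v' v] abs_le_iff)
qed

text \<open>An automorphism of the lattice maps paths to paths. It is applied to translations, reflections and
  permutations of the coordinates.\<close>

lemma site_time_reindex:
  assumes "bij \<phi>" and adj: "\<And>u v. lattice_adj (\<phi> u) (\<phi> v) \<longleftrightarrow> lattice_adj u v"
  shows "site_time (\<lambda>u. \<omega> (\<phi> u)) u v = site_time \<omega> (\<phi> u) (\<phi> v)"
proof (rule antisym)
  obtain \<gamma> where g: "\<gamma> \<in> lattice_paths (\<phi> u) (\<phi> v)" "path_time \<omega> \<gamma> = site_time \<omega> (\<phi> u) (\<phi> v)"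
    by (rule site_time_attained)
  define \<delta> where "\<delta> = map (inv \<phi>) \<gamma>"
  have gd: "\<gamma> = map \<phi> \<delta>" using \<open>bij \<phi>\<close> by (simp add: \<delta>_def bij_is_surj surj_f_inv_f o_def)
  have inj: "\<phi> x = \<phi> y \<longleftrightarrow> x = y" for x y using \<open>bij \<phi>\<close> by (simp add: bij_is_inj inj_eq)
  have "\<delta> \<in> lattice_paths u v"
    using g(1) unfolding gd by (auto simp: lattice_paths_def hd_map last_map successively_map adj inj)
  then show "site_time (\<lambda>u. \<omega> (\<phi> u)) u v \<le> site_time \<omega> (\<phi> u) (\<phi> v)"
    using g(2) unfolding gd path_time_map by (metis site_time_lower)
next
  obtain \<gamma> where g: "\<gamma> \<in> lattice_paths u v" "path_time (\<lambda>u. \<omega> (\<phi> u)) \<gamma> = site_time (\<lambda>u. \<omega> (\<phi> u)) u v"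
    by (rule site_time_attained)
  have "map \<phi> \<gamma> \<in> lattice_paths (\<phi> u) (\<phi> v)"
    using g(1) by (auto simp: lattice_paths_def hd_map last_map successively_map adj)
  then show "site_time \<omega> (\<phi> u) (\<phi> v) \<le> site_time (\<lambda>u. \<omega> (\<phi> u)) u v"
    using g(2) site_time_lower[of "map \<phi> \<gamma>" "\<phi> u" "\<phi> v" \<omega>] by (simp add: path_time_map)
qed

lemma site_time_shift: "site_time (\<lambda>u. \<omega> (u + a)) u v = site_time \<omega> (u + a) (v + a)"
  by (rule site_time_reindex[where \<phi>="\<lambda>u. u + a"])
     (auto simp: lattice_adj_iff_l1 intro!: bij_plus_right)

text \<open>Cutting out a loop does not increase the time of a path, so a shortest optimal path repeats no site.\<close>

lemma site_time_attained_distinct: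
  obtains \<gamma> where "\<gamma> \<in> lattice_paths u v" "path_time \<omega> \<gamma> = site_time \<omega> u v" "distinct \<gamma>"
proof -
  define Q where "Q \<gamma> \<longleftrightarrow> \<gamma> \<in> lattice_paths u v \<and> path_time \<omega> \<gamma> = site_time \<omega> u v" for \<gamma>
  obtain \<gamma>0 where "Q \<gamma>0" unfolding Q_def using site_time_attained by metis
  define \<gamma> where "\<gamma> = arg_min length Q"
  have Q: "Q \<gamma>" unfolding \<gamma>_def using \<open>Q \<gamma>0\<close> by (rule arg_min_natI)
  have min: "length \<gamma> \<le> length \<delta>" if "Q \<delta>" for \<delta> unfolding \<gamma>_def using that by (rule arg_min_nat_le)
  have "distinct \<gamma>"
  proof (rule ccontr)
    assume "\<not> distinct \<gamma>"
    then obtain xs ys zs y where g: "\<gamma> = xs @ [y] @ ys @ [y] @ zs" using not_distinct_decomp by blast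
    let ?d = "xs @ [y] @ zs"
    have "?d \<in> lattice_paths u v" using Q unfolding Q_def g
      by (auto simp: lattice_paths_def successively_append_iff successively_Cons hd_append last_append split: if_splits)
    moreover have "path_time \<omega> ?d \<le> path_time \<omega> \<gamma>"
      unfolding g using path_time_join[of \<omega> xs y zs] path_time_join[of \<omega> xs y "ys @ [y] @ zs"]
        path_time_join[of \<omega> "y # ys" y zs] path_time_nonneg[of \<omega> "y # ys @ [y]"] by simp
    ultimately have "Q ?d" using Q site_time_lower unfolding Q_def by (metis order_antisym)
    from min[OF this] show False by (simp add: g)
  qed
  then show ?thesis using that Q unfolding Q_def by blast
qed

section \<open>Product measures of independent colors\<close>

lemma indep_vars_PiM_coords:
  assumes "prob_space M"
  shows "prob_space.indep_vars (PiM UNIV (\<lambda>_::'v. M)) (\<lambda>_. M) (\<lambda>u \<omega>. \<omega> u) UNIV"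
proof -
  interpret M: prob_space M by fact
  interpret product_prob_space "\<lambda>_::'v. M" UNIV by unfold_locales
  have "distr (PiM UNIV (\<lambda>_::'v. M)) (PiM UNIV (\<lambda>_. M)) (\<lambda>\<omega>. \<lambda>u\<in>UNIV. \<omega> u) = PiM UNIV (\<lambda>_. M)"
    unfolding restrict_UNIV by (rule distr_id2) (rule refl)
  also have "\<dots> = PiM UNIV (\<lambda>u. distr (PiM UNIV (\<lambda>_::'v. M)) M (\<lambda>\<omega>. \<omega> u))"
    by (rule PiM_cong[OF refl], rule PiM_component[symmetric]) simp
  finally show ?thesis
    by (rule P.indep_vars_iff_distr_eq_PiM'[THEN iffD2, rotated 2]) simp_all
qed

text \<open>The image coordinates remain independent, and a family of independent variables has a product law.\<close>

lemma distr_PiM_map: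
  fixes f :: "'a \<Rightarrow> 'b"
  assumes "prob_space M" and f: "f \<in> measurable M N"
  shows "distr (PiM UNIV (\<lambda>_::'v. M)) (PiM UNIV (\<lambda>_. N)) (\<lambda>\<omega> u. f (\<omega> u)) = PiM UNIV (\<lambda>_. distr M N f)"
proof -
  interpret M: prob_space M by fact
  interpret product_prob_space "\<lambda>_::'v. M" UNIV by unfold_locales
  have comp: "distr (PiM UNIV (\<lambda>_::'v. M)) M (\<lambda>\<omega>. \<omega> u) = M" for u
    by (rule PiM_component) simp
  have "P.indep_vars (\<lambda>_. M) (\<lambda>u \<omega>. \<omega> u) UNIV"
    by (rule indep_vars_PiM_coords) fact
  then have "P.indep_vars (\<lambda>_. N) (\<lambda>u \<omega>. f (\<omega> u)) UNIV"
    by (rule P.indep_vars_compose2) (rule f)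
  then have "distr (PiM UNIV (\<lambda>_::'v. M)) (PiM UNIV (\<lambda>_. N)) (\<lambda>\<omega>. \<lambda>u\<in>UNIV. f (\<omega> u))
      = PiM UNIV (\<lambda>u. distr (PiM UNIV (\<lambda>_::'v. M)) N (\<lambda>\<omega>. f (\<omega> u)))"
    by (subst (asm) P.indep_vars_iff_distr_eq_PiM') (use f in simp_all)
  moreover have "distr (PiM UNIV (\<lambda>_::'v. M)) N (\<lambda>\<omega>. f (\<omega> u)) = distr M N f" for u
    using distr_distr[OF f, of "\<lambda>\<omega>. \<omega> u" "PiM UNIV (\<lambda>_::'v. M)"] by (simp add: comp o_def)
  ultimately show ?thesis by (simp only: restrict_UNIV)
qed

text \<open>Laws of a single color are given as probability mass functions, on an arbitrary type, so that the same
  facts serve colorings and pairs of coupled colorings.\<close>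

definition iid :: "'c pmf \<Rightarrow> ('v \<Rightarrow> 'c) measure" where
  "iid P = PiM UNIV (\<lambda>_. measure_pmf P)"

lemma space_iid [simp]: "space (iid P) = UNIV"
  by (simp add: iid_def space_PiM PiE_UNIV_domain)

lemma prob_space_iid: "prob_space (iid P)"
  unfolding iid_def by (rule prob_space_PiM) unfold_locales

lemma iid_recolor:
  shows measurable_recolor: "(\<lambda>\<omega> u. f (\<omega> u)) \<in> measurable (iid P) (iid (map_pmf f P))"
    and distr_recolor: "distr (iid P) (iid (map_pmf f P)) (\<lambda>\<omega> (u::'v). f (\<omega> u)) = iid (map_pmf f P)"
proof -
  have [measurable]: "f \<in> measurable (measure_pmf P) (measure_pmf (map_pmf f P))" by simp
  show "(\<lambda>\<omega> u. f (\<omega> u)) \<in> measurable (iid P) (iid (map_pmf f P))"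
    unfolding iid_def by (rule measurable_PiM_single') 
      (auto simp: space_PiM PiE_UNIV_domain intro!: measurable_compose[OF measurable_component_singleton])
  have "distr (measure_pmf P) (measure_pmf (map_pmf f P)) f = measure_pmf (map_pmf f P)"
    unfolding map_pmf_rep_eq by (rule distr_cong) simp_all
  then show "distr (iid P) (iid (map_pmf f P)) (\<lambda>\<omega> (u::'v). f (\<omega> u)) = iid (map_pmf f P)"
    unfolding iid_def
    by (subst distr_PiM_map) (auto intro: prob_space_measure_pmf)
qed

lemma iid_reindex:
  assumes "inj \<phi>"
  shows measurable_reindex: "(\<lambda>\<omega> u. \<omega> (\<phi> u)) \<in> measurable (iid P) (iid P)"
    and distr_reindex: "distr (iid P) (iid P) (\<lambda>\<omega> u. \<omega> (\<phi> u)) = iid P"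
proof -
  show "(\<lambda>\<omega> u. \<omega> (\<phi> u)) \<in> measurable (iid P) (iid P)"
    unfolding iid_def by (rule measurable_PiM_single') (auto simp: space_PiM PiE_UNIV_domain)
  show "distr (iid P) (iid P) (\<lambda>\<omega> u. \<omega> (\<phi> u)) = iid P"
    using distr_PiM_reindex[of UNIV "\<lambda>_. measure_pmf P" \<phi> UNIV] assms
    by (simp add: iid_def prob_space_measure_pmf restrict_def)
qed

definition depends_on :: "'v set \<Rightarrow> (('v \<Rightarrow> 'c) \<Rightarrow> 'b) \<Rightarrow> bool" where
  "depends_on S f \<longleftrightarrow> (\<forall>\<omega> \<omega>'. (\<forall>u\<in>S. \<omega> u = \<omega>' u) \<longrightarrow> f \<omega> = f \<omega>')"

lemma depends_on_restrict: "depends_on S f \<Longrightarrow> f (restrict \<omega> S) = f \<omega>"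
  unfolding depends_on_def by (metis restrict_apply')

text \<open>A finite set of sites has only countably many colorings, so every function of them is measurable.\<close>

lemma measurable_local_restrict:
  fixes f :: "('v \<Rightarrow> 'c :: countable) \<Rightarrow> 'b"
  assumes "finite S"
  shows "f \<in> measurable (PiM S (\<lambda>_. measure_pmf P)) (count_space UNIV)"
proof (rule measurableI)
  fix A :: "'b set"
  have c: "countable (S \<rightarrow>\<^sub>E (UNIV :: 'c set))" using assms by (intro countable_PiE) auto
  have single: "{s} \<in> sets (PiM S (\<lambda>_. measure_pmf P))" if "s \<in> S \<rightarrow>\<^sub>E (UNIV :: 'c set)" for s
  proof -
    have "PiE S (\<lambda>u. {s u}) = {s}" using that by (intro PiE_singleton) (simp add: PiE_def)
    then show ?thesis using sets_PiM_I_finite[OF assms, of "\<lambda>u. {s u}" "\<lambda>_. measure_pmf P"] by simp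
  qed
  have sub: "f -` A \<inter> space (PiM S (\<lambda>_. measure_pmf P)) \<subseteq> S \<rightarrow>\<^sub>E UNIV" by (simp add: space_PiM)
  show "f -` A \<inter> space (PiM S (\<lambda>_. measure_pmf P)) \<in> sets (PiM S (\<lambda>_. measure_pmf P))"
    by (rule sets.countable) (fact single[OF subsetD[OF sub]] countable_subset[OF sub c])+
qed simp

lemma measurable_local:
  fixes f :: "('v \<Rightarrow> 'c :: countable) \<Rightarrow> 'b"
  assumes "finite S" "depends_on S f"
  shows "f \<in> measurable (iid P) (count_space UNIV)"
proof -
  have "(\<lambda>\<omega>. restrict \<omega> S) \<in> measurable (iid P) (PiM S (\<lambda>_. measure_pmf P))"
    unfolding iid_def by (rule measurable_restrict_subset) simp
  from measurable_compose[OF this measurable_local_restrict[OF assms(1)], of f]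
  show ?thesis using assms(2) by (simp add: depends_on_restrict)
qed

lemma borel_measurable_local:
  fixes f :: "('v \<Rightarrow> 'c :: countable) \<Rightarrow> real"
  assumes "finite S" "depends_on S f"
  shows "f \<in> borel_measurable (iid P)"
proof -
  have "(\<lambda>x::real. x) \<in> measurable (count_space UNIV) borel" by simp
  from measurable_compose[OF measurable_local[OF assms] this] show ?thesis .
qed

lemma sets_local:
  fixes B :: "('v \<Rightarrow> 'c :: countable) \<Rightarrow> bool"
  assumes "finite S" "depends_on S B"
  shows "{\<omega>. B \<omega>} \<in> sets (iid P)"
  using measurable_sets[OF measurable_local[OF assms], of "{True}" P] by (simp add: vimage_def)

lemma indep_vars_local:
  fixes f :: "'i \<Rightarrow> ('v \<Rightarrow> 'c :: countable) \<Rightarrow> 'b"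
  assumes "\<And>i. i \<in> I \<Longrightarrow> finite (K i)" "\<And>i. i \<in> I \<Longrightarrow> depends_on (K i) (f i)" "disjoint_family_on K I"
  shows "prob_space.indep_vars (iid P) (\<lambda>_. count_space UNIV) f I"
proof -
  interpret prob_space "iid P :: ('v \<Rightarrow> 'c) measure" by (rule prob_space_iid)
  have "indep_vars (\<lambda>_. measure_pmf P) (\<lambda>u \<omega>. \<omega> u) (UNIV :: 'v set)"
    using indep_vars_PiM_coords[OF prob_space_measure_pmf, of P] by (simp only: iid_def)
  then have "indep_vars (\<lambda>i. PiM (K i) (\<lambda>_. measure_pmf P)) (\<lambda>i \<omega>. restrict (\<lambda>u. \<omega> u) (K i)) I"
    by (rule indep_vars_restrict[OF _ subset_UNIV assms(3)])
  then have "indep_vars (\<lambda>_. count_space UNIV) (\<lambda>i \<omega>. f i (restrict (\<lambda>u. \<omega> u) (K i))) I"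
    by (rule indep_vars_compose2) (rule measurable_local_restrict[OF assms(1)])
  then show ?thesis
    by (rule indep_vars_cong[OF refl _ refl, THEN iffD1, rotated]) (simp add: fun_eq_iff depends_on_restrict[OF assms(2)])
qed

lemma prob_local_inter:
  fixes B :: "'i \<Rightarrow> ('v \<Rightarrow> 'c :: countable) \<Rightarrow> bool"
  assumes "finite I" "\<And>i. i \<in> I \<Longrightarrow> finite (K i)" "\<And>i. i \<in> I \<Longrightarrow> depends_on (K i) (B i)" "disjoint_family_on K I"
  shows "measure (iid P) {\<omega>. \<forall>i\<in>I. B i \<omega>} = (\<Prod>i\<in>I. measure (iid P) {\<omega>. B i \<omega>})"
proof (cases "I = {}")
  case False
  interpret prob_space "iid P :: ('v \<Rightarrow> 'c) measure" by (rule prob_space_iid)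
  have "indep_vars (\<lambda>_. count_space UNIV) B I"
    by (rule indep_vars_local) (use assms in auto)
  then have "prob (\<Inter>i\<in>I. B i -` {True} \<inter> space (iid P)) = (\<Prod>i\<in>I. prob (B i -` {True} \<inter> space (iid P)))"
    by (rule indep_varsD) (use assms False in auto)
  moreover have "(\<Inter>i\<in>I. B i -` {True} \<inter> space (iid P)) = {\<omega>. \<forall>i\<in>I. B i \<omega>}" using False by auto
  moreover have "B i -` {True} \<inter> space (iid P) = {\<omega>. B i \<omega>}" for i by auto
  ultimately show ?thesis by simp
qed (use prob_space.prob_space[OF prob_space_iid, of P] in simp)

text \<open>The summands are functions of disjoint finite sets of sites, hence independent; they are identically distributed
  because injective relabelling of the sites preserves the law. Deviations of the average are exponentially unlikely by
  Hoeffding's inequality and therefore stop almost surely by the Borel-Cantelli lemma.\<close>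

lemma slln_local:
  fixes f :: "('v \<Rightarrow> 'c :: countable) \<Rightarrow> real" and \<phi> :: "nat \<Rightarrow> 'v \<Rightarrow> 'v"
  assumes S: "finite S" "depends_on S f" and f: "\<And>\<omega>. 0 \<le> f \<omega>" "\<And>\<omega>. f \<omega> \<le> B"
    and \<phi>: "\<And>i. inj (\<phi> i)" and disj: "disjoint_family (\<lambda>i. \<phi> i ` S)"
  shows "AE \<omega> in iid P. (\<lambda>n. (\<Sum>i<n. f (\<lambda>u. \<omega> (\<phi> i u))) / real n) \<longlonglongrightarrow> (\<integral>\<omega>. f \<omega> \<partial>iid P)"
proof -
  interpret prob_space "iid P :: ('v \<Rightarrow> 'c) measure" by (rule prob_space_iid)
  define X where "X i \<omega> = f (\<lambda>u. \<omega> (\<phi> i u))" for i \<omega>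
  (* B may be 0, but the interval of values has to have positive length *)
  define C where "C = B + 1"
  have C: "C > 0" using f(1)[of undefined] f(2)[of undefined] by (simp add: C_def)
  have dep: "depends_on (\<phi> i ` S) (X i)" for i
    unfolding depends_on_def X_def by (intro allI impI S(2)[unfolded depends_on_def, rule_format]) auto
  have meas: "X i \<in> borel_measurable (iid P)" for i
    by (rule borel_measurable_local[OF _ dep]) (use S in auto)
  note meas[measurable]
  have indep: "indep_vars (\<lambda>_. borel) X I" for I
  proof -
    have "indep_vars (\<lambda>_. count_space UNIV) X I"
      by (rule indep_vars_local[where K="\<lambda>i. \<phi> i ` S"])
         (use S dep disj in \<open>auto simp: disjoint_family_on_def\<close>)
    from indep_vars_compose2[OF this, of "\<lambda>_ x. x" "\<lambda>_. borel"] show ?thesis by simp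
  qed
  have EX: "expectation (X i) = expectation f" for i
  proof -
    have "expectation f = (\<integral>\<omega>. f \<omega> \<partial>distr (iid P) (iid P) (\<lambda>\<omega> u. \<omega> (\<phi> i u)))"
      by (simp only: distr_reindex[OF \<phi>])
    also have "\<dots> = expectation (X i)" unfolding X_def
      by (rule integral_distr) (use measurable_reindex[OF \<phi>] borel_measurable_local[OF S] in auto)
    finally show ?thesis by simp
  qed
  have ev: "AE \<omega> in iid P. eventually (\<lambda>n. \<bar>(\<Sum>i<n. X i \<omega>) / real n - expectation f\<bar> < \<epsilon>) sequentially"
    if e: "\<epsilon> > 0" for \<epsilon>
  proof -
    define A where "A n = {\<omega> \<in> space (iid P). \<bar>(\<Sum>i<n. X i \<omega>) - (\<Sum>i<n. expectation (X i))\<bar> \<ge> real n * \<epsilon>}" for n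
    have A [measurable]: "A n \<in> sets (iid P)" for n unfolding A_def by measurable
    define q where "q = exp (- 2 * \<epsilon>\<^sup>2 / C\<^sup>2)"
    have bound: "prob (A n) \<le> 2 * q ^ n" for n
    proof (cases "n = 0")
      case True then show ?thesis using order_trans[OF prob_le_1[of "A n"], of 2] by simp
    next
      case False
      interpret Hoeffding_ineq "iid P" "{..<n}" X "\<lambda>_. 0" "\<lambda>_. C" "\<Sum>i<n. expectation (X i)"
      proof unfold_locales
        fix i
        show "AE x in iid P. X i x \<in> {0..C}" using f unfolding X_def C_def by (simp add: add_increasing2)
      qed (simp_all add: indep)
      have "prob (A n) \<le> 2 * exp (- 2 * (real n * \<epsilon>)\<^sup>2 / (\<Sum>i<n. (C - 0)\<^sup>2))"
        unfolding A_def by (rule Hoeffding_ineq_abs_ge) (use e C False in auto)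
      also have "- 2 * (real n * \<epsilon>)\<^sup>2 / (\<Sum>i<n. (C - 0)\<^sup>2) = real n * (- 2 * \<epsilon>\<^sup>2 / C\<^sup>2)"
        using False C by (simp add: field_simps power2_eq_square)
      finally show ?thesis by (simp only: q_def exp_of_nat_mult)
    qed
    have "summable (\<lambda>n. 2 * q ^ n)" using e C by (intro summable_mult summable_geometric) (simp add: q_def)
    then have "summable (\<lambda>n. prob (A n))"
      by (rule summable_comparison_test_ev[rotated]) (use bound in auto)
    then have "AE \<omega> in iid P. eventually (\<lambda>n. \<omega> \<in> space (iid P) - A n) sequentially"
      by (intro borel_cantelli_AE1) (auto simp: emeasure_eq_measure)
    then show ?thesis
    proof (rule AE_mp, intro AE_I2 impI)
      fix \<omega> assume "eventually (\<lambda>n. \<omega> \<in> space (iid P) - A n) sequentially"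
      then show "eventually (\<lambda>n. \<bar>(\<Sum>i<n. X i \<omega>) / real n - expectation f\<bar> < \<epsilon>) sequentially"
        using eventually_gt_at_top[of 0]
      proof eventually_elim
        case (elim n)
        then have "\<bar>(\<Sum>i<n. X i \<omega>) - real n * expectation f\<bar> < real n * \<epsilon>" by (simp add: A_def EX)
        moreover have "(\<Sum>i<n. X i \<omega>) / real n - expectation f = ((\<Sum>i<n. X i \<omega>) - real n * expectation f) / real n"
          using elim by (simp add: field_simps)
        ultimately show ?case using elim by (simp add: abs_divide pos_divide_less_eq mult.commute)
      qed
    qed
  qed
  have "AE \<omega> in iid P. \<forall>k::nat. eventually (\<lambda>n. \<bar>(\<Sum>i<n. X i \<omega>) / real n - expectation f\<bar> < 1 / real (Suc k)) sequentially"
    unfolding AE_all_countable by (intro allI ev) simp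
  then show ?thesis
  proof (rule AE_mp, intro AE_I2 impI)
    fix \<omega> assume *: "\<forall>k::nat. eventually (\<lambda>n. \<bar>(\<Sum>i<n. X i \<omega>) / real n - expectation f\<bar> < 1 / real (Suc k)) sequentially"
    show "(\<lambda>n. (\<Sum>i<n. f (\<lambda>u. \<omega> (\<phi> i u))) / real n) \<longlonglongrightarrow> expectation f"
    proof (rule tendstoI)
      fix e :: real assume "e > 0"
      then obtain k where k: "1 / real (Suc k) < e" using nat_approx_posE by blast
      from *[rule_format, of k]
      show "eventually (\<lambda>n. dist ((\<Sum>i<n. f (\<lambda>u. \<omega> (\<phi> i u))) / real n) (expectation f) < e) sequentially"
        by eventually_elim (use k in \<open>auto simp: dist_real_def X_def\<close>)
    qed
  qed
qed

lemma borel_measurable_path_time: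
  "(\<lambda>\<omega>. path_time \<omega> \<gamma>) \<in> borel_measurable (iid P)"
  by (rule borel_measurable_local[of "set \<gamma>"]) (auto simp: depends_on_def intro: path_time_cong)

lemma borel_measurable_site_time [measurable]:
  "(\<lambda>\<omega>. site_time \<omega> u v) \<in> borel_measurable (iid P)"
  unfolding site_time_def
  by (rule borel_measurable_cINF) (auto intro!: bdd_belowI2[where m=0] borel_measurable_path_time)

section \<open>The rate in a lattice direction and the upper bound\<close>

definition mean_time :: "nat pmf \<Rightarrow> int ^ 'd \<Rightarrow> real" where
  "mean_time P z = (\<integral>\<omega>. site_time \<omega> 0 z \<partial>iid P)"

text \<open>By subadditivity this infimum is also the limit of the normalized means, see \<open>mean_time_rate\<close>.\<close>

definition time_rate :: "nat pmf \<Rightarrow> int ^ 'd \<Rightarrow> real" where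
  "time_rate P z = (INF n\<in>{1..}. mean_time P (int n *s z) / real n)"

lemma integrable_site_time [simp]:
  fixes u v :: "int ^ 'd"
  shows "integrable (iid P) (\<lambda>\<omega>. site_time \<omega> u v)"
proof -
  interpret prob_space "iid P :: (int ^ 'd \<Rightarrow> nat) measure" by (rule prob_space_iid)
  show ?thesis
    by (rule integrable_const_bound[where B="l1 (u - v)"]) (auto simp: site_time_le_l1)
qed

lemma mean_time_nonneg: "0 \<le> mean_time P z"
  by (simp add: mean_time_def)

lemma time_rate_le_mean: "n \<ge> 1 \<Longrightarrow> time_rate P z \<le> mean_time P (int n *s z) / real n"
  unfolding time_rate_def by (rule cINF_lower) (auto intro!: bdd_belowI2[where m=0] simp: mean_time_nonneg)

lemma time_rate_nonneg: "0 \<le> time_rate P z"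
  unfolding time_rate_def by (rule cINF_greatest) (auto simp: mean_time_nonneg)

lemma time_rate_0 [simp]: "time_rate P 0 = 0"
  using time_rate_le_mean[of 1 P 0] by (intro antisym time_rate_nonneg) (simp add: mean_time_def)

lemma scale_add: "int (m + n) *s z = int m *s z + int n *s (z :: int ^ 'd)"
  by (simp add: vec_eq_iff algebra_simps)

lemma scale_scale: "int m *s (int n *s z) = int (m * n) *s (z :: int ^ 'd)"
  by (simp add: vec_eq_iff)

lemma site_time_multiples:
  "site_time \<omega> (int i *s z) (int j *s z) \<le> \<bar>real i - real j\<bar> * l1 z"
proof -
  have "int i *s z - int j *s z = (int i - int j) *s z" by (simp add: vec_eq_iff algebra_simps)
  from arg_cong[OF this, of l1] have "l1 (int i *s z - int j *s z) = \<bar>real i - real j\<bar> * l1 z"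
    by (simp only: l1_scale of_int_diff of_int_of_nat_eq)
  then show ?thesis using site_time_le_l1[of \<omega> "int i *s z" "int j *s z"] by simp
qed

text \<open>In a coordinate where \<open>v\<close> does not vanish, the steps \<open>L v\<close> exceed the width of \<open>S\<close>.\<close>

lemma disjoint_translates:
  fixes S :: "(int ^ 'd) set"
  assumes "finite S" "v \<noteq> 0"
  obtains L :: nat where "L \<ge> 1" "\<And>r. disjoint_family (\<lambda>j. (\<lambda>u. u + int (j * L + r) *s v) ` S)"
proof -
  obtain i where i: "v $ i \<noteq> 0" using \<open>v \<noteq> 0\<close> by (auto simp: vec_eq_iff)
  define R where "R = (\<Sum>s\<in>S. nat \<bar>s $ i\<bar>)"
  have R: "\<bar>s $ i\<bar> \<le> int R" if "s \<in> S" for s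
    using member_le_sum[of s S "\<lambda>s. nat \<bar>s $ i\<bar>"] assms(1) that by (simp add: R_def del: of_nat_sum)
  define L where "L = 2 * R + 1"
  have "j = k" if st: "s \<in> S" "t \<in> S" and eq: "s + int (j * L + r) *s v = t + int (k * L + r) *s v" for s t j k r
  proof (rule ccontr)
    assume "j \<noteq> k"
    from arg_cong[OF eq, of "\<lambda>x. x $ i"]
    have "s $ i - t $ i = (int k - int j) * int L * v $ i" by (simp add: algebra_simps)
    then have "\<bar>s $ i - t $ i\<bar> = \<bar>int k - int j\<bar> * int L * \<bar>v $ i\<bar>" by (simp add: abs_mult)
    moreover have "\<bar>int k - int j\<bar> * int L * \<bar>v $ i\<bar> \<ge> 1 * int L * 1"
      using \<open>j \<noteq> k\<close> i by (intro mult_mono) auto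
    moreover have "\<bar>s $ i - t $ i\<bar> \<le> 2 * int R" using R[OF st(1)] R[OF st(2)] by linarith
    moreover have "int L = 2 * int R + 1" by (simp add: L_def)
    ultimately show False by linarith
  qed
  then have "disjoint_family (\<lambda>j. (\<lambda>u. u + int (j * L + r) *s v) ` S)" for r
    unfolding disjoint_family_on_def by blast
  then show ?thesis using that[of L] by (simp add: L_def)
qed

text \<open>An optimal path is finite, hence it is contained in all late members of an exhaustion of the lattice by finite sets;
  dominated convergence gives convergence of the means. Every member of the exhaustion contains a fixed straight path, which
  bounds the confined times by \<open>l1 v\<close>.\<close>

lemma local_approximation:
  fixes v :: "int ^ 'd"
  assumes "\<epsilon> > 0"
  obtains S where "finite S" "\<And>\<omega>. site_time \<omega> 0 v \<le> time_in S \<omega> 0 v" "\<And>\<omega>. time_in S \<omega> 0 v \<le> l1 v"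
    "(\<integral>\<omega>. time_in S \<omega> 0 v \<partial>iid P) < mean_time P v + \<epsilon>"
proof -
  interpret prob_space "iid P :: (int ^ 'd \<Rightarrow> nat) measure" by (rule prob_space_iid)
  obtain \<gamma> where \<gamma>: "\<gamma> \<in> lattice_paths 0 v" "real (length \<gamma> - 1) = l1 v"
    using straight_path[of 0 v] by auto
  (* the K-th finite set of the exhaustion, together with the straight path *)
  define S where "S K = set \<gamma> \<union> from_nat ` {..<K::nat}" for K
  have fin: "finite (S K)" for K by (simp add: S_def)
  have sub: "set \<gamma> \<subseteq> S K" for K by (simp add: S_def)
  have low: "site_time \<omega> 0 v \<le> time_in (S K) \<omega> 0 v" for \<omega> K
    by (rule site_time_le_time_in[OF \<gamma>(1) sub])
  have up: "time_in (S K) \<omega> 0 v \<le> l1 v" for \<omega> K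
    using time_in_lower[OF \<gamma>(1) sub, where \<omega>=\<omega>] path_time_le_length[of \<omega> \<gamma>] \<gamma>(2) by (metis order_trans)
  have meas: "(\<lambda>\<omega>. time_in (S K) \<omega> 0 v) \<in> borel_measurable (iid P)" for K
    by (rule borel_measurable_local[OF fin[of K]]) (auto simp: depends_on_def intro: time_in_cong)
  have nn: "0 \<le> time_in (S K) \<omega> 0 v" for \<omega> K using low[of \<omega> K] site_time_nonneg order_trans by blast
  have "(\<lambda>K. time_in (S K) \<omega> 0 v) \<longlonglongrightarrow> site_time \<omega> 0 v" for \<omega>
  proof (rule tendsto_eventually)
    obtain \<delta> where d: "\<delta> \<in> lattice_paths 0 v" "path_time \<omega> \<delta> = site_time \<omega> 0 v" by (rule site_time_attained)
    define K0 where "K0 = Suc (Max (to_nat ` set \<delta>))"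
    have "set \<delta> \<subseteq> S K" if "K \<ge> K0" for K
    proof
      fix x assume "x \<in> set \<delta>"
      then have "to_nat x < K" using that unfolding K0_def by (meson Max_ge finite_imageI finite_set image_eqI le_imp_less_Suc less_le_trans)
      then show "x \<in> S K" unfolding S_def by (metis UnI2 from_nat_to_nat image_eqI lessThan_iff)
    qed
    then have "time_in (S K) \<omega> 0 v = site_time \<omega> 0 v" if "K \<ge> K0" for K
      using time_in_lower[OF d(1), of "S K" \<omega>] low[of \<omega> K] d(2) that by simp
    then show "eventually (\<lambda>K. time_in (S K) \<omega> 0 v = site_time \<omega> 0 v) sequentially"
      by (auto simp: eventually_sequentially)
  qed
  then have "(\<lambda>K. \<integral>\<omega>. time_in (S K) \<omega> 0 v \<partial>iid P) \<longlonglongrightarrow> (\<integral>\<omega>. site_time \<omega> 0 v \<partial>iid P)"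
    by (intro integral_dominated_convergence[where w="\<lambda>_. l1 v"]) (auto simp: meas nn up)
  then have "eventually (\<lambda>K. (\<integral>\<omega>. time_in (S K) \<omega> 0 v \<partial>iid P) < mean_time P v + \<epsilon>) sequentially"
    by (rule order_tendstoD(2)) (use assms in \<open>simp add: mean_time_def\<close>)
  then obtain K where "(\<integral>\<omega>. time_in (S K) \<omega> 0 v \<partial>iid P) < mean_time P v + \<epsilon>"
    by (meson eventually_happens sequentially_bot)
  then show ?thesis by (intro that[of "S K"]) (use fin low up in auto)
qed

lemma sum_residues: "(\<Sum>m<k * L. F m) = (\<Sum>r<L. \<Sum>j<k. F (j * L + r :: nat) :: real)"
proof (induction k)
  case (Suc k)
  have "(\<Sum>m<k * L + b. F m) = (\<Sum>m<k * L. F m) + (\<Sum>r<b. F (k * L + r))" for b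
    by (induction b) auto
  from this[of L] have "(\<Sum>m<Suc k * L. F m) = (\<Sum>m<k * L. F m) + (\<Sum>r<L. F (k * L + r))"
    by (simp add: add.commute)
  then show ?case using Suc by (simp add: sum.distrib)
qed simp

lemma near_optimal_scale:
  assumes "\<epsilon> > 0"
  obtains N where "N \<ge> 1" "mean_time P (int N *s z) / real N < time_rate P z + \<epsilon>"
proof -
  have "\<exists>n\<in>{1..}. mean_time P (int n *s z) / real n < time_rate P z + \<epsilon>"
    using assms unfolding time_rate_def
    by (subst cINF_less_iff[symmetric]) (auto intro!: bdd_belowI2[where m=0] simp: mean_time_nonneg)
  then show ?thesis using that by auto
qed

lemma filterlim_div_at_top:
  assumes "K > (0 :: nat)"
  shows "filterlim (\<lambda>n. n div K) at_top sequentially"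
  unfolding filterlim_at_top
proof
  fix k show "eventually (\<lambda>n. k \<le> n div K) sequentially"
    using eventually_ge_at_top[of "k * K"]
    by eventually_elim (use assms in \<open>simp add: less_eq_div_iff_mult_less_eq\<close>)
qed

text \<open>Cover the way to \<open>n z\<close> by stretches \<open>v = N z\<close> at a nearly optimal scale \<open>N\<close>, each with paths confined to a
  translate of one finite set. Translates whose indices agree modulo \<open>L\<close> are disjoint, so the strong law applies to each
  residue class of stretches.\<close>

lemma limsup_le_time_rate:
  fixes z :: "int ^ 'd"
  assumes "\<epsilon> > 0"
  shows "AE \<omega> in iid P. eventually (\<lambda>n. site_time \<omega> 0 (int n *s z) \<le> real n * (time_rate P z + \<epsilon>)) sequentially"
proof (cases "z = 0")
  case True
  then show ?thesis using assms by (simp)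
next
  case False
  obtain N where N: "N \<ge> 1" "mean_time P (int N *s z) / real N < time_rate P z + \<epsilon> / 4"
    using near_optimal_scale[of "\<epsilon> / 4" P z] assms by auto
  define v where "v = int N *s z"
  have v: "v \<noteq> 0" using False N unfolding v_def by (auto simp: vec_eq_iff)
  obtain S where S: "finite S" "\<And>\<omega>. site_time \<omega> 0 v \<le> time_in S \<omega> 0 v" "\<And>\<omega>. time_in S \<omega> 0 v \<le> l1 v"
    "(\<integral>\<omega>. time_in S \<omega> 0 v \<partial>iid P) < mean_time P v + \<epsilon> / 4"
    using local_approximation[of "\<epsilon> / 4" v P] assms by auto
  define f where "f \<omega> = time_in S \<omega> 0 v" for \<omega>
  define e where "e = (\<integral>\<omega>. f \<omega> \<partial>iid P)"
  obtain L where L: "L \<ge> 1" "\<And>r. disjoint_family (\<lambda>j. (\<lambda>u. u + int (j * L + r) *s v) ` S)"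
    using disjoint_translates[OF S(1) v] by blast
  have "AE \<omega> in iid P. (\<lambda>k. (\<Sum>j<k. f (\<lambda>u. \<omega> (u + int (j * L + r) *s v))) / real k) \<longlonglongrightarrow> e" for r
    unfolding e_def
  proof (rule slln_local[where S=S and B="l1 v" and \<phi>="\<lambda>j u. u + int (j * L + r) *s v"])
    show "depends_on S f" unfolding depends_on_def f_def using time_in_cong by blast
    show "0 \<le> f \<omega>" for \<omega> using S(2)[of \<omega>] site_time_nonneg unfolding f_def by (rule order_trans[rotated])
  qed (use S L in \<open>auto simp: f_def intro: injI\<close>)
  then have "AE \<omega> in iid P. \<forall>r. (\<lambda>k. (\<Sum>j<k. f (\<lambda>u. \<omega> (u + int (j * L + r) *s v))) / real k) \<longlonglongrightarrow> e"
    by (simp add: AE_all_countable)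
  then show ?thesis
  proof (rule AE_mp, intro AE_I2 impI)
    fix \<omega> assume lim: "\<forall>r. (\<lambda>k. (\<Sum>j<k. f (\<lambda>u. \<omega> (u + int (j * L + r) *s v))) / real k) \<longlonglongrightarrow> e"
    define A where "A k = (\<Sum>r<L. (\<Sum>j<k. f (\<lambda>u. \<omega> (u + int (j * L + r) *s v))) / real k)" for k
    have "A \<longlonglongrightarrow> (\<Sum>r<L. e)" unfolding A_def using lim by (intro tendsto_sum) auto
    then have "A \<longlonglongrightarrow> real L * e" by simp
    moreover have "real L * e < real L * (e + \<epsilon> / 4)" using assms L by simp
    ultimately have evA: "eventually (\<lambda>k. A k < real L * (e + \<epsilon> / 4)) sequentially" by (rule order_tendstoD(2))
    have chain: "site_time \<omega> 0 (int m *s v) \<le> (\<Sum>i<m. f (\<lambda>u. \<omega> (u + int i *s v)))" for m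
    proof (induction m)
      case (Suc m)
      have "site_time \<omega> (int m *s v) (int (Suc m) *s v) = site_time (\<lambda>u. \<omega> (u + int m *s v)) 0 v"
        using scale_add[of 1 m v] by (simp add: site_time_shift)
      also have "\<dots> \<le> f (\<lambda>u. \<omega> (u + int m *s v))" unfolding f_def by (rule S(2))
      finally show ?case using Suc site_time_triangle[of \<omega> 0 "int (Suc m) *s v" "int m *s v"] by simp
    qed simp
    (* T(0, n z) is controlled along the multiples of L * N; in between it varies by at most D * l1 z *)
    define D where "D = L * N"
    have D: "D > 0" using L N by (simp add: D_def)
    from eventually_compose_filterlim[OF evA filterlim_div_at_top[OF D]]
    have ev1: "eventually (\<lambda>n. A (n div D) < real L * (e + \<epsilon> / 4)) sequentially" .
    have ev2: "eventually (\<lambda>n. real D * l1 z / (\<epsilon> / 4) \<le> real n) sequentially"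
      by real_asymp
    show "eventually (\<lambda>n. site_time \<omega> 0 (int n *s z) \<le> real n * (time_rate P z + \<epsilon>)) sequentially"
      using ev1 ev2 eventually_ge_at_top[of D]
    proof eventually_elim
      case (elim n)
      define k where "k = n div D"
      have k: "k \<ge> 1" using elim D unfolding k_def by (simp add: less_eq_div_iff_mult_less_eq)
      have kn: "k * D \<le> n" "n < k * D + D" unfolding k_def using D
        by (auto simp: div_times_less_eq_dividend) (metis div_mult_mod_eq add_less_cancel_left mod_less_divisor)
      have "site_time \<omega> 0 (int (k * L) *s v) \<le> real k * A k"
      proof -
        have "site_time \<omega> 0 (int (k * L) *s v) \<le> (\<Sum>m<k * L. f (\<lambda>u. \<omega> (u + int m *s v)))" by (rule chain)
        also have "\<dots> = real k * A k" unfolding sum_residues A_def sum_distrib_left using k by (intro sum.cong) simp_all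
        finally show ?thesis .
      qed
      also have "\<dots> \<le> real k * (real L * (e + \<epsilon> / 4))" using elim unfolding k_def[symmetric] by (intro mult_left_mono) auto
      finally have 1: "site_time \<omega> 0 (int (k * D) *s z) \<le> real (k * L) * (e + \<epsilon> / 4)"
        unfolding v_def scale_scale D_def by (simp add: mult_ac)
      have "site_time \<omega> (int (k * D) *s z) (int n *s z) \<le> \<bar>real (k * D) - real n\<bar> * l1 z"
        by (rule site_time_multiples)
      also have "\<dots> \<le> real D * l1 z" using kn by (intro mult_right_mono) (auto simp flip: of_nat_mult of_nat_add)
      also have "\<dots> \<le> real n * (\<epsilon> / 4)" using elim assms by (simp add: field_simps)
      finally have 2: "site_time \<omega> 0 (int n *s z) \<le> real (k * L) * (e + \<epsilon> / 4) + real n * (\<epsilon> / 4)"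
        using 1 site_time_triangle[of \<omega> 0 "int n *s z" "int (k * D) *s z"] by linarith
      have "e + \<epsilon> / 4 \<le> mean_time P v + \<epsilon> / 2" using S(4) by (simp add: e_def f_def)
      also have "\<dots> \<le> real N * (time_rate P z + \<epsilon> * 3 / 4)"
      proof -
        have "mean_time P v \<le> real N * (time_rate P z + \<epsilon> / 4)" using N by (simp add: v_def field_simps)
        moreover have "\<epsilon> / 2 \<le> real N * (\<epsilon> / 2)" using N assms by simp
        ultimately show ?thesis by (simp add: algebra_simps)
      qed
      finally have "real (k * L) * (e + \<epsilon> / 4) \<le> real (k * L) * (real N * (time_rate P z + \<epsilon> * 3 / 4))"
        by (rule mult_left_mono) simp
      also have "\<dots> = real (k * D) * (time_rate P z + \<epsilon> * 3 / 4)" by (simp add: D_def)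
      also have "\<dots> \<le> real n * (time_rate P z + \<epsilon> * 3 / 4)"
        using kn time_rate_nonneg[of P z] assms by (intro mult_right_mono) (auto simp flip: of_nat_mult)
      finally show ?case using 2 by (simp add: algebra_simps)
    qed
  qed
qed

text \<open>Travel from \<open>j\<close> towards \<open>L\<close>: if a stretch of length at most \<open>M\<close> and speed at most \<open>g\<close> starts at the current
  point, take it, otherwise make one step at cost at most \<open>B\<close>. The last \<open>M\<close> units, where a good stretch might overshoot
  \<open>L\<close>, are paid at full cost.\<close>

lemma greedy_cover:
  fixes t :: "nat \<Rightarrow> nat \<Rightarrow> real"
  assumes tri: "\<And>i j k. t i k \<le> t i j + t j k"
    and lin: "\<And>i j. i \<le> j \<Longrightarrow> t i j \<le> real (j - i) * B" and B: "B \<ge> 0" and g: "g \<ge> 0" and "j \<le> L"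
  shows "t j L \<le> real (L - j) * g + B * real (card {i\<in>{j..<L}. \<not> (\<exists>n\<in>{1..M}. t i (i + n) \<le> real n * g)}) + real M * B"
  using \<open>j \<le> L\<close>
proof (induction "L - j" arbitrary: j rule: less_induct)
  case less
  let ?H = "\<lambda>i. \<not> (\<exists>n\<in>{1..M}. t i (i + n) \<le> real n * g)"
  show ?case
  proof (cases "L - j \<le> M")
    case True
    have "t j L \<le> real (L - j) * B" using less.prems by (rule lin)
    also have "\<dots> \<le> real M * B" using True B by (intro mult_right_mono) auto
    also have "\<dots> \<le> real (L - j) * g + B * real (card {i\<in>{j..<L}. ?H i}) + real M * B"
      using B g by simp
    finally show ?thesis .
  next
    case False
    show ?thesis
    proof (cases "?H j")
      case True
      have "t j L \<le> t j (Suc j) + t (Suc j) L" by (rule tri)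
      also have "\<dots> \<le> B + (real (L - Suc j) * g + B * real (card {i\<in>{Suc j..<L}. ?H i}) + real M * B)"
        using lin[of j "Suc j"] False by (intro add_mono less.hyps) auto
      also have "real (L - Suc j) * g \<le> real (L - j) * g" using g by (intro mult_right_mono) auto
      also have "{i\<in>{j..<L}. ?H i} = insert j {i\<in>{Suc j..<L}. ?H i}" using True False by (auto simp: le_eq_less_or_eq Suc_le_eq)
      then have "real (card {i\<in>{j..<L}. ?H i}) = 1 + real (card {i\<in>{Suc j..<L}. ?H i})" by simp
      ultimately show ?thesis by (simp add: algebra_simps)
    next
      case H: False
      then obtain n where n: "1 \<le> n" "n \<le> M" "t j (j + n) \<le> real n * g" by auto
      have "t j L \<le> t j (j + n) + t (j + n) L" by (rule tri)
      also have "\<dots> \<le> real n * g + (real (L - (j + n)) * g + B * real (card {i\<in>{j + n..<L}. ?H i}) + real M * B)"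
        using n False by (intro add_mono less.hyps) auto
      also have "real (card {i\<in>{j + n..<L}. ?H i}) \<le> real (card {i\<in>{j..<L}. ?H i})"
        by (intro of_nat_mono card_mono) auto
      then have "B * real (card {i\<in>{j + n..<L}. ?H i}) \<le> B * real (card {i\<in>{j..<L}. ?H i})"
        using B by (intro mult_left_mono)
      also have "real (L - (j + n)) = real (L - j) - real n" using n False by (simp add: of_nat_diff)
      ultimately show ?thesis by (simp add: algebra_simps)
    qed
  qed
qed

section \<open>The lower bound and almost sure convergence\<close>

lemma prob_reindex:
  assumes "inj \<phi>" "{\<omega>. Q \<omega>} \<in> sets (iid P)"
  shows "measure (iid P) {\<omega>. Q (\<lambda>u. \<omega> (\<phi> u))} = measure (iid P) {\<omega>. Q \<omega>}"
proof -
  have "measure (iid P) {\<omega>. Q \<omega>} = measure (distr (iid P) (iid P) (\<lambda>\<omega> u. \<omega> (\<phi> u))) {\<omega>. Q \<omega>}"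
    by (simp only: distr_reindex[OF assms(1)])
  also have "\<dots> = measure (iid P) {\<omega>. Q (\<lambda>u. \<omega> (\<phi> u))}"
    by (subst measure_distr) (use assms measurable_reindex[OF assms(1)] in \<open>auto simp: vimage_def\<close>)
  finally show ?thesis by simp
qed

text \<open>Let \<open>A\<close> be the event that \<open>T(0, n z) \<le> n (\<gamma> - 2 \<epsilon>)\<close> for infinitely many \<open>n\<close>. On \<open>A\<close> a stretch of speed
  at most \<open>g = \<gamma> - \<epsilon>\<close> starts at every multiple of \<open>z\<close>, because moving the starting point costs a bounded amount; its
  length is at most \<open>M\<close> except with probability \<open>D M\<close>, which tends to 0. So \<open>greedy_cover\<close> bounds \<open>T(0, L z)\<close> on \<open>A\<close> by
  about \<open>L g\<close>, while off \<open>A\<close> it is at most about \<open>L \<gamma>\<close> by \<open>limsup_le_time_rate\<close>. As the mean is at least \<open>L \<gamma>\<close>, the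
  probability of \<open>A\<close> must vanish.\<close>

lemma liminf_ge_time_rate:
  fixes z :: "int ^ 'd"
  assumes "\<epsilon> > 0"
  shows "AE \<omega> in iid P. eventually (\<lambda>n. real n * (time_rate P z - 2 * \<epsilon>) < site_time \<omega> 0 (int n *s z)) sequentially"
proof -
  interpret prob_space "iid P :: (int ^ 'd \<Rightarrow> nat) measure" by (rule prob_space_iid)
  define \<gamma> where "\<gamma> = time_rate P z"
  define g where "g = \<gamma> - \<epsilon>"
  define B where "B = l1 z"
  have B: "B \<ge> 0" by (simp add: B_def)
  define t where "t \<omega> i j = site_time \<omega> (int i *s z) (int j *s z)" for \<omega> i j
  have t0: "t \<omega> 0 j = site_time \<omega> 0 (int j *s z)" for \<omega> j by (simp add: t_def)
  have t_meas [measurable]: "(\<lambda>\<omega>. t \<omega> i j) \<in> borel_measurable (iid P)" for i j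
    unfolding t_def by measurable
  have t_tri: "t \<omega> i k \<le> t \<omega> i j + t \<omega> j k" for \<omega> i j k unfolding t_def by (rule site_time_triangle)
  have t_lin: "t \<omega> i j \<le> real (j - i) * B" if "i \<le> j" for \<omega> i j
    using site_time_multiples[of \<omega> i z j] that by (simp add: t_def B_def of_nat_diff)
  have t_shift: "t (\<lambda>u. \<omega> (u + int j *s z)) 0 n = t \<omega> j (j + n)" for \<omega> j n
    by (simp add: t_def site_time_shift scale_add add.commute)
  have t_nn: "0 \<le> t \<omega> i j" for \<omega> i j by (simp add: t_def)
  define good where "good M \<omega> \<longleftrightarrow> (\<exists>n\<in>{1..M::nat}. t \<omega> 0 n \<le> real n * g)" for M \<omega>
  define ever where "ever \<omega> \<longleftrightarrow> (\<exists>n\<ge>1. t \<omega> 0 n \<le> real n * g)" for \<omega>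
  define A where "A = {\<omega>. \<forall>m. \<exists>n\<ge>m. t \<omega> 0 n \<le> real n * (g - \<epsilon>)}"
  define D where "D M = prob {\<omega>. ever \<omega> \<and> \<not> good M \<omega>}" for M
  have [measurable]: "Measurable.pred (iid P) (good M)" for M unfolding good_def[abs_def] by measurable
  have [measurable]: "Measurable.pred (iid P) ever" unfolding ever_def[abs_def] by measurable
  have A [measurable]: "A \<in> sets (iid P)"
  proof -
    have "A = {\<omega> \<in> space (iid P). \<forall>m. \<exists>n\<ge>m. t \<omega> 0 n \<le> real n * (g - \<epsilon>)}" by (simp add: A_def)
    also have "\<dots> \<in> sets (iid P)" by measurable
    finally show ?thesis .
  qed
  have D_meas [measurable]: "{\<omega>. ever \<omega> \<and> \<not> good M \<omega>} \<in> sets (iid P)" for M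
  proof -
    have "{\<omega> \<in> space (iid P). ever \<omega> \<and> \<not> good M \<omega>} \<in> sets (iid P)" by measurable
    then show ?thesis by simp
  qed
  have D_lim: "D \<longlonglongrightarrow> 0"
  proof -
    have "(\<lambda>M. prob {\<omega>. ever \<omega> \<and> \<not> good M \<omega>}) \<longlonglongrightarrow> prob (\<Inter>M. {\<omega>. ever \<omega> \<and> \<not> good M \<omega>})"
    proof (rule finite_Lim_measure_decseq)
      show "range (\<lambda>M. {\<omega>. ever \<omega> \<and> \<not> good M \<omega>}) \<subseteq> events" using D_meas by blast
      show "decseq (\<lambda>M. {\<omega>. ever \<omega> \<and> \<not> good M \<omega>})" by (auto simp: decseq_def good_def)
    qed
    also have "(\<Inter>M. {\<omega>. ever \<omega> \<and> \<not> good M \<omega>}) = {}" unfolding ever_def good_def by fastforce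
    finally show ?thesis by (simp add: D_def[abs_def])
  qed
  have "prob A = 0"
  proof (cases "g \<ge> 0")
    case False
    have "A = {}"
    proof (rule ccontr)
      assume "A \<noteq> {}"
      then obtain \<omega> n where "n \<ge> 1" "t \<omega> 0 n \<le> real n * (g - \<epsilon>)" unfolding A_def by blast
      moreover have "real n * (g - \<epsilon>) < 0" using \<open>n \<ge> 1\<close> False assms by (simp add: mult_pos_neg)
      ultimately show False using t_nn[of \<omega> 0 n] by linarith
    qed
    then show ?thesis by simp
  next
    case True
    (* moving the start from 0 to j z costs j * B, which n * \<epsilon> exceeds for large n *)
    have ever_shift: "ever (\<lambda>u. \<omega> (u + int j *s z))" if "\<omega> \<in> A" for \<omega> j
    proof -
      obtain m :: nat where m: "(real j * B + real j * g) / \<epsilon> \<le> real m" using real_arch_simple by blast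
      obtain n where n: "n \<ge> max m (Suc j)" "t \<omega> 0 n \<le> real n * (g - \<epsilon>)" using \<open>\<omega> \<in> A\<close> unfolding A_def by blast
      have "t \<omega> j n \<le> t \<omega> j 0 + t \<omega> 0 n" by (rule t_tri)
      also have "t \<omega> j 0 \<le> real j * B" using site_time_multiples[of \<omega> j z 0] by (simp add: t_def B_def)
      also have "real j * B + t \<omega> 0 n \<le> real j * B + real n * (g - \<epsilon>)" using n by simp
      also have "\<dots> \<le> real (n - j) * g"
      proof -
        have "real m \<le> real n" using n by simp
        with m have "(real j * B + real j * g) / \<epsilon> \<le> real n" by linarith
        then have "real j * B + real j * g \<le> real n * \<epsilon>" using assms by (simp add: field_simps)
        then show ?thesis using n by (simp add: of_nat_diff algebra_simps)
      qed
      finally have "t \<omega> j (j + (n - j)) \<le> real (n - j) * g" using n by simp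
      moreover have "n - j \<ge> 1" using n by linarith
      ultimately show ?thesis unfolding ever_def t_shift by blast
    qed
    define H where "H M j = {\<omega>. ever (\<lambda>u. \<omega> (u + int j *s z)) \<and> \<not> good M (\<lambda>u. \<omega> (u + int j *s z))}" for M j
    have inj: "inj (\<lambda>u. u + int j *s z)" for j by (rule injI) simp
    have H: "prob (H M j) = D M" for M j
      unfolding H_def D_def by (rule prob_reindex[OF inj D_meas])
    have H_meas [measurable]: "H M j \<in> sets (iid P)" for M j
      using measurable_sets[OF measurable_reindex[OF inj] D_meas] by (simp add: H_def vimage_def)
    define e where "e L = expectation (\<lambda>\<omega>. max 0 (t \<omega> 0 L / real L - \<gamma>))" for L
    have e_lim: "e \<longlonglongrightarrow> 0"
    proof -
      have "AE \<omega> in iid P. \<forall>k::nat. eventually (\<lambda>n. t \<omega> 0 n \<le> real n * (\<gamma> + 1 / real (Suc k))) sequentially"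
        unfolding AE_all_countable t0 \<gamma>_def by (intro allI limsup_le_time_rate) simp
      then have "AE \<omega> in iid P. (\<lambda>n. max 0 (t \<omega> 0 n / real n - \<gamma>)) \<longlonglongrightarrow> 0"
      proof (rule AE_mp, intro AE_I2 impI)
        fix \<omega> assume *: "\<forall>k::nat. eventually (\<lambda>n. t \<omega> 0 n \<le> real n * (\<gamma> + 1 / real (Suc k))) sequentially"
        show "(\<lambda>n. max 0 (t \<omega> 0 n / real n - \<gamma>)) \<longlonglongrightarrow> 0"
        proof (rule tendstoI)
          fix r :: real assume "r > 0"
          then obtain k where k: "1 / real (Suc k) < r" using nat_approx_posE by blast
          from *[rule_format, of k] eventually_gt_at_top[of 0]
          show "eventually (\<lambda>n. dist (max 0 (t \<omega> 0 n / real n - \<gamma>)) 0 < r) sequentially"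
          proof eventually_elim
            case (elim n)
            then have "t \<omega> 0 n / real n \<le> \<gamma> + 1 / real (Suc k)" by (simp add: field_simps)
            then show ?case using k \<open>r > 0\<close> by (auto simp: dist_real_def)
          qed
        qed
      qed
      then have "(\<lambda>n. expectation (\<lambda>\<omega>. max 0 (t \<omega> 0 n / real n - \<gamma>))) \<longlonglongrightarrow> expectation (\<lambda>\<omega>. 0)"
      proof (intro integral_dominated_convergence[where w="\<lambda>_. B"])
        fix n show "AE \<omega> in iid P. norm (max 0 (t \<omega> 0 n / real n - \<gamma>)) \<le> B"
        proof (rule AE_I2)
          fix \<omega>
          have "t \<omega> 0 n / real n \<le> B" using t_lin[of 0 n \<omega>] B by (cases "n = 0") (auto simp: field_simps)
          then show "norm (max 0 (t \<omega> 0 n / real n - \<gamma>)) \<le> B" using B time_rate_nonneg[of P z] by (auto simp: \<gamma>_def)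
        qed
      qed auto
      then show ?thesis by (simp add: e_def[abs_def])
    qed
    have main: "\<epsilon> * prob A \<le> B * D M + real M * B / real L + e L" if L: "L \<ge> 1" for L M
    proof -
      (* greedy_cover on A, and the definition of the positive part off A *)
      have pt: "t \<omega> 0 L \<le> indicator A \<omega> * (real L * g) + B * (\<Sum>j<L. indicator (H M j) \<omega>) + real M * B
          + (1 - indicator A \<omega>) * (real L * \<gamma>) + real L * max 0 (t \<omega> 0 L / real L - \<gamma>)" for \<omega>
      proof (cases "\<omega> \<in> A")
        case True
        have "t \<omega> 0 L \<le> real (L - 0) * g + B * real (card {i\<in>{0..<L}. \<not> (\<exists>n\<in>{1..M}. t \<omega> i (i + n) \<le> real n * g)}) + real M * B"
          by (rule greedy_cover) (use t_tri t_lin B \<open>g \<ge> 0\<close> in auto)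
        also have "{i\<in>{0..<L}. \<not> (\<exists>n\<in>{1..M}. t \<omega> i (i + n) \<le> real n * g)} = {i\<in>{0..<L}. \<omega> \<in> H M i}"
          using ever_shift[OF True] by (auto simp: H_def good_def t_shift)
        also have "real (card {i\<in>{0..<L}. \<omega> \<in> H M i}) = (\<Sum>j<L. indicator (H M j) \<omega>)"
          by (simp add: indicator_def sum.If_cases Int_def atLeast0LessThan)
        finally have "t \<omega> 0 L \<le> real L * g + B * (\<Sum>j<L. indicator (H M j) \<omega>) + real M * B" by simp
        moreover define X where "X = real L * max 0 (t \<omega> 0 L / real L - \<gamma>)"
        then have "X \<ge> 0" by simp
        ultimately show ?thesis unfolding X_def[symmetric] using True by simp
      next
        case False
        have "t \<omega> 0 L = real L * (t \<omega> 0 L / real L)" using L by simp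
        also have "\<dots> \<le> real L * (\<gamma> + max 0 (t \<omega> 0 L / real L - \<gamma>))" by (intro mult_left_mono) auto
        finally have "t \<omega> 0 L \<le> real L * \<gamma> + real L * max 0 (t \<omega> 0 L / real L - \<gamma>)" by (simp add: distrib_left)
        moreover have "0 \<le> B * (\<Sum>j<L. indicator (H M j) \<omega>) + real M * B" using B by (intro add_nonneg_nonneg mult_nonneg_nonneg sum_nonneg) auto
        ultimately show ?thesis using False by simp
      qed
      have int: "integrable (iid P) (\<lambda>\<omega>. max 0 (t \<omega> 0 L / real L - \<gamma>))"
        by (rule integrable_max) (auto simp: t_def)
      have intA: "integrable (iid P) (indicator A :: _ \<Rightarrow> real)" "integrable (iid P) (indicator (H M j) :: _ \<Rightarrow> real)" for j
        by (rule integrable_real_indicator; simp add: emeasure_eq_measure A H_meas)+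
      have "real L * \<gamma> \<le> expectation (\<lambda>\<omega>. t \<omega> 0 L)"
        using time_rate_le_mean[OF L, of P z] L by (simp add: \<gamma>_def t0 mean_time_def field_simps)
      also have "\<dots> \<le> expectation (\<lambda>\<omega>. indicator A \<omega> * (real L * g) + B * (\<Sum>j<L. indicator (H M j) \<omega>) + real M * B
          + (1 - indicator A \<omega>) * (real L * \<gamma>) + real L * max 0 (t \<omega> 0 L / real L - \<gamma>))"
      proof (rule integral_mono[OF _ _ pt])
        show "integrable (iid P) (\<lambda>\<omega>. t \<omega> 0 L)" by (simp add: t_def)
      qed (use int intA in simp)
      also have "\<dots> = prob A * (real L * g) + B * (\<Sum>j<L. prob (H M j)) + real M * B
          + (1 - prob A) * (real L * \<gamma>) + real L * e L"
        using int intA prob_space by (simp add: e_def)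
      finally have "real L * (\<epsilon> * prob A) \<le> B * (real L * D M) + real M * B + real L * e L"
        by (simp add: H g_def algebra_simps)
      then show ?thesis using L by (simp add: field_simps)
    qed
    have "\<epsilon> * prob A \<le> B * D M" for M
    proof (rule tendsto_lowerbound)
      have "(\<lambda>L. B * D M + real M * B / real L + e L) \<longlonglongrightarrow> B * D M + 0 + 0"
        by (intro tendsto_add tendsto_const e_lim) real_asymp
      then show "(\<lambda>L. B * D M + real M * B / real L + e L) \<longlonglongrightarrow> B * D M" by simp
      show "eventually (\<lambda>L. \<epsilon> * prob A \<le> B * D M + real M * B / real L + e L) sequentially"
        using eventually_ge_at_top[of 1] by eventually_elim (rule main)
    qed simp
    moreover have "(\<lambda>M. B * D M) \<longlonglongrightarrow> B * 0" by (intro tendsto_intros D_lim)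
    ultimately have "\<epsilon> * prob A \<le> B * 0" by (intro tendsto_lowerbound) auto
    then show ?thesis using assms measure_nonneg[of "iid P" A] by (simp add: mult_le_0_iff) 
  qed
  then have "AE \<omega> in iid P. \<omega> \<notin> A"
    by (intro AE_not_in null_setsI) (auto simp: emeasure_eq_measure)
  then show ?thesis
  proof (rule AE_mp, intro AE_I2 impI)
    fix \<omega> assume "\<omega> \<notin> A"
    then obtain m where m: "\<And>n. n \<ge> m \<Longrightarrow> \<not> t \<omega> 0 n \<le> real n * (g - \<epsilon>)" unfolding A_def by blast
    have "g - \<epsilon> = time_rate P z - 2 * \<epsilon>" by (simp add: g_def \<gamma>_def)
    with m show "eventually (\<lambda>n. real n * (time_rate P z - 2 * \<epsilon>) < site_time \<omega> 0 (int n *s z)) sequentially"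
      unfolding eventually_sequentially t0 by (metis not_le)
  qed
qed

theorem site_time_rate:
  fixes z :: "int ^ 'd"
  shows "AE \<omega> in iid P. (\<lambda>n. site_time \<omega> 0 (int n *s z) / real n) \<longlonglongrightarrow> time_rate P z"
proof -
  have "AE \<omega> in iid P. \<forall>k::nat. eventually (\<lambda>n. site_time \<omega> 0 (int n *s z) \<le> real n * (time_rate P z + 1 / real (Suc k))) sequentially"
    unfolding AE_all_countable by (intro allI limsup_le_time_rate) simp
  moreover have "AE \<omega> in iid P. \<forall>k::nat. eventually (\<lambda>n. real n * (time_rate P z - 2 * (1 / real (Suc k))) < site_time \<omega> 0 (int n *s z)) sequentially"
    unfolding AE_all_countable by (intro allI liminf_ge_time_rate) simp
  ultimately show ?thesis
  proof eventually_elim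
    case (elim \<omega>)
    show ?case
    proof (rule tendstoI)
      fix r :: real assume "r > 0"
      then obtain k where k: "1 / real (Suc k) < r / 2" using nat_approx_posE[of "r / 2"] by auto
      from elim(1)[rule_format, of k] elim(2)[rule_format, of k] eventually_gt_at_top[of 0]
      show "eventually (\<lambda>n. dist (site_time \<omega> 0 (int n *s z) / real n) (time_rate P z) < r) sequentially"
      proof eventually_elim
        case (elim n)
        then have "site_time \<omega> 0 (int n *s z) / real n \<le> time_rate P z + 1 / real (Suc k)"
          "time_rate P z - 2 * (1 / real (Suc k)) < site_time \<omega> 0 (int n *s z) / real n"
          by (simp_all add: pos_divide_le_eq pos_less_divide_eq mult.commute)
        then show ?case using k unfolding dist_real_def by linarith
      qed
    qed
  qed
qed

lemma site_time_div_le: "site_time \<omega> 0 (int n *s z) / real n \<le> l1 z"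
  using site_time_multiples[of \<omega> 0 z n] by (cases "n = 0") (simp_all add: field_simps)

corollary mean_time_rate:
  fixes z :: "int ^ 'd"
  shows "(\<lambda>n. mean_time P (int n *s z) / real n) \<longlonglongrightarrow> time_rate P z"
proof -
  interpret prob_space "iid P :: (int ^ 'd \<Rightarrow> nat) measure" by (rule prob_space_iid)
  have "(\<lambda>n. expectation (\<lambda>\<omega>. site_time \<omega> 0 (int n *s z) / real n)) \<longlonglongrightarrow> expectation (\<lambda>\<omega>. time_rate P z)"
  proof (rule integral_dominated_convergence[where w="\<lambda>_. l1 z"])
    show "AE \<omega> in iid P. (\<lambda>n. site_time \<omega> 0 (int n *s z) / real n) \<longlonglongrightarrow> time_rate P z"
      by (rule site_time_rate)
    show "AE \<omega> in iid P. norm (site_time \<omega> 0 (int n *s z) / real n) \<le> l1 z" for n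
      using site_time_div_le[of _ n z] by (intro AE_I2) simp
  qed auto
  then show ?thesis using prob_space by (simp add: mean_time_def)
qed

section \<open>Blocks, walks and animals\<close>

text \<open>It contains the differences between the blocks of adjacent sites (\<open>block_adj\<close>), and the null vector, so that walks can
  be padded to a prescribed length.\<close>

definition near :: "(int ^ 'd) set" where
  "near = {s. \<forall>i. \<bar>s $ i\<bar> \<le> 1}"

lemma finite_box: "finite {u :: int ^ 'd. \<forall>i. a \<le> u $ i \<and> u $ i \<le> b}"
proof -
  have "finite ((\<lambda>f. \<chi> i. f i) ` (PiE (UNIV :: 'd set) (\<lambda>_. {a..b})))"
    by (intro finite_imageI finite_PiE) auto
  moreover have "{u :: int ^ 'd. \<forall>i. a \<le> u $ i \<and> u $ i \<le> b} \<subseteq> (\<lambda>f. \<chi> i. f i) ` (PiE (UNIV :: 'd set) (\<lambda>_. {a..b}))"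
  proof
    fix u :: "int ^ 'd" assume "u \<in> {u. \<forall>i. a \<le> u $ i \<and> u $ i \<le> b}"
    then show "u \<in> (\<lambda>f. \<chi> i. f i) ` (PiE (UNIV :: 'd set) (\<lambda>_. {a..b}))"
      by (intro image_eqI[of _ _ "\<lambda>i. u $ i"]) (auto simp: vec_eq_iff)
  qed
  ultimately show ?thesis by (rule finite_subset[rotated])
qed

lemma finite_near [simp]: "finite near"
  by (rule finite_subset[OF _ finite_box[of "-1" 1]]) (auto simp: near_def abs_le_iff minus_le_iff)

lemma near_0 [simp]: "0 \<in> near"
  by (simp add: near_def)

lemma near_minus: "a - b \<in> near \<longleftrightarrow> b - a \<in> near"
  by (simp add: near_def abs_minus_commute)

lemma card_near_pos: "card near \<ge> 1"
proof -
  have "near \<noteq> {}" using near_0 by blast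
  then show ?thesis by (simp add: Suc_le_eq card_gt_0_iff)
qed

definition walks :: "int ^ 'd \<Rightarrow> nat \<Rightarrow> (int ^ 'd) list set" where
  "walks a n = {w. length w = Suc n \<and> hd w = a \<and> successively (\<lambda>a b. b - a \<in> near) w}"

lemma card_walks:
  fixes a :: "int ^ 'd"
  shows "finite (walks a n) \<and> card (walks a n) \<le> card (near :: (int ^ 'd) set) ^ n"
proof (induction n arbitrary: a)
  case 0
  have "walks a 0 = {[a]}" by (auto simp: walks_def length_Suc_conv)
  then show ?case by simp
next
  case (Suc n)
  have sub: "walks a (Suc n) \<subseteq> (\<Union>s\<in>near. (#) a ` walks (a + s) n)"
  proof
    fix w assume w: "w \<in> walks a (Suc n)"
    then obtain b ys where e: "w = a # b # ys" by (auto simp: walks_def length_Suc_conv)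
    have "b - a \<in> near" "b # ys \<in> walks (a + (b - a)) n" using w by (auto simp: walks_def e)
    then show "w \<in> (\<Union>s\<in>near. (#) a ` walks (a + s) n)"
      unfolding e by (intro UN_I[of "b - a"] imageI)
  qed
  have fin: "finite (\<Union>s\<in>near. (#) a ` walks (a + s) n)" by (simp add: Suc)
  have c1: "card (walks a (Suc n)) \<le> card (\<Union>s\<in>near. (#) a ` walks (a + s) n)" by (rule card_mono[OF fin sub])
  have c2: "card (\<Union>s\<in>near. (#) a ` walks (a + s) n) \<le> (\<Sum>s\<in>near. card ((#) a ` walks (a + s) n))"
    by (rule card_UN_le) simp
  have c3: "(\<Sum>s\<in>near. card ((#) a ` walks (a + s) n)) \<le> (\<Sum>s\<in>(near :: (int ^ 'd) set). card (near :: (int ^ 'd) set) ^ n)"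
  proof (rule sum_mono)
    fix s :: "int ^ 'd"
    have "card ((#) a ` walks (a + s) n) \<le> card (walks (a + s) n)" by (rule card_image_le) (simp add: Suc)
    also have "\<dots> \<le> card (near :: (int ^ 'd) set) ^ n" by (simp add: Suc)
    finally show "card ((#) a ` walks (a + s) n) \<le> card (near :: (int ^ 'd) set) ^ n" .
  qed
  have "card (walks a (Suc n)) \<le> card (near :: (int ^ 'd) set) ^ Suc n"
    using order_trans[OF c1 order_trans[OF c2 c3]] by (simp only: sum_constant power_Suc of_nat_id)
  with finite_subset[OF sub fin] show ?case by (rule conjI)
qed

text \<open>Build the short walk along the given one. Whenever a new block is met, go to it and back from an already visited
  neighbour: two more entries for one more block, however often the original walk returns to old blocks.\<close>

lemma covering_walk_aux:
  assumes "w \<noteq> []" "successively (\<lambda>a b. b - a \<in> near) w"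
  shows "\<exists>w'. w' \<noteq> [] \<and> hd w' = hd w \<and> set w' = set w \<and> successively (\<lambda>a b. b - a \<in> near) w'
    \<and> length w' \<le> 2 * card (set w) - 1"
  using assms
proof (induction w rule: rev_induct)
  case (snoc b w)
  show ?case
  proof (cases "w = []")
    case True then show ?thesis by (intro exI[of _ "[b]"]) simp
  next
    case False
    obtain w' where w': "w' \<noteq> []" "hd w' = hd w" "set w' = set w" "successively (\<lambda>a b. b - a \<in> near) w'"
      "length w' \<le> 2 * card (set w) - 1"
      using snoc False by (auto simp: successively_append_iff)
    have ab: "b - last w \<in> near" using snoc.prems False by (auto simp: successively_append_iff)
    show ?thesis
    proof (cases "b \<in> set w")
      case True
      then show ?thesis using w' False by (intro exI[of _ w']) (auto simp: insert_absorb)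
    next
      case b: False
      have "last w \<in> set w'" using w'(3) False by simp
      then obtain xs ys where e: "w' = xs @ last w # ys" by (meson split_list)
      (* the detour from last w to b and back *)
      let ?v = "xs @ last w # b # last w # ys"
      have "successively (\<lambda>a b. b - a \<in> near) ?v"
        using w'(4) ab near_minus[of b "last w"] unfolding e
        by (auto simp: successively_append_iff successively_Cons)
      moreover have "hd ?v = hd (w @ [b])" using w'(2) False unfolding e by (cases xs) auto
      moreover have "set ?v = set (w @ [b])" using w'(3) unfolding e by auto
      moreover have "card (set w) \<ge> 1" using False by (metis One_nat_def Suc_leI card_gt_0_iff finite_set set_empty)
      then have "length ?v \<le> 2 * card (set (w @ [b])) - 1" using w'(5) b unfolding e by simp
      ultimately show ?thesis by (intro exI[of _ ?v]) auto
    qed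
  qed
qed simp

lemma covering_walk:
  assumes "w \<noteq> []" "successively (\<lambda>a b. b - a \<in> near) w" "card (set w) \<le> k"
  obtains w' where "w' \<in> walks (hd w) (2 * k)" "set w' = set w"
proof -
  obtain v where v: "v \<noteq> []" "hd v = hd w" "set v = set w" "successively (\<lambda>a b. b - a \<in> near) v"
    "length v \<le> 2 * card (set w) - 1" using covering_walk_aux[OF assms(1,2)] by (elim exE conjE)
  have "length v \<le> Suc (2 * k)" using v(5) assms(3) by linarith
  (* repeating the first block brings the walk to the prescribed length *)
  define m where "m = Suc (2 * k) - length v"
  have rep: "successively (\<lambda>a b. b - a \<in> near) (replicate m (hd v) @ v)" for m
  proof (induction m)
    case (Suc m)
    have "hd (replicate m (hd v) @ v) = hd v" by (cases m) auto
    then show ?case using Suc by (simp add: successively_Cons)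
  qed (use v in simp)
  have "length (replicate m (hd v) @ v) = Suc (2 * k)" using \<open>length v \<le> Suc (2 * k)\<close> by (simp add: m_def)
  moreover have "hd (replicate m (hd v) @ v) = hd w" using v(2) by (cases m) simp_all
  ultimately have "replicate m (hd v) @ v \<in> walks (hd w) (2 * k)"
    using rep[of m] by (simp only: walks_def mem_Collect_eq simp_thms)
  moreover have "set (replicate m (hd v) @ v) = set w" 
    using v(1) unfolding v(3)[symmetric] by (cases "m = 0") (simp_all add: insert_absorb)
  ultimately show ?thesis by (rule that)
qed

definition block :: "nat \<Rightarrow> int ^ 'd \<Rightarrow> int ^ 'd" where
  "block N u = (\<chi> i. u $ i div int N)"

definition nbhd :: "nat \<Rightarrow> int ^ 'd \<Rightarrow> (int ^ 'd) set" where
  "nbhd N b = {u. block N u - b \<in> near}"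

text \<open>Residues modulo 3, shifted by one so that there are at most \<open>card near\<close> of them.\<close>

definition residue_class :: "int ^ 'd \<Rightarrow> int ^ 'd" where
  "residue_class b = (\<chi> i. b $ i mod 3 - 1)"

lemma residue_class_near: "residue_class b \<in> near"
proof -
  have "\<bar>x mod 3 - 1\<bar> \<le> 1" for x :: int by (simp add: abs_le_iff)
  then show ?thesis by (simp add: near_def residue_class_def)
qed

lemma residue_pigeonhole:
  fixes G :: "(int ^ 'd) set"
  assumes "finite G"
  obtains c where "card G \<le> card (near :: (int ^ 'd) set) * card {b \<in> G. residue_class b = c}"
proof -
  have cardG: "card G = (\<Sum>c\<in>near. card {b \<in> G. residue_class b = c})"
  proof -
    have "residue_class ` G \<subseteq> near" using residue_class_near by auto
    from sum.group[OF assms finite_near this, of "\<lambda>_. 1 :: nat"] show ?thesis by simp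
  qed
  have "\<exists>c\<in>(near :: (int ^ 'd) set). card G \<le> card (near :: (int ^ 'd) set) * card {b \<in> G. residue_class b = c}"
  proof (rule ccontr)
    let ?s = "card (near :: (int ^ 'd) set)"
    assume "\<not> ?thesis"
    then have *: "\<And>c. c \<in> near \<Longrightarrow> ?s * card {b \<in> G. residue_class b = c} < card G" by auto
    have "(\<Sum>c\<in>(near :: (int ^ 'd) set). ?s * card {b \<in> G. residue_class b = c}) < (\<Sum>c\<in>(near :: (int ^ 'd) set). card G)"
      by (rule sum_strict_mono) (use * near_0 in \<open>auto simp del: near_0\<close>)
    moreover have "(\<Sum>c\<in>(near :: (int ^ 'd) set). ?s * card {b \<in> G. residue_class b = c}) = ?s * card G"
      unfolding cardG by (rule sum_distrib_left[symmetric])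
    ultimately show False by simp
  qed
  then show ?thesis using that by blast
qed

text \<open>Distinct blocks of one residue class are at distance at least 3 in some coordinate.\<close>

lemma nbhd_disjoint:
  assumes "residue_class b = residue_class c" "u \<in> nbhd N b" "u \<in> nbhd N c"
  shows "b = c"
proof -
  have "b $ i = c $ i" for i
  proof -
    have "b $ i mod 3 = c $ i mod 3" using assms(1) by (simp add: residue_class_def vec_eq_iff)
    moreover have "\<bar>block N u $ i - b $ i\<bar> \<le> 1" "\<bar>block N u $ i - c $ i\<bar> \<le> 1"
      using assms(2,3) by (auto simp: nbhd_def near_def)
    then have "\<bar>b $ i - c $ i\<bar> \<le> 2" by linarith
    ultimately show ?thesis by presburger
  qed
  then show ?thesis by (simp add: vec_eq_iff)
qed

lemma block_in_nbhd: "u \<in> nbhd N (block N u)"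
  by (simp add: nbhd_def)

lemma block_translate:
  assumes "N \<ge> 1" shows "block N (u + int N *s b) = block N u + b"
  using assms by (simp add: block_def vec_eq_iff)

lemma nbhd_translate:
  assumes "N \<ge> 1" shows "u + int N *s b \<in> nbhd N b \<longleftrightarrow> u \<in> nbhd N 0"
  using assms by (simp add: nbhd_def block_translate)

lemma div_le_1_bounds:
  fixes x M :: int
  assumes "M > 0" "\<bar>x div M\<bar> \<le> 1"
  shows "- M \<le> x \<and> x < 2 * M"
proof -
  define q r where "q = x div M" and "r = x mod M"
  have x: "x = M * q + r" by (simp add: q_def r_def)
  have r: "0 \<le> r" "r < M" using assms by (simp_all add: r_def)
  have "q = -1 \<or> q = 0 \<or> q = 1" using assms(2) unfolding q_def by linarith
  then show ?thesis by (elim disjE) (use r in \<open>simp_all add: x\<close>)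
qed

lemma div_diff_le_1:
  fixes x y M :: int
  assumes "M > 0" "\<bar>x - y\<bar> \<le> M"
  shows "\<bar>y div M - x div M\<bar> \<le> 1"
proof -
  have *: "y div M \<le> x div M + 1" if "y \<le> x + M" for x y
    using zdiv_mono1[OF that, of M] \<open>M > 0\<close> by simp
  have "y div M \<le> x div M + 1" by (rule *) (use assms in linarith)
  moreover have "x div M \<le> y div M + 1" by (rule *) (use assms in linarith)
  ultimately show ?thesis by linarith
qed

lemma finite_nbhd:
  assumes "N \<ge> 1" shows "finite (nbhd N (b :: int ^ 'd))"
proof -
  have "nbhd N (0 :: int ^ 'd) \<subseteq> {u. \<forall>i. - int N \<le> u $ i \<and> u $ i \<le> 2 * int N}"
  proof
    fix u :: "int ^ 'd" assume u: "u \<in> nbhd N 0"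
    show "u \<in> {u. \<forall>i. - int N \<le> u $ i \<and> u $ i \<le> 2 * int N}"
    proof (intro CollectI allI)
      fix i
      have "\<bar>u $ i div int N\<bar> \<le> 1" using u by (auto simp: nbhd_def near_def block_def)
      then show "- int N \<le> u $ i \<and> u $ i \<le> 2 * int N" using div_le_1_bounds[of "int N" "u $ i"] assms by simp
    qed
  qed
  then have "finite (nbhd N (0 :: int ^ 'd))" using finite_box finite_subset by blast
  moreover have "nbhd N b \<subseteq> (\<lambda>u. u + int N *s b) ` nbhd N 0"
  proof
    fix u assume "u \<in> nbhd N b"
    then have "u - int N *s b \<in> nbhd N 0" using nbhd_translate[OF assms, of "u - int N *s b" b] by simp
    then show "u \<in> (\<lambda>u. u + int N *s b) ` nbhd N 0" by (intro image_eqI[of _ _ "u - int N *s b"]) auto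
  qed
  ultimately show ?thesis by (meson finite_imageI finite_subset)
qed

lemma finite_block_fibre: "N \<ge> 1 \<Longrightarrow> finite {u. block N u = b}"
  by (rule finite_subset[OF _ finite_nbhd[of N b]]) (auto simp: block_in_nbhd)

lemma card_block_fibre:
  fixes b :: "int ^ 'd"
  assumes "N \<ge> 1" shows "card {u. block N u = b} \<le> card {u :: int ^ 'd. block N u = 0}"
proof (rule card_inj_on_le[of "\<lambda>u. u - int N *s b"])
  show "(\<lambda>u. u - int N *s b) ` {u. block N u = b} \<subseteq> {u. block N u = 0}"
  proof
    fix x assume "x \<in> (\<lambda>u. u - int N *s b) ` {u. block N u = b}"
    then obtain u where "x = u - int N *s b" "block N u = b" by blast
    then show "x \<in> {u. block N u = 0}" using block_translate[OF assms, of x b] by simp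
  qed
qed (use assms finite_block_fibre in \<open>auto simp: inj_on_def\<close>)

lemma block_adj:
  assumes "N \<ge> 1" "lattice_adj u v" shows "block N v - block N u \<in> near"
proof -
  have "\<bar>(v $ i div int N) - (u $ i div int N)\<bar> \<le> 1" for i
  proof -
    have "\<bar>u $ i - v $ i\<bar> \<le> (\<Sum>i\<in>UNIV. \<bar>u $ i - v $ i\<bar>)" by (rule member_le_sum) auto
    then have "\<bar>u $ i - v $ i\<bar> \<le> 1" using assms(2) by (simp add: lattice_adj_def)
    then show ?thesis using assms(1) by (intro div_diff_le_1) auto
  qed
  then show ?thesis by (simp add: near_def block_def)
qed

lemma block_path:
  assumes "N \<ge> 1" "successively lattice_adj \<gamma>"
  shows "successively (\<lambda>a b. b - a \<in> near) (map (block N) \<gamma>)"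
  using assms(2) unfolding successively_map
  by (rule successively_mono) (use assms(1) block_adj in auto)

text \<open>A union bound. If a walk meets at least \<open>k / r\<close> bad blocks, then one of the \<open>s\<close> residue classes contains a fraction
  \<open>1 / s\<close> of them; their neighbourhoods are disjoint, so their badness is independent and the chosen set is entirely bad with probability at
  most \<open>\<zeta> ^ k\<close>. There are at most \<open>s ^ (2 k)\<close> walks, each with at most \<open>2 ^ (2 k + 1)\<close> sets of blocks.\<close>

lemma animal_bound:
  fixes Bad :: "int ^ 'd \<Rightarrow> (int ^ 'd \<Rightarrow> 'c :: countable) \<Rightarrow> bool" and N r k :: nat
  defines "s \<equiv> card (near :: (int ^ 'd) set)"
  assumes N: "N \<ge> 1" and dep: "\<And>b. depends_on (nbhd N b) (Bad b)"
    and prob: "\<And>b. measure (iid P) {\<omega>. Bad b \<omega>} \<le> \<zeta> ^ (s * r)" and \<zeta>: "0 \<le> \<zeta>" "\<zeta> \<le> 1"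
  shows "measure (iid P) {\<omega>. \<exists>w\<in>walks 0 (2 * k). k \<le> r * card {b \<in> set w. Bad b \<omega>}} \<le> 2 * (4 * real s ^ 2 * \<zeta>) ^ k"
proof -
  interpret prob_space "iid P :: (int ^ 'd \<Rightarrow> 'c) measure" by (rule prob_space_iid)
  define F where "F w = {E \<in> Pow (set w). (\<forall>b\<in>E. \<forall>c\<in>E. residue_class b = residue_class c) \<and> k \<le> s * r * card E}"
    for w :: "(int ^ 'd) list"
  define I where "I = Sigma (walks (0 :: int ^ 'd) (2 * k)) F"
  define U where "U = (\<lambda>(w :: (int ^ 'd) list, E). {\<omega>. \<forall>b\<in>E. Bad b \<omega>})"
  have finF: "finite (F w)" for w by (simp add: F_def)
  have cardF: "card (F w) \<le> 2 ^ Suc (2 * k)" if "w \<in> walks 0 (2 * k)" for w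
  proof -
    have "card (F w) \<le> card (Pow (set w))" by (rule card_mono) (auto simp: F_def)
    also have "\<dots> = 2 ^ card (set w)" by (simp add: card_Pow)
    also have "card (set w) \<le> length w" by (rule card_length)
    then have "(2::nat) ^ card (set w) \<le> 2 ^ length w" by (rule power_increasing) simp
    also have "length w = Suc (2 * k)" using that by (simp add: walks_def)
    finally show ?thesis .
  qed
  have finI: "finite I" unfolding I_def by (intro finite_SigmaI) (use card_walks finF in auto)
  have "card I = (\<Sum>w\<in>walks (0 :: int ^ 'd) (2 * k). card (F w))" unfolding I_def
    by (rule card_SigmaI) (use card_walks finF in auto)
  also have "\<dots> \<le> (\<Sum>w\<in>walks (0 :: int ^ 'd) (2 * k). 2 ^ Suc (2 * k))" by (rule sum_mono) (rule cardF)
  also have "\<dots> \<le> s ^ (2 * k) * 2 ^ Suc (2 * k)" using card_walks[of "0 :: int ^ 'd" "2 * k"] unfolding s_def by simp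
  finally have cardI: "card I \<le> s ^ (2 * k) * 2 ^ Suc (2 * k)" .
  have Bad_meas: "{\<omega>. Bad b \<omega>} \<in> events" for b
    by (rule sets_local[OF finite_nbhd[OF N] dep])
  have U_meas: "U i \<in> events" if iI: "i \<in> I" for i
  proof -
    obtain w E where i: "i = (w, E)" "E \<in> F w" using iI by (auto simp: I_def)
    have E: "finite E" using i(2) by (auto simp: F_def intro: finite_subset)
    have "{\<omega> \<in> space (iid P). \<forall>b\<in>E. Bad b \<omega>} \<in> events"
      by (rule sets.sets_Collect_finite_All[OF _ E]) (simp add: Bad_meas)
    then show ?thesis by (simp add: U_def i(1))
  qed
  have U_prob: "prob (U i) \<le> \<zeta> ^ k" if iI: "i \<in> I" for i
  proof -
    obtain w E where i: "i = (w, E)" "E \<in> F w" using iI by (auto simp: I_def)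
    have E: "finite E" "\<And>b c. b \<in> E \<Longrightarrow> c \<in> E \<Longrightarrow> residue_class b = residue_class c" "k \<le> s * r * card E"
    proof -
      show "finite E" using i(2) by (auto simp: F_def intro: finite_subset)
      show "residue_class b = residue_class c" if "b \<in> E" "c \<in> E" for b c
        using i(2) that unfolding F_def by blast
      show "k \<le> s * r * card E" using i(2) by (simp add: F_def)
    qed
    have disj: "disjoint_family_on (nbhd N) E"
      unfolding disjoint_family_on_def using nbhd_disjoint E(2) by blast
    have "prob (U i) = (\<Prod>b\<in>E. prob {\<omega>. Bad b \<omega>})" unfolding U_def i prod.case
      by (rule prob_local_inter[where K="nbhd N", OF E(1) finite_nbhd[OF N] dep disj])
    also have "\<dots> \<le> (\<Prod>b\<in>E. \<zeta> ^ (s * r))" by (rule prod_mono) (use prob in auto)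
    also have "\<dots> = \<zeta> ^ (s * r * card E)" by (simp add: power_mult)
    also have "\<dots> \<le> \<zeta> ^ k" using E(3) \<zeta> by (rule power_decreasing)
    finally show ?thesis .
  qed
  have sub: "{\<omega>. \<exists>w\<in>walks 0 (2 * k). k \<le> r * card {b \<in> set w. Bad b \<omega>}} \<subseteq> (\<Union>i\<in>I. U i)"
  proof
    fix \<omega> assume "\<omega> \<in> {\<omega>. \<exists>w\<in>walks 0 (2 * k). k \<le> r * card {b \<in> set w. Bad b \<omega>}}"
    then obtain w where w: "w \<in> walks 0 (2 * k)" "k \<le> r * card {b \<in> set w. Bad b \<omega>}" by blast
    define G where "G = {b \<in> set w. Bad b \<omega>}"
    have "finite G" by (simp add: G_def)
    then obtain c where c: "card G \<le> s * card {b \<in> G. residue_class b = c}"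
      using residue_pigeonhole[of G] unfolding s_def by blast
    define E where "E = {b \<in> G. residue_class b = c}"
    have "k \<le> r * card G" using w(2) by (simp add: G_def)
    also have "\<dots> \<le> r * (s * card E)" using c unfolding E_def by (rule mult_left_mono) simp
    finally have "k \<le> s * r * card E" by (simp add: mult_ac)
    moreover have "E \<in> Pow (set w)" "\<forall>b\<in>E. \<forall>c\<in>E. residue_class b = residue_class c"
      by (auto simp: E_def G_def)
    ultimately have "E \<in> F w" unfolding F_def by blast
    then have "(w, E) \<in> I" using w(1) by (simp add: I_def)
    moreover have "\<omega> \<in> U (w, E)" by (auto simp: U_def E_def G_def)
    ultimately show "\<omega> \<in> (\<Union>i\<in>I. U i)" by blast
  qed
  have "prob {\<omega>. \<exists>w\<in>walks 0 (2 * k). k \<le> r * card {b \<in> set w. Bad b \<omega>}} \<le> prob (\<Union>i\<in>I. U i)"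
    by (rule finite_measure_mono[OF sub]) (use finI U_meas in auto)
  also have "\<dots> \<le> (\<Sum>i\<in>I. prob (U i))"
    by (rule finite_measure_subadditive_finite[OF finI]) (use U_meas in auto)
  also have "\<dots> \<le> real (card I) * \<zeta> ^ k" using sum_bounded_above[of I "\<lambda>i. prob (U i)" "\<zeta> ^ k"] U_prob by simp
  also have "\<dots> \<le> real (s ^ (2 * k) * 2 ^ Suc (2 * k)) * \<zeta> ^ k"
    using cardI \<zeta> by (intro mult_right_mono of_nat_mono) auto
  also have "\<dots> = 2 * (4 * real s ^ 2 * \<zeta>) ^ k"
  proof -
    have "real (s ^ (2 * k) * 2 ^ Suc (2 * k)) = 2 * ((real s ^ 2) ^ k * 4 ^ k)" by (simp add: power_mult)
    then show ?thesis by (simp only: power_mult_distrib) (simp only: mult_ac)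
  qed
  finally show ?thesis .
qed

section \<open>Monochromatic crossings and two colorings of the same lattice\<close>

text \<open>Its reflexive transitive closure joins the sites of a monochromatic cluster inside \<open>S\<close>.\<close>

definition mono_step :: "(int ^ 'd) set \<Rightarrow> (int ^ 'd \<Rightarrow> nat) \<Rightarrow> (int ^ 'd) rel" where
  "mono_step S X = {(x, y). x \<in> S \<and> y \<in> S \<and> lattice_adj x y \<and> X x = X y}"

text \<open>A monochromatic path runs from the block \<open>b\<close>, inside its neighbourhood, to a site at the edge of the neighbourhood.
  Thus only the colors inside the neighbourhood matter.\<close>

definition crossing :: "nat \<Rightarrow> int ^ 'd \<Rightarrow> (int ^ 'd \<Rightarrow> nat) \<Rightarrow> bool" where
  "crossing N b X \<longleftrightarrow> (\<exists>u v v'. block N u = b \<and> v \<in> nbhd N b \<and> lattice_adj v v' \<and> v' \<notin> nbhd N b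
     \<and> (u, v) \<in> (mono_step (nbhd N b) X)\<^sup>*)"

lemma crossing_depends:
  fixes b :: "int ^ 'd"
  shows "depends_on (nbhd N b) (crossing N b)"
  unfolding depends_on_def
proof (intro allI impI)
  fix X Y :: "int ^ 'd \<Rightarrow> nat" assume "\<forall>u\<in>nbhd N b. X u = Y u"
  then have eq: "mono_step (nbhd N b) X = mono_step (nbhd N b) Y" by (auto simp: mono_step_def)
  show "crossing N b X = crossing N b Y" unfolding crossing_def eq ..
qed

definition has_break :: "'v set \<Rightarrow> ('v \<Rightarrow> nat) \<Rightarrow> 'v list \<Rightarrow> bool" where
  "has_break S X \<gamma> \<longleftrightarrow> (\<exists>xs x y ys. \<gamma> = xs @ x # y # ys \<and> x \<in> S \<and> y \<in> S \<and> X x \<noteq> X y)"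

lemma has_break_append: "has_break S X ys \<Longrightarrow> has_break S X (xs @ ys)"
  unfolding has_break_def by (metis append.assoc)

lemma has_break_rev: "has_break S X (rev \<gamma>) \<Longrightarrow> has_break S X \<gamma>"
proof -
  assume "has_break S X (rev \<gamma>)"
  then obtain xs x y ys where "rev \<gamma> = xs @ x # y # ys" "x \<in> S" "y \<in> S" "X x \<noteq> X y"
    unfolding has_break_def by blast
  then have "\<gamma> = rev ys @ y # x # rev xs" "x \<in> S" "y \<in> S" "X y \<noteq> X x"
    by (auto simp: rev_swap)
  then show ?thesis unfolding has_break_def by blast
qed

text \<open>Until its exit the path stays in the neighbourhood; without a change of color there it would be a crossing.\<close>

lemma exit_has_break:
  assumes "\<not> crossing N b X" "block N u0 = b" "(u0, u) \<in> (mono_step (nbhd N b) X)\<^sup>*" "u \<in> nbhd N b"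
    and "successively lattice_adj (u # ys)" "\<not> set ys \<subseteq> nbhd N b"
  shows "has_break (nbhd N b) X (u # ys)"
  using assms(3-)
proof (induction ys arbitrary: u)
  case (Cons y ys)
  have adj: "lattice_adj u y" using Cons.prems by simp
  have y: "y \<in> nbhd N b"
  proof (rule ccontr)
    assume "y \<notin> nbhd N b"
    then have "crossing N b X" unfolding crossing_def using Cons.prems(1,2) adj assms(2) by blast
    with assms(1) show False ..
  qed
  show ?case
  proof (cases "X u = X y")
    case True
    then have "(u, y) \<in> mono_step (nbhd N b) X" using adj y Cons.prems by (simp add: mono_step_def)
    then have "(u0, y) \<in> (mono_step (nbhd N b) X)\<^sup>*" using Cons.prems(1) by (rule rtrancl_into_rtrancl[rotated])
    then have "has_break (nbhd N b) X (y # ys)" using y Cons.prems by (intro Cons.IH) auto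
    then show ?thesis using has_break_append[of _ _ "y # ys" "[u]"] by simp
  next
    case False
    then show ?thesis unfolding has_break_def using y Cons.prems(2)
      by (intro exI[of _ "[]"] exI[of _ u] exI[of _ y] exI[of _ ys]) simp
  qed
qed simp

text \<open>The path is outside the neighbourhood at some time after or before its visit to the block; in the second case the
  reversed path is used.\<close>

lemma no_crossing_has_break:
  assumes "\<not> crossing N b X" "successively lattice_adj \<gamma>" "u \<in> set \<gamma>" "block N u = b" "w \<in> set \<gamma>" "w \<notin> nbhd N b"
  shows "has_break (nbhd N b) X \<gamma>"
proof -
  obtain xs ys where g: "\<gamma> = xs @ u # ys" using assms(3) by (meson split_list)
  have u: "u \<in> nbhd N b" using assms(4) block_in_nbhd by metis
  have adj: "successively lattice_adj (u # ys)" "successively lattice_adj (u # rev xs)"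
  proof -
    show "successively lattice_adj (u # ys)" using assms(2) unfolding g by (auto simp: successively_append_iff)
    have "successively lattice_adj (rev \<gamma>)" unfolding successively_rev
      using assms(2) by (rule successively_mono) (auto simp: lattice_adj_commute)
    then show "successively lattice_adj (u # rev xs)" unfolding g by (auto simp: successively_append_iff)
  qed
  have "w \<in> set xs \<or> w \<in> set ys" using assms(5,6) u unfolding g by auto
  then show ?thesis
  proof
    assume "w \<in> set ys"
    then have "has_break (nbhd N b) X (u # ys)" using assms u adj by (intro exit_has_break[where u0=u]) auto
    then show ?thesis unfolding g by (rule has_break_append)
  next
    assume "w \<in> set xs"
    then have "has_break (nbhd N b) X (u # rev xs)" using assms u adj by (intro exit_has_break[where u0=u]) auto
    from has_break_append[OF this, of "rev ys"] have "has_break (nbhd N b) X (rev \<gamma>)" unfolding g by simp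
    then show ?thesis by (rule has_break_rev)
  qed
qed

text \<open>Edges found inside disjoint sets are different.\<close>

lemma path_time_ge_breaks:
  assumes "finite D" "disjoint_family_on S D" "\<And>b. b \<in> D \<Longrightarrow> has_break (S b) X \<gamma>"
  shows "real (card D) \<le> path_time X \<gamma>"
proof -
  have "\<exists>k. Suc k < length \<gamma> \<and> \<gamma> ! k \<in> S b \<and> X (\<gamma> ! k) \<noteq> X (\<gamma> ! Suc k)" if b: "b \<in> D" for b
  proof -
    obtain xs x y ys where "\<gamma> = xs @ x # y # ys" "x \<in> S b" "X x \<noteq> X y"
      using assms(3)[OF b] unfolding has_break_def by blast
    then show ?thesis by (intro exI[of _ "length xs"]) (auto simp: nth_append)
  qed
  then obtain k where k: "\<And>b. b \<in> D \<Longrightarrow> Suc (k b) < length \<gamma> \<and> \<gamma> ! k b \<in> S b \<and> X (\<gamma> ! k b) \<noteq> X (\<gamma> ! Suc (k b))"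
    by metis
  define B where "B = {i. i < length \<gamma> - 1 \<and> X (\<gamma> ! i) \<noteq> X (\<gamma> ! Suc i)}"
  have "inj_on k D"
  proof (rule inj_onI)
    fix b c assume bc: "b \<in> D" "c \<in> D" "k b = k c"
    then have "\<gamma> ! k b \<in> S b \<inter> S c" using k[of b] k[of c] by simp
    then show "b = c" using assms(2) bc unfolding disjoint_family_on_def by blast
  qed
  then have "card D = card (k ` D)" by (simp add: card_image)
  also have "\<dots> \<le> card B"
  proof (rule card_mono)
    show "k ` D \<subseteq> B" unfolding B_def using k by (auto simp: less_diff_conv)
  qed (simp add: B_def)
  also have "real (card B) = path_time X \<gamma>"
    unfolding path_time_def edge_time_def B_def by (simp add: sum.If_cases Int_def)
  finally show ?thesis by simp
qed

text \<open>Each further entry adds at most one value, so no cardinality is skipped.\<close>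

lemma prefix_with_card_image:
  assumes "k \<le> card (f ` set \<gamma>)"
  obtains i where "card (f ` set (take i \<gamma>)) = k"
proof -
  define F where "F i = card (f ` set (take i \<gamma>))" for i
  have step: "F (Suc i) \<le> Suc (F i)" for i
  proof (cases "i < length \<gamma>")
    case True
    then have "f ` set (take (Suc i) \<gamma>) = insert (f (\<gamma> ! i)) (f ` set (take i \<gamma>))"
      by (simp add: take_Suc_conv_app_nth)
    then show ?thesis unfolding F_def by (simp add: card_insert_if)
  qed (simp add: F_def)
  define i where "i = (LEAST i. k \<le> F i)"
  have ex: "k \<le> F (length \<gamma>)" using assms by (simp add: F_def)
  then have ki: "k \<le> F i" unfolding i_def by (rule LeastI)
  have "F i = k"
  proof (cases i)
    case 0 then show ?thesis using ki by (simp add: F_def)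
  next
    case (Suc j)
    have "\<not> k \<le> F j" using not_less_Least[of j "\<lambda>i. k \<le> F i"] Suc unfolding i_def by simp
    then show ?thesis using step[of j] ki Suc by simp
  qed
  then show ?thesis using that unfolding F_def by blast
qed

lemma path_time_take: "path_time X (take i \<gamma>) \<le> path_time X \<gamma>"
proof (cases "take i \<gamma> = []")
  case False
  then obtain xs y where t: "take i \<gamma> = xs @ [y]" by (metis rev_exhaust)
  have "\<gamma> = take i \<gamma> @ drop i \<gamma>" by simp
  then have "path_time X \<gamma> = path_time X (xs @ y # drop i \<gamma>)" unfolding t by simp
  also have "\<dots> = path_time X (take i \<gamma>) + path_time X (y # drop i \<gamma>)" unfolding t by (rule path_time_join)
  finally show ?thesis by simp
next
  case True
  show ?thesis unfolding True by simp
qed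

text \<open>Let \<open>\<gamma>\<close> be an optimal self-avoiding path for \<open>X\<close>. If it visited at least \<open>k\<close> blocks, some prefix would visit exactly \<open>k\<close>.
  More than half of these have no crossing, and one residue class contains a fraction \<open>1 / s\<close> of the latter; each of them
  forces a change of color, since \<open>k > s\<close> blocks do not fit into one neighbourhood, and these changes happen on different
  edges. Then \<open>\<gamma>\<close> would cost more than \<open>k / (2 s)\<close>, contrary to the assumption on \<open>T\<close>. So \<open>\<gamma>\<close> visits fewer than
  \<open>k\<close> blocks, fewer than \<open>k / r\<close> of these contain a recolored site, and \<open>path_time_recolor\<close> applies.\<close>

lemma geodesic_comparison:
  fixes X Y :: "int ^ 'd \<Rightarrow> nat" and N k r :: nat
  defines "s \<equiv> card (near :: (int ^ 'd) set)"
  assumes N: "N \<ge> 1" and r: "r \<ge> 1" and k: "s < k" "2 * real s * site_time X 0 v < real k"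
    and crossing: "\<And>w. w \<in> walks 0 (2 * k) \<Longrightarrow> 2 * card {b \<in> set w. crossing N b X} < k"
    and differ: "\<And>w. w \<in> walks 0 (2 * k) \<Longrightarrow> r * card {b \<in> set w. \<exists>u. block N u = b \<and> X u \<noteq> Y u} < k"
  shows "site_time Y 0 v \<le> site_time X 0 v + 2 * real (card {u :: int ^ 'd. block N u = 0}) * real k / real r"
proof -
  obtain \<gamma> where \<gamma>: "\<gamma> \<in> lattice_paths 0 v" "path_time X \<gamma> = site_time X 0 v" "distinct \<gamma>"
    by (rule site_time_attained_distinct)
  have adj: "successively lattice_adj \<gamma>" and ne: "\<gamma> \<noteq> []" and hd: "hd \<gamma> = 0"
    using \<gamma>(1) by (auto simp: lattice_paths_def)
  have block0: "block N 0 = 0" by (simp add: block_def vec_eq_iff)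
  have walk: "\<exists>w\<in>walks 0 (2 * k). set w = block N ` set (take i \<gamma>)"
    if ti: "take i \<gamma> \<noteq> []" "card (block N ` set (take i \<gamma>)) \<le> k" for i
  proof -
    have "successively lattice_adj (take i \<gamma>)"
      using adj successively_append_iff[of lattice_adj "take i \<gamma>" "drop i \<gamma>"] by simp
    then have steps: "successively (\<lambda>a b. b - a \<in> near) (map (block N) (take i \<gamma>))" by (rule block_path[OF N])
    have "map (block N) (take i \<gamma>) \<noteq> []" "card (set (map (block N) (take i \<gamma>))) \<le> k"
      using ti by simp_all
    from covering_walk[OF this(1) steps this(2)]
    obtain w where "w \<in> walks (hd (map (block N) (take i \<gamma>))) (2 * k)" "set w = set (map (block N) (take i \<gamma>))"
      by blast
    moreover have "hd (map (block N) (take i \<gamma>)) = 0"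
      using ti(1) hd block0 by (cases i) (auto simp: hd_map)
    ultimately show ?thesis by auto
  qed
  have few: "card (block N ` set \<gamma>) < k"
  proof (rule ccontr)
    assume "\<not> ?thesis"
    then obtain i where i: "card (block N ` set (take i \<gamma>)) = k"
      using prefix_with_card_image[of k "block N" \<gamma>] by auto
    define \<delta> where "\<delta> = take i \<gamma>"
    (* k > 0, so the prefix is not empty *)
    have "\<delta> \<noteq> []"
    proof
      assume "\<delta> = []"
      then have "k = 0" using i unfolding \<delta>_def by (metis card.empty image_empty list.set(1))
      then show False using k(1) by simp
    qed
    obtain w where w: "w \<in> walks 0 (2 * k)" "set w = block N ` set \<delta>"
      using walk[of i] i \<open>\<delta> \<noteq> []\<close> by (auto simp: \<delta>_def)
    define G where "G = {b \<in> set w. \<not> crossing N b X}"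
    have "finite G" by (simp add: G_def)
    have "card (set w) = card G + card {b \<in> set w. crossing N b X}"
      unfolding G_def by (subst card_Un_disjoint[symmetric]) (auto intro: arg_cong[where f=card])
    then have "k < 2 * card G" using crossing[OF w(1)] i w(2) by (simp add: \<delta>_def)
    obtain c where c: "card G \<le> s * card {b \<in> G. residue_class b = c}"
      using residue_pigeonhole[OF \<open>finite G\<close>] unfolding s_def by blast
    define D where "D = {b \<in> G. residue_class b = c}"
    have adj\<delta>: "successively lattice_adj \<delta>"
      using adj successively_append_iff[of lattice_adj "take i \<gamma>" "drop i \<gamma>"] by (simp add: \<delta>_def)
    have "real (card D) \<le> path_time X \<delta>"
    proof (rule path_time_ge_breaks[where S="nbhd N"])
      show "finite D" using \<open>finite G\<close> by (simp add: D_def)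
      show "disjoint_family_on (nbhd N) D" unfolding disjoint_family_on_def D_def using nbhd_disjoint by blast
      fix b assume "b \<in> D"
      then have b: "b \<in> set w" "\<not> crossing N b X" by (auto simp: D_def G_def)
      then obtain u where u: "u \<in> set \<delta>" "block N u = b" using w(2) by auto
      (* k > s blocks do not all lie around b, so the prefix leaves the neighbourhood of b *)
      have "\<not> block N ` set \<delta> \<subseteq> (\<lambda>a. b + a) ` near"
      proof
        assume "block N ` set \<delta> \<subseteq> (\<lambda>a. b + a) ` near"
        then have "card (block N ` set \<delta>) \<le> card ((\<lambda>a. b + a) ` near)" by (intro card_mono) auto
        also have "\<dots> \<le> s" unfolding s_def by (rule card_image_le) simp
        finally show False using i k by (simp add: \<delta>_def)
      qed
      then obtain x where x: "x \<in> set \<delta>" "block N x \<notin> (\<lambda>a. b + a) ` near" by auto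
      have "x \<notin> nbhd N b"
      proof
        assume "x \<in> nbhd N b"
        then have "block N x - b \<in> near" by (simp add: nbhd_def)
        then have "b + (block N x - b) \<in> (\<lambda>a. b + a) ` near" by (rule imageI)
        then show False using x(2) by simp
      qed
      then show "has_break (nbhd N b) X \<delta>" by (rule no_crossing_has_break[OF b(2) adj\<delta> u x(1)])
    qed
    also have "\<dots> \<le> site_time X 0 v" using path_time_take[of X i \<gamma>] \<gamma>(2) by (simp add: \<delta>_def)
    finally have "real s * real (card D) \<le> real s * site_time X 0 v" by (rule mult_left_mono) simp
    moreover have "real (card G) \<le> real s * real (card D)" using c unfolding D_def by (simp flip: of_nat_mult)
    moreover have "real k < 2 * real (card G)" using \<open>k < 2 * card G\<close> by linarith
    ultimately show False using k(2) by linarith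
  qed
  obtain w where w: "w \<in> walks 0 (2 * k)" "set w = block N ` set \<gamma>"
    using walk[of "length \<gamma>"] few ne by auto
  define E where "E = {b \<in> set w. \<exists>u. block N u = b \<and> X u \<noteq> Y u}"
  define m where "m = card {u :: int ^ 'd. block N u = 0}"
  have "{u \<in> set \<gamma>. X u \<noteq> Y u} \<subseteq> (\<Union>b\<in>E. {u. block N u = b})" using w(2) by (auto simp: E_def)
  then have "card {u \<in> set \<gamma>. X u \<noteq> Y u} \<le> card (\<Union>b\<in>E. {u. block N u = b})"
    by (intro card_mono) (auto simp: E_def finite_block_fibre[OF N])
  also have "\<dots> \<le> (\<Sum>b\<in>E. card {u. block N u = b})" by (rule card_UN_le) (simp add: E_def)
  also have "\<dots> \<le> (\<Sum>b\<in>E. m)" unfolding m_def by (rule sum_mono) (rule card_block_fibre[OF N])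
  finally have "card {u \<in> set \<gamma>. X u \<noteq> Y u} \<le> card E * m" by simp
  then have "real (card {u \<in> set \<gamma>. X u \<noteq> Y u}) \<le> real (card E) * real m"
    unfolding of_nat_mult[symmetric] by (rule of_nat_mono)
  also have "real (card E) \<le> real k / real r"
  proof -
    have "r * card E \<le> k" using differ[OF w(1)] unfolding E_def by (rule less_imp_le)
    then have "real (r * card E) \<le> real k" by (rule of_nat_mono)
    then have "real r * real (card E) \<le> real k" by simp
    then show ?thesis using r by (simp add: field_simps)
  qed
  then have "real (card E) * real m \<le> real k / real r * real m" by (rule mult_right_mono) simp
  finally have card: "real (card {u \<in> set \<gamma>. X u \<noteq> Y u}) \<le> real k / real r * real m" .
  have "site_time Y 0 v \<le> path_time Y \<gamma>" by (rule site_time_lower[OF \<gamma>(1)])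
  also have "\<dots> \<le> path_time X \<gamma> + 2 * real (card {u \<in> set \<gamma>. X u \<noteq> Y u})" by (rule path_time_recolor[OF \<gamma>(3)])
  also have "\<dots> \<le> site_time X 0 v + 2 * (real k / real r * real m)" using card \<gamma>(2) by simp
  finally show ?thesis by (simp add: m_def mult_ac)
qed

section \<open>Rates of coupled color laws\<close>

lemma mean_time_map: "mean_time (map_pmf f \<pi>) z = (\<integral>\<omega>. site_time (\<lambda>u. f (\<omega> u)) 0 z \<partial>iid \<pi>)"
proof -
  have "mean_time (map_pmf f \<pi>) z
      = (\<integral>\<omega>. site_time \<omega> 0 z \<partial>distr (iid \<pi>) (iid (map_pmf f \<pi>)) (\<lambda>\<omega> u. f (\<omega> u)))"
    by (simp only: mean_time_def distr_recolor)
  also have "\<dots> = (\<integral>\<omega>. site_time (\<lambda>u. f (\<omega> u)) 0 z \<partial>iid \<pi>)"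
    by (rule integral_distr[OF measurable_recolor]) measurable
  finally show ?thesis .
qed

lemma integrable_recolored:
  fixes z :: "int ^ 'd"
  shows "integrable (iid \<pi>) (\<lambda>\<omega>. site_time (\<lambda>u. f (\<omega> u)) 0 z)"
proof -
  interpret prob_space "iid \<pi> :: (int ^ 'd \<Rightarrow> 'a) measure" by (rule prob_space_iid)
  have "(\<lambda>\<omega>. site_time (\<lambda>u. f (\<omega> u)) 0 z) \<in> borel_measurable (iid \<pi>)"
    by (rule measurable_compose[OF measurable_recolor]) measurable
  then show ?thesis
    by (intro integrable_const_bound[where B="l1 z"] AE_I2)
       (use site_time_le_l1[where u=0 and v=z] in auto)
qed

text \<open>One direction suffices, as only an upper bound for the probability of a crossing is needed.\<close>

lemma crossing_shift:
  assumes "N \<ge> 1" "crossing N b X" shows "crossing N 0 (\<lambda>u. X (u + int N *s b))"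
proof -
  let ?t = "\<lambda>u. u - int N *s b"
  let ?X = "\<lambda>u. X (u + int N *s b)"
  obtain u v v' where c: "block N u = b" "v \<in> nbhd N b" "lattice_adj v v'" "v' \<notin> nbhd N b"
    "(u, v) \<in> (mono_step (nbhd N b) X)\<^sup>*" using assms(2) unfolding crossing_def by blast
  have nbhd: "?t x \<in> nbhd N 0 \<longleftrightarrow> x \<in> nbhd N b" for x
    using nbhd_translate[OF assms(1), of "?t x" b] by simp
  have "(?t u, ?t v) \<in> (mono_step (nbhd N 0) ?X)\<^sup>*"
    using c(5)
  proof (induction rule: rtrancl_induct)
    case (step y z)
    have "(?t y, ?t z) \<in> mono_step (nbhd N 0) ?X"
      using step(2) unfolding mono_step_def by (simp add: nbhd lattice_adj_iff_l1)
    with step(3) show ?case by (rule rtrancl_into_rtrancl)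
  qed simp
  moreover have "block N (?t u) = 0" using block_translate[OF assms(1), of "?t u" b] c(1) by simp
  moreover have "?t v \<in> nbhd N 0" "?t v' \<notin> nbhd N 0" using c by (simp_all add: nbhd)
  moreover have "lattice_adj (?t v) (?t v')" using c(3) by (simp add: lattice_adj_iff_l1)
  ultimately show ?thesis unfolding crossing_def by blast
qed

lemma sets_walks:
  fixes Bad :: "int ^ 'd \<Rightarrow> (int ^ 'd \<Rightarrow> 'c :: countable) \<Rightarrow> bool"
  assumes "N \<ge> 1" "\<And>b. depends_on (nbhd N b) (Bad b)"
  shows "{\<omega>. \<exists>w\<in>walks 0 (2 * k). k \<le> r * card {b \<in> set w. Bad b \<omega>}} \<in> sets (iid P)"
proof (rule sets_local)
  show "finite (\<Union>w\<in>walks (0 :: int ^ 'd) (2 * k). \<Union>b\<in>set w. nbhd N b)"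
    by (intro finite_UN_I finite_set finite_nbhd[OF assms(1)] conjunct1[OF card_walks])
  show "depends_on (\<Union>w\<in>walks (0 :: int ^ 'd) (2 * k). \<Union>b\<in>set w. nbhd N b)
      (\<lambda>\<omega>. \<exists>w\<in>walks 0 (2 * k). k \<le> r * card {b \<in> set w. Bad b \<omega>})"
    unfolding depends_on_def
  proof (intro allI impI bex_cong refl)
    fix \<omega> \<omega>' :: "int ^ 'd \<Rightarrow> 'c" and w :: "(int ^ 'd) list"
    assume *: "\<forall>u\<in>\<Union>w\<in>walks (0 :: int ^ 'd) (2 * k). \<Union>b\<in>set w. nbhd N b. \<omega> u = \<omega>' u" and w: "w \<in> walks 0 (2 * k)"
    have "Bad b \<omega> = Bad b \<omega>'" if "b \<in> set w" for b
      using assms(2)[of b, unfolded depends_on_def, rule_format, of \<omega> \<omega>'] * w that by blast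
    then have "{b \<in> set w. Bad b \<omega>} = {b \<in> set w. Bad b \<omega>'}" by auto
    then show "(k \<le> r * card {b \<in> set w. Bad b \<omega>}) = (k \<le> r * card {b \<in> set w. Bad b \<omega>'})" by simp
  qed
qed

text \<open>The bound of \<open>animal_bound\<close> for a translation invariant family of events, with \<open>\<zeta>\<close> chosen to
  make its base \<open>1 / 2\<close>.\<close>

lemma animal_bound_half:
  fixes Bad :: "int ^ 'd \<Rightarrow> (int ^ 'd \<Rightarrow> 'c :: countable) \<Rightarrow> bool" and N r k :: nat
  defines "s \<equiv> card (near :: (int ^ 'd) set)"
  assumes N: "N \<ge> 1" and dep: "\<And>b. depends_on (nbhd N b) (Bad b)"
    and shift: "\<And>b \<omega>. Bad b \<omega> \<Longrightarrow> Bad 0 (\<lambda>u. \<omega> (u + int N *s b))"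
    and prob: "measure (iid P) {\<omega>. Bad 0 \<omega>} \<le> (1 / (8 * real s ^ 2)) ^ (s * r)"
  shows "measure (iid P) {\<omega>. \<exists>w\<in>walks 0 (2 * k). k \<le> r * card {b \<in> set w. Bad b \<omega>}} \<le> 2 * (1 / 2) ^ k"
proof -
  interpret prob_space "iid P :: (int ^ 'd \<Rightarrow> 'c) measure" by (rule prob_space_iid)
  have s: "real s \<ge> 1" using card_near_pos[where 'a='d] unfolding s_def by linarith
  have "1 \<le> real s ^ 2" using s by (rule one_le_power)
  then have small: "1 / (8 * real s ^ 2) \<le> 1" by (simp add: divide_le_eq)
  have meas: "{\<omega>. Bad b \<omega>} \<in> events" for b by (rule sets_local[OF finite_nbhd[OF N] dep])
  have inj: "inj (\<lambda>u. u + int N *s b)" for b :: "int ^ 'd" by (rule injI) simp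
  have "prob {\<omega>. Bad b \<omega>} \<le> (1 / (8 * real s ^ 2)) ^ (s * r)" for b
  proof -
    have "prob {\<omega>. Bad b \<omega>} \<le> prob {\<omega>. Bad 0 (\<lambda>u. \<omega> (u + int N *s b))}"
    proof (rule finite_measure_mono)
      show "{\<omega>. Bad b \<omega>} \<subseteq> {\<omega>. Bad 0 (\<lambda>u. \<omega> (u + int N *s b))}" using shift by blast
      show "{\<omega>. Bad 0 (\<lambda>u. \<omega> (u + int N *s b))} \<in> events"
        using measurable_sets[OF measurable_reindex[OF inj] meas, of b 0] by (simp add: vimage_def)
    qed
    also have "\<dots> = prob {\<omega>. Bad 0 \<omega>}" by (rule prob_reindex[OF inj meas])
    finally show ?thesis using prob by simp
  qed
  then have "prob {\<omega>. \<exists>w\<in>walks 0 (2 * k). k \<le> r * card {b \<in> set w. Bad b \<omega>}}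
      \<le> 2 * (4 * real (card (near :: (int ^ 'd) set)) ^ 2 * (1 / (8 * real s ^ 2))) ^ k"
    by (intro animal_bound[OF N dep]) (use small in \<open>simp_all add: s_def\<close>)
  also have "4 * real (card (near :: (int ^ 'd) set)) ^ 2 * (1 / (8 * real s ^ 2)) = 1 / 2"
    using s by (simp add: s_def[symmetric] field_simps)
  finally show ?thesis .
qed

text \<open>Apply \<open>geodesic_comparison\<close> to the target \<open>n z\<close> with \<open>k = C n\<close>; the choice of \<open>C\<close> makes \<open>k\<close> exceed the bound that it needs, as
  \<open>T(0, n z) \<le> n * l1 z\<close>. Its two hypotheses on walks fail with probability at most \<open>4 * (1/2) ^ n\<close>, and then \<open>T \<le> n * l1 z\<close> is
  used instead. Dividing the means by \<open>n\<close> gives the claim in the limit.\<close>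

lemma rate_comparison:
  fixes \<pi> :: "(nat \<times> nat) pmf" and z :: "int ^ 'd" and N r C :: nat
  defines "s \<equiv> card (near :: (int ^ 'd) set)"
  assumes N: "N \<ge> 1" and r: "r \<ge> 1" and C: "2 * real s * l1 z + real s < real C"
    and crossing: "measure (iid \<pi>) {\<omega>. crossing N (0 :: int ^ 'd) (\<lambda>u. fst (\<omega> u))} \<le> (1 / (8 * real s ^ 2)) ^ (s * 2)"
    and differ: "measure (iid \<pi>) {\<omega>. \<exists>u :: int ^ 'd. block N u = 0 \<and> fst (\<omega> u) \<noteq> snd (\<omega> u)} \<le> (1 / (8 * real s ^ 2)) ^ (s * r)"
  shows "time_rate (map_pmf snd \<pi>) z
    \<le> time_rate (map_pmf fst \<pi>) z + 2 * real (card {u :: int ^ 'd. block N u = 0}) * real C / real r"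
proof -
  interpret prob_space "iid \<pi> :: (int ^ 'd \<Rightarrow> nat \<times> nat) measure" by (rule prob_space_iid)
  let ?X = "\<lambda>(\<omega> :: int ^ 'd \<Rightarrow> nat \<times> nat) u. fst (\<omega> u)" and ?Y = "\<lambda>(\<omega> :: int ^ 'd \<Rightarrow> nat \<times> nat) u. snd (\<omega> u)"
  define B1 where "B1 b \<omega> \<longleftrightarrow> crossing N b (?X \<omega>)" for b \<omega>
  define B2 where "B2 b \<omega> \<longleftrightarrow> (\<exists>u. block N u = b \<and> fst (\<omega> u) \<noteq> snd (\<omega> u))" for b and \<omega> :: "int ^ 'd \<Rightarrow> nat \<times> nat"
  have dep1: "depends_on (nbhd N b) (B1 b)" for b
    unfolding depends_on_def B1_def
    by (intro allI impI crossing_depends[unfolded depends_on_def, rule_format]) simp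
  have dep2: "depends_on (nbhd N b) (B2 b)" for b
    unfolding depends_on_def B2_def by (metis block_in_nbhd)
  define E1 where "E1 k = {\<omega>. \<exists>w\<in>walks 0 (2 * k). k \<le> 2 * card {b \<in> set w. B1 b \<omega>}}" for k
  define E2 where "E2 k = {\<omega>. \<exists>w\<in>walks 0 (2 * k). k \<le> r * card {b \<in> set w. B2 b \<omega>}}" for k
  have E1_meas: "E1 k \<in> events" and E2_meas: "E2 k \<in> events" for k
    unfolding E1_def E2_def by (rule sets_walks[OF N]; rule dep1 dep2)+
  have E1: "prob (E1 k) \<le> 2 * (1 / 2) ^ k" for k
    unfolding E1_def
  proof (rule animal_bound_half[OF N dep1])
    show "B1 0 (\<lambda>u. \<omega> (u + int N *s b))" if "B1 b \<omega>" for b \<omega>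
      using that crossing_shift[OF N, of b "?X \<omega>"] by (simp add: B1_def)
    show "prob {\<omega>. B1 0 \<omega>} \<le> (1 / (8 * real (card (near :: (int ^ 'd) set)) ^ 2)) ^ (card (near :: (int ^ 'd) set) * 2)"
      using crossing by (simp add: B1_def s_def)
  qed
  have E2: "prob (E2 k) \<le> 2 * (1 / 2) ^ k" for k
    unfolding E2_def
  proof (rule animal_bound_half[OF N dep2])
    show "B2 0 (\<lambda>u. \<omega> (u + int N *s b))" if B: "B2 b \<omega>" for b \<omega>
    proof -
      obtain u where u: "block N u = b" "fst (\<omega> u) \<noteq> snd (\<omega> u)" using B unfolding B2_def by blast
      have "block N (u - int N *s b) = 0" using block_translate[OF N, of "u - int N *s b" b] u(1) by simp
      then show ?thesis unfolding B2_def using u(2) by (intro exI[of _ "u - int N *s b"]) simp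
    qed
    show "prob {\<omega>. B2 0 \<omega>} \<le> (1 / (8 * real (card (near :: (int ^ 'd) set)) ^ 2)) ^ (card (near :: (int ^ 'd) set) * r)"
      using differ by (simp add: B2_def s_def)
  qed
  define m where "m = real (card {u :: int ^ 'd. block N u = 0})"
  have main: "mean_time (map_pmf snd \<pi>) (int n *s z) / real n
      \<le> mean_time (map_pmf fst \<pi>) (int n *s z) / real n + 2 * m * real C / real r + l1 z * (4 * (1 / 2) ^ n)"
    if n: "n \<ge> 1" for n
  proof -
    define k where "k = C * n"
    define v where "v = int n *s z"
    have "0 \<le> 2 * real s * l1 z + real s" by simp
    with C have "0 < real C" by linarith
    then have C1: "C \<ge> 1" by simp
    have kn: "n \<le> k" using C1 by (simp add: k_def)
    have v: "l1 v = real n * l1 z" by (simp add: v_def l1_scale)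
    have k: "real s + 2 * real s * l1 v < real k"
    proof -
      have "real s + 2 * real s * l1 v \<le> real n * (2 * real s * l1 z + real s)"
        using mult_right_mono[of 1 "real n" "real s"] n by (simp add: v algebra_simps)
      also have "\<dots> < real n * real C" using C n by simp
      finally show ?thesis by (simp add: k_def mult.commute)
    qed
    have pt: "site_time (?Y \<omega>) 0 v \<le> site_time (?X \<omega>) 0 v + 2 * m * real k / real r
        + l1 v * (indicator (E1 k) \<omega> + indicator (E2 k) \<omega>)" for \<omega>
    proof (cases "\<omega> \<in> E1 k \<or> \<omega> \<in> E2 k")
      case True
      then have "1 \<le> indicator (E1 k) \<omega> + (indicator (E2 k) \<omega> :: real)" by (auto simp: indicator_def)
      then have "l1 v * 1 \<le> l1 v * (indicator (E1 k) \<omega> + indicator (E2 k) \<omega>)" by (rule mult_left_mono) simp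
      moreover have "site_time (?Y \<omega>) 0 v \<le> l1 v" using site_time_le_l1[of "?Y \<omega>" 0 v] by simp
      moreover have "0 \<le> 2 * m * real k / real r" by (simp add: m_def)
      ultimately show ?thesis using site_time_nonneg[of "?X \<omega>" 0 v] by linarith
    next
      case False
      have "site_time (?Y \<omega>) 0 v \<le> site_time (?X \<omega>) 0 v + 2 * m * real k / real r"
        unfolding m_def
      proof (rule geodesic_comparison[OF N r])
        have "0 \<le> 2 * real s * l1 v" by simp
        then show "card (near :: (int ^ 'd) set) < k" using k unfolding s_def by linarith
        have "2 * real s * site_time (?X \<omega>) 0 v \<le> 2 * real s * l1 v"
          using site_time_le_l1[of "?X \<omega>" 0 v] by (intro mult_left_mono) auto
        then show "2 * real (card (near :: (int ^ 'd) set)) * site_time (?X \<omega>) 0 v < real k"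
          using k unfolding s_def by linarith
        show "2 * card {b \<in> set w. crossing N b (?X \<omega>)} < k" if "w \<in> walks 0 (2 * k)" for w
          using False that by (auto simp: E1_def B1_def not_le)
        show "r * card {b \<in> set w. \<exists>u. block N u = b \<and> ?X \<omega> u \<noteq> ?Y \<omega> u} < k" if "w \<in> walks 0 (2 * k)" for w
          using False that by (auto simp: E2_def B2_def not_le)
      qed
      then show ?thesis using False by simp
    qed
    have intE: "integrable (iid \<pi>) (indicator (E1 k) :: _ \<Rightarrow> real)" "integrable (iid \<pi>) (indicator (E2 k) :: _ \<Rightarrow> real)"
      by (rule integrable_real_indicator; simp add: emeasure_eq_measure E1_meas E2_meas)+
    have "mean_time (map_pmf snd \<pi>) v \<le> expectation (\<lambda>\<omega>. site_time (?X \<omega>) 0 v + 2 * m * real k / real r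
        + l1 v * (indicator (E1 k) \<omega> + indicator (E2 k) \<omega>))"
      unfolding mean_time_map
      by (rule integral_mono[OF _ _ pt]) (use intE in \<open>simp_all add: integrable_recolored\<close>)
    also have "\<dots> = mean_time (map_pmf fst \<pi>) v + 2 * m * real k / real r + l1 v * (prob (E1 k) + prob (E2 k))"
      using intE prob_space by (simp add: mean_time_map integrable_recolored)
    also have "l1 v * (prob (E1 k) + prob (E2 k)) \<le> l1 v * (4 * (1 / 2) ^ n)"
    proof (rule mult_left_mono)
      have "(1 / 2 :: real) ^ k \<le> (1 / 2) ^ n" using kn by (rule power_decreasing) auto
      then show "prob (E1 k) + prob (E2 k) \<le> 4 * (1 / 2) ^ n" using E1[of k] E2[of k] by linarith
    qed simp
    finally have "mean_time (map_pmf snd \<pi>) v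
        \<le> mean_time (map_pmf fst \<pi>) v + 2 * m * real k / real r + l1 v * (4 * (1 / 2) ^ n)" by simp
    then have "mean_time (map_pmf snd \<pi>) v / real n
        \<le> (mean_time (map_pmf fst \<pi>) v + 2 * m * real k / real r + l1 v * (4 * (1 / 2) ^ n)) / real n"
      by (rule divide_right_mono) simp
    also have "\<dots> = mean_time (map_pmf fst \<pi>) v / real n + 2 * m * real C / real r + l1 z * (4 * (1 / 2) ^ n)"
      using n r by (simp add: v k_def field_simps)
    finally show ?thesis by (simp add: v_def)
  qed
  have "(\<lambda>n. mean_time (map_pmf fst \<pi>) (int n *s z) / real n + 2 * m * real C / real r + l1 z * (4 * (1 / 2) ^ n))
      \<longlonglongrightarrow> time_rate (map_pmf fst \<pi>) z + 2 * m * real C / real r + l1 z * (4 * 0)"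
    by (intro tendsto_intros mean_time_rate LIMSEQ_power_zero) simp
  from LIMSEQ_le[OF mean_time_rate[of "map_pmf snd \<pi>" z] this]
  have "time_rate (map_pmf snd \<pi>) z \<le> time_rate (map_pmf fst \<pi>) z + 2 * m * real C / real r + l1 z * (4 * 0)"
    using main by blast
  then show ?thesis by (simp add: m_def)
qed

section \<open>Crossings are unlikely when the rate is positive\<close>

lemma mean_time_symmetric:
  assumes \<phi>: "bij \<phi>" "\<And>u v. lattice_adj (\<phi> u) (\<phi> v) \<longleftrightarrow> lattice_adj u v"
  shows "(\<integral>\<omega>. site_time \<omega> (\<phi> 0) (\<phi> z) \<partial>iid P) = mean_time P z"
proof -
  have inj: "inj \<phi>" using \<phi>(1) by (rule bij_is_inj)
  have "mean_time P z = (\<integral>\<omega>. site_time \<omega> 0 z \<partial>distr (iid P) (iid P) (\<lambda>\<omega> u. \<omega> (\<phi> u)))"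
    by (simp only: mean_time_def distr_reindex[OF inj])
  also have "\<dots> = (\<integral>\<omega>. site_time (\<lambda>u. \<omega> (\<phi> u)) 0 z \<partial>iid P)"
    by (rule integral_distr[OF measurable_reindex[OF inj]]) measurable
  finally show ?thesis by (simp only: site_time_reindex[OF \<phi>])
qed

lemma time_rate_symmetric:
  assumes \<phi>: "bij \<phi>" "\<And>u v. lattice_adj (\<phi> u) (\<phi> v) \<longleftrightarrow> lattice_adj u v" "\<phi> 0 = 0"
    and scale: "\<And>n. \<phi> (int n *s z) = int n *s \<phi> z"
  shows "time_rate P (\<phi> z) = time_rate P z"
  unfolding time_rate_def scale[symmetric]
  using mean_time_symmetric[OF \<phi>(1,2)] by (simp add: mean_time_def \<phi>(3))

lemma time_rate_triangle: "time_rate P (u + v) \<le> time_rate P u + time_rate P (v :: int ^ 'd)"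
proof -
  have "mean_time P (int n *s (u + v)) / real n \<le> mean_time P (int n *s u) / real n + mean_time P (int n *s v) / real n" for n
  proof -
    define a b where "a = int n *s u" and "b = int n *s v"
    have ab: "int n *s (u + v) = b + a" by (simp add: a_def b_def vec_eq_iff algebra_simps)
    have "mean_time P (b + a) \<le> (\<integral>\<omega>. site_time \<omega> 0 a + site_time \<omega> a (b + a) \<partial>iid P)"
      unfolding mean_time_def by (rule integral_mono) (use site_time_triangle in auto)
    also have "\<dots> = mean_time P a + (\<integral>\<omega>. site_time \<omega> a (b + a) \<partial>iid P)"
      by (simp add: mean_time_def)
    also have "(\<integral>\<omega>. site_time \<omega> a (b + a) \<partial>iid P) = mean_time P b"
      using mean_time_symmetric[where \<phi>="\<lambda>u. u + a" and z=b and P=P] by (simp add: lattice_adj_iff_l1 bij_plus_right)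
    finally show ?thesis unfolding ab by (simp add: a_def b_def add_divide_distrib[symmetric] divide_right_mono)
  qed
  then show ?thesis
    by (intro LIMSEQ_le[OF mean_time_rate tendsto_add[OF mean_time_rate mean_time_rate]]) auto
qed

lemma time_rate_scale: "time_rate P (int k *s z) = real k * time_rate P (z :: int ^ 'd)"
proof (cases "k = 0")
  case False
  then have "filterlim (\<lambda>n. n * k) at_top sequentially"
    by (intro filterlim_subseq) (auto simp: strict_mono_def)
  from filterlim_compose[OF mean_time_rate[of P z] this]
  have "(\<lambda>n. real k * (mean_time P (int (n * k) *s z) / real (n * k))) \<longlonglongrightarrow> real k * time_rate P z"
    by (intro tendsto_intros)
  moreover have "(\<lambda>n. real k * (mean_time P (int (n * k) *s z) / real (n * k))) = (\<lambda>n. mean_time P (int n *s (int k *s z)) / real n)"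
    using False by (simp only: scale_scale) (simp add: fun_eq_iff)
  ultimately show ?thesis using mean_time_rate[of P "int k *s z"] LIMSEQ_unique by metis
qed (simp add: vec_eq_iff)

lemma time_rate_flip:
  assumes "\<And>i. f i = 1 \<or> f i = (-1 :: int)"
  shows "time_rate P (\<chi> i. f i * z $ i) = time_rate P z"
proof (rule time_rate_symmetric[where \<phi>="\<lambda>z. \<chi> i. f i * z $ i"])
  have ff: "f i * (f i * x) = x" for i x using assms[of i] by auto
  show "bij (\<lambda>z. \<chi> i. f i * z $ i)"
    by (rule o_bij[where g="\<lambda>z. \<chi> i. f i * z $ i"]) (auto simp: fun_eq_iff vec_eq_iff ff)
  have "\<bar>f i * x - f i * y\<bar> = \<bar>x - y\<bar>" for i x y using assms[of i] by auto
  then show "lattice_adj (\<chi> i. f i * u $ i) (\<chi> i. f i * v $ i) = lattice_adj u v" for u v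
    by (simp add: lattice_adj_def)
qed (simp_all add: vec_eq_iff)

lemma time_rate_minus: "time_rate P (- z) = time_rate P z"
proof -
  have "(\<chi> i. -1 * z $ i) = - z" by (simp add: vec_eq_iff)
  then show ?thesis using time_rate_flip[of "\<lambda>_. -1" P z] by simp
qed

lemma time_rate_axis:
  fixes i j :: "'d :: finite"
  shows "time_rate P (axis i c) = \<bar>real_of_int c\<bar> * time_rate P (axis j 1 :: int ^ 'd)"
proof -
  have 1: "time_rate P (axis i c) = \<bar>real_of_int c\<bar> * time_rate P (axis i 1 :: int ^ 'd)" for i :: 'd and c
  proof -
    have a: "axis i c = int (nat \<bar>c\<bar>) *s (if c \<ge> 0 then axis i 1 else - axis i 1)"
      by (auto simp: vec_eq_iff axis_def)
    have "time_rate P (if c \<ge> 0 then axis i 1 else - axis i 1) = time_rate P (axis i 1 :: int ^ 'd)"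
      by (simp add: time_rate_minus)
    then show ?thesis by (subst a) (simp only: time_rate_scale, simp)
  qed
  (* exchanging two coordinates shows that the rate does not depend on the axis *)
  define \<tau> where "\<tau> = Transposition.transpose i j"
  have \<tau>: "\<tau> (\<tau> x) = x" for x by (simp add: \<tau>_def)
  have b: "bij \<tau>" by (simp add: \<tau>_def)
  have "time_rate P (\<chi> x. axis i 1 $ \<tau> x) = time_rate P (axis i 1 :: int ^ 'd)"
  proof (rule time_rate_symmetric[where \<phi>="\<lambda>z. \<chi> x. z $ \<tau> x"])
    show "bij (\<lambda>z. \<chi> x. (z :: int ^ 'd) $ \<tau> x)"
      by (rule o_bij[where g="\<lambda>z. \<chi> x. z $ \<tau> x"]) (auto simp: fun_eq_iff vec_eq_iff \<tau>)
    have "(\<Sum>x\<in>UNIV. \<bar>u $ \<tau> x - v $ \<tau> x\<bar>) = (\<Sum>x\<in>UNIV. \<bar>u $ x - v $ x\<bar>)" for u v :: "int ^ 'd"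
      using sum.reindex_bij_betw[of \<tau> UNIV UNIV "\<lambda>x. \<bar>u $ x - v $ x\<bar>"] b by simp
    then show "lattice_adj (\<chi> x. u $ \<tau> x) (\<chi> x. v $ \<tau> x) = lattice_adj u v" for u v :: "int ^ 'd"
      by (simp add: lattice_adj_def)
  qed (simp_all add: vec_eq_iff)
  moreover have "(\<chi> x. axis i 1 $ \<tau> x) = (axis j 1 :: int ^ 'd)"
    by (auto simp: vec_eq_iff axis_def \<tau>_def Transposition.transpose_def)
  ultimately have "time_rate P (axis j 1 :: int ^ 'd) = time_rate P (axis i 1 :: int ^ 'd)" by simp
  then show ?thesis by (simp only: 1[of i c])
qed

lemma time_rate_le_axis:
  fixes z :: "int ^ 'd"
  shows "time_rate P z \<le> l1 z * time_rate P (axis j 1 :: int ^ 'd)"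
proof -
  have "time_rate P (\<Sum>i\<in>A. axis i (z $ i)) \<le> (\<Sum>i\<in>A. \<bar>real_of_int (z $ i)\<bar>) * time_rate P (axis j 1 :: int ^ 'd)" if "finite A" for A
    using that
  proof (induction A rule: finite_induct)
    case (insert i A)
    have "time_rate P (axis i (z $ i) + (\<Sum>i\<in>A. axis i (z $ i))) \<le> time_rate P (axis i (z $ i)) + time_rate P (\<Sum>i\<in>A. axis i (z $ i))"
      by (rule time_rate_triangle)
    with insert show ?case by (simp add: time_rate_axis[of P i _ j] distrib_right)
  qed simp
  from this[of UNIV] have "time_rate P (\<Sum>i\<in>UNIV. axis i (z $ i)) \<le> l1 z * time_rate P (axis j 1 :: int ^ 'd)"
    by (simp add: l1_def)
  moreover have "(\<Sum>i\<in>UNIV. axis i (z $ i)) = z"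
    by (simp add: vec_eq_iff axis_def)
  ultimately show ?thesis by simp
qed

text \<open>Reflect \<open>w\<close> in all coordinates except \<open>i\<close>: the two vectors have the same rate and their sum lies on the \<open>i\<close>-th axis.\<close>

lemma time_rate_ge_axis: "\<bar>real_of_int (w $ i)\<bar> * time_rate P (axis j 1 :: int ^ 'd) \<le> time_rate P (w :: int ^ 'd)"
proof -
  define r where "r = (\<chi> k. (if k = i then 1 else -1) * w $ k)"
  have "time_rate P r = time_rate P w" unfolding r_def by (rule time_rate_flip) auto
  moreover have "w + r = axis i (2 * w $ i)" by (auto simp: vec_eq_iff r_def axis_def)
  moreover have "time_rate P (w + r) \<le> time_rate P w + time_rate P r" by (rule time_rate_triangle)
  ultimately show ?thesis by (simp add: time_rate_axis[of P i _ j] abs_mult)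
qed

lemma mono_connected_site_time:
  assumes "(u, v) \<in> (mono_step S X)\<^sup>*" shows "site_time X u v = 0"
  using assms
proof (induction rule: rtrancl_induct)
  case (step v w)
  have "site_time X v w \<le> path_time X [v, w]"
    using step(2) by (intro site_time_lower) (auto simp: lattice_paths_def mono_step_def)
  also have "\<dots> = 0" using step(2) by (simp add: edge_time_def mono_step_def)
  finally have "site_time X u w \<le> 0" using site_time_triangle[of X u w v] step(3) by simp
  then show ?case using site_time_nonneg[of X u w] by simp
qed simp

lemma prob_below_limit:
  fixes f :: "nat \<Rightarrow> ('v \<Rightarrow> 'c) \<Rightarrow> real"
  assumes [measurable]: "\<And>k. f k \<in> borel_measurable (iid P)"
    and lim: "AE \<omega> in iid P. (\<lambda>k. f k \<omega>) \<longlonglongrightarrow> l" and "t < l"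
  shows "(\<lambda>k. measure (iid P) {\<omega>. f k \<omega> \<le> t}) \<longlonglongrightarrow> 0"
proof -
  interpret prob_space "iid P :: ('v \<Rightarrow> 'c) measure" by (rule prob_space_iid)
  have meas [measurable]: "{\<omega>. f k \<omega> \<le> t} \<in> events" for k
  proof -
    have "{\<omega> \<in> space (iid P). f k \<omega> \<le> t} \<in> events" by measurable
    then show ?thesis by simp
  qed
  have "(\<lambda>k. expectation (indicator {\<omega>. f k \<omega> \<le> t} :: _ \<Rightarrow> real)) \<longlonglongrightarrow> expectation (\<lambda>_. 0)"
  proof (rule integral_dominated_convergence[where w="\<lambda>_. 1"])
    show "AE \<omega> in iid P. (\<lambda>k. indicator {\<omega>. f k \<omega> \<le> t} \<omega> :: real) \<longlonglongrightarrow> 0"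
      using lim
    proof eventually_elim
      case (elim \<omega>)
      then have "eventually (\<lambda>k. t < f k \<omega>) sequentially" using \<open>t < l\<close> by (rule order_tendstoD(1))
      then have "eventually (\<lambda>k. indicator {\<omega>. f k \<omega> \<le> t} \<omega> = (0 :: real)) sequentially"
        by eventually_elim (simp add: indicator_def)
      then show ?case by (rule tendsto_eventually)
    qed
  qed (auto simp: indicator_def)
  then show ?thesis by simp
qed

lemma coarse_distance:
  fixes u :: "int ^ 'd"
  assumes "k \<ge> 1"
  shows "l1 (int k *s block k u - u) \<le> real CARD('d) * real k"
proof -
  have "\<bar>(int k *s block k u - u) $ i\<bar> \<le> int k" for i
  proof -
    have "u $ i = int k * (u $ i div int k) + u $ i mod int k" by simp
    moreover have "0 \<le> u $ i mod int k" "u $ i mod int k < int k" using assms by auto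
    moreover have "(int k *s block k u - u) $ i = int k * (u $ i div int k) - u $ i" by (simp add: block_def)
    ultimately show ?thesis by linarith
  qed
  then have "(\<Sum>i\<in>UNIV. \<bar>(int k *s block k u - u) $ i\<bar>) \<le> (\<Sum>i\<in>(UNIV :: 'd set). int k)" by (intro sum_mono)
  then have "(\<Sum>i\<in>UNIV. \<bar>(int k *s block k u - u) $ i\<bar>) \<le> int CARD('d) * int k" by simp
  then have "real_of_int (\<Sum>i\<in>UNIV. \<bar>(int k *s block k u - u) $ i\<bar>) \<le> real_of_int (int CARD('d) * int k)"
    by (simp only: of_int_le_iff)
  then show ?thesis unfolding l1_def by simp
qed

text \<open>A crossing at scale \<open>N = M k\<close> joins, at no cost, two sites that differ by at least \<open>N\<close> in some coordinate.
  Rounding both to multiples of \<open>k\<close> costs at most \<open>d k\<close> each, and leaves finitely many pairs \<open>(a, c)\<close>, a number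
  independent of \<open>k\<close>.\<close>

lemma crossing_imp_fast:
  fixes X :: "int ^ 'd \<Rightarrow> nat" and M k :: nat
  assumes "M \<ge> 1" "k \<ge> 1" "crossing (M * k) 0 X"
  obtains a c where "\<forall>i. - int M \<le> a $ i \<and> a $ i \<le> 2 * int M" "\<forall>i. - int M \<le> c $ i \<and> c $ i \<le> 2 * int M"
    "\<exists>i. int M - 1 \<le> \<bar>(c - a) $ i\<bar>"
    "site_time X (int k *s a) (int k *s c) \<le> 2 * real CARD('d) * real k"
proof -
  define N where "N = M * k"
  have N: "int N > 0" using assms by (simp add: N_def)
  obtain u v v' where c: "block N u = 0" "v \<in> nbhd N 0" "lattice_adj v v'" "v' \<notin> nbhd N 0"
    "(u, v) \<in> (mono_step (nbhd N 0) X)\<^sup>*" using assms(3) unfolding crossing_def N_def by blast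
  have div: "x div int k div int M = x div int N" for x
  proof -
    have "int N = int k * int M" by (simp add: N_def)
    then show ?thesis by (simp only: zdiv_zmult2_eq of_nat_0_le_iff)
  qed
  have udiv: "u $ i div int N = 0" for i using c(1) by (simp add: block_def vec_eq_iff)
  have vdiv: "\<bar>v $ i div int N\<bar> \<le> 1" for i using c(2) by (simp add: nbhd_def near_def block_def)
  have box: "- int M \<le> block k w $ i \<and> block k w $ i \<le> 2 * int M" if "\<bar>w $ i div int N\<bar> \<le> 1" for w :: "int ^ 'd" and i
    using div_le_1_bounds[of "int M" "w $ i div int k"] that assms(1) by (simp add: div block_def)
  obtain i where i: "\<not> \<bar>v' $ i div int N\<bar> \<le> 1" using c(4) by (auto simp: nbhd_def near_def block_def)
  have "\<bar>v $ i - v' $ i\<bar> \<le> (\<Sum>i\<in>UNIV. \<bar>v $ i - v' $ i\<bar>)" by (rule member_le_sum) auto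
  then have vv: "\<bar>v $ i - v' $ i\<bar> \<le> 1" using c(3) by (simp add: lattice_adj_def)
  have far: "int N \<le> \<bar>v $ i - u $ i\<bar>"
  proof -
    have v'q: "v' $ i = int N * (v' $ i div int N) + v' $ i mod int N" "0 \<le> v' $ i mod int N" "v' $ i mod int N < int N"
      using N by simp_all
    have u: "0 \<le> u $ i" "u $ i < int N"
    proof -
      have "u $ i = u $ i mod int N" using udiv[of i] mult_div_mod_eq[of "int N" "u $ i"] by simp
      moreover have "0 \<le> u $ i mod int N" "u $ i mod int N < int N" using N by simp_all
      ultimately show "0 \<le> u $ i" "u $ i < int N" by linarith+
    qed
    consider "2 \<le> v' $ i div int N" | "v' $ i div int N \<le> -2" using i by linarith
    then show ?thesis
    proof cases
      case 1
      then have "int N * 2 \<le> int N * (v' $ i div int N)" using N by (intro mult_left_mono) auto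
      then show ?thesis using v'q u vv by linarith
    next
      case 2
      then have "int N * (v' $ i div int N) \<le> int N * (-2)" using N by (intro mult_left_mono) auto
      then show ?thesis using v'q u vv by linarith
    qed
  qed
  have close: "int k * (block k w $ i) \<le> w $ i \<and> w $ i < int k * (block k w $ i) + int k" for w :: "int ^ 'd"
  proof -
    have "w $ i = int k * (w $ i div int k) + w $ i mod int k" by simp
    moreover have "0 \<le> w $ i mod int k" "w $ i mod int k < int k" using assms by auto
    ultimately show ?thesis unfolding block_def vec_lambda_beta by linarith
  qed
  have "int M - 1 \<le> \<bar>(block k v - block k u) $ i\<bar>"
  proof (rule ccontr)
    assume "\<not> ?thesis"
    then have "\<bar>block k v $ i - block k u $ i\<bar> \<le> int M - 2" by simp
    then have "int k * \<bar>block k v $ i - block k u $ i\<bar> \<le> int k * (int M - 2)" by (rule mult_left_mono) simp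
    moreover have "int k * \<bar>block k v $ i - block k u $ i\<bar> = \<bar>int k * (block k v $ i) - int k * (block k u $ i)\<bar>"
      by (simp add: abs_mult flip: right_diff_distrib)
    moreover have "int k * (int M - 2) = int N - 2 * int k" by (simp add: N_def algebra_simps)
    ultimately show False using far close[of u] close[of v] assms(2) by linarith
  qed
  moreover have "site_time X (int k *s block k u) (int k *s block k v) \<le> 2 * real CARD('d) * real k"
    using site_time_perturb[of X "int k *s block k u" "int k *s block k v" u v] mono_connected_site_time[OF c(5)]
      coarse_distance[OF assms(2), of u] coarse_distance[OF assms(2), of v] by simp
  ultimately show ?thesis using that[of "block k u" "block k v"] box[of u] box[of v] udiv vdiv by auto
qed

text \<open>For the pairs \<open>(a, c)\<close> of \<open>crossing_imp_fast\<close> the rate in direction \<open>c - a\<close> exceeds \<open>2 d\<close> once \<open>M\<close> is large, since the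
  rate is bounded below by a multiple of the maximum norm. So each of these finitely many fast passages becomes
  unlikely as \<open>k\<close> grows with \<open>M\<close> fixed.\<close>

lemma crossing_unlikely:
  fixes z :: "int ^ 'd"
  assumes "time_rate P z > 0" "\<eta> > 0"
  obtains N where "N \<ge> 1" "measure (iid P) {\<omega>. crossing N (0 :: int ^ 'd) \<omega>} \<le> \<eta>"
proof -
  interpret prob_space "iid P :: (int ^ 'd \<Rightarrow> nat) measure" by (rule prob_space_iid)
  obtain j :: 'd where True by blast
  define c where "c = time_rate P (axis j 1 :: int ^ 'd)"
  have "0 < l1 z * c" using time_rate_le_axis[of P z j] assms(1) by (simp add: c_def)
  have c: "c > 0"
  proof (rule ccontr)
    assume "\<not> ?thesis"
    then have "l1 z * c \<le> 0" by (intro mult_nonneg_nonpos) auto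
    with \<open>0 < l1 z * c\<close> show False by simp
  qed
  (* the rates in question are at least (M - 1) * c, and 2 * d is the total cost of rounding at mesh 1 *)
  obtain M :: nat where M': "2 * real CARD('d) / c + 1 < real M" using reals_Archimedean2 by blast
  have M: "M \<ge> 1" "2 * real CARD('d) < (real M - 1) * c"
  proof -
    have "0 \<le> 2 * real CARD('d) / c" using c by simp
    then show "M \<ge> 1" using M' by linarith
    show "2 * real CARD('d) < (real M - 1) * c" using M' c by (simp add: field_simps)
  qed
  define A where "A = {u :: int ^ 'd. \<forall>i. - int M \<le> u $ i \<and> u $ i \<le> 2 * int M}"
  define I where "I = {(a, b) \<in> A \<times> A. \<exists>i. int M - 1 \<le> \<bar>(b - a) $ i\<bar>}"
  have finI: "finite I" unfolding I_def A_def
    by (rule finite_subset[OF _ finite_cartesian_product[OF finite_box finite_box]]) auto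
  define U where "U k x = {\<omega>. site_time \<omega> (int k *s fst x) (int k *s snd x) \<le> 2 * real CARD('d) * real k}"
    for k and x :: "(int ^ 'd) \<times> (int ^ 'd)"
  have U_meas: "U k x \<in> events" for k x
  proof -
    have "{\<omega> \<in> space (iid P). site_time \<omega> (int k *s fst x) (int k *s snd x) \<le> 2 * real CARD('d) * real k} \<in> events"
      by measurable
    then show ?thesis by (simp add: U_def)
  qed
  have lim: "(\<lambda>k. prob (U k x)) \<longlonglongrightarrow> 0" if "x \<in> I" for x
  proof -
    obtain a b where x: "x = (a, b)" by (cases x)
    define w where "w = b - a"
    obtain i where i: "int M - 1 \<le> \<bar>w $ i\<bar>" using \<open>x \<in> I\<close> by (auto simp: I_def x w_def)
    have "(real M - 1) * c \<le> \<bar>real_of_int (w $ i)\<bar> * c"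
      using i c by (intro mult_right_mono) linarith+
    also have "\<dots> \<le> time_rate P w" unfolding c_def by (rule time_rate_ge_axis)
    finally have gt: "2 * real CARD('d) < time_rate P w" using M by linarith
    have "(\<lambda>k. prob {\<omega>. site_time \<omega> 0 (int k *s w) / real k \<le> 2 * real CARD('d)}) \<longlonglongrightarrow> 0"
      by (rule prob_below_limit[OF _ site_time_rate gt]) measurable
    moreover have "eventually (\<lambda>k. prob {\<omega>. site_time \<omega> 0 (int k *s w) / real k \<le> 2 * real CARD('d)} = prob (U k x)) sequentially"
      using eventually_ge_at_top[of 1]
    proof eventually_elim
      case (elim k)
      have bw: "int k *s w + int k *s a = int k *s b" by (simp add: w_def vec_eq_iff algebra_simps)
      have "U k x = {\<omega>. site_time (\<lambda>u. \<omega> (u + int k *s a)) 0 (int k *s w) / real k \<le> 2 * real CARD('d)}"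
        using elim unfolding U_def x fst_conv snd_conv site_time_shift bw by (simp add: field_simps)
      also have "prob \<dots> = prob {\<omega>. site_time \<omega> 0 (int k *s w) / real k \<le> 2 * real CARD('d)}"
      proof (rule prob_reindex)
        have "{\<omega> \<in> space (iid P). site_time \<omega> 0 (int k *s w) / real k \<le> 2 * real CARD('d)} \<in> events" by measurable
        then show "{\<omega>. site_time \<omega> 0 (int k *s w) / real k \<le> 2 * real CARD('d)} \<in> events" by simp
      qed (rule injI, simp)
      finally show ?case by simp
    qed
    ultimately show ?thesis by (rule Lim_transform_eventually)
  qed
  have "(\<lambda>k. \<Sum>x\<in>I. prob (U k x)) \<longlonglongrightarrow> (\<Sum>x\<in>I. 0)" by (intro tendsto_sum lim)
  then have "eventually (\<lambda>k. (\<Sum>x\<in>I. prob (U k x)) < \<eta>) sequentially" using assms(2) by (intro order_tendstoD(2)) auto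
  then have "eventually (\<lambda>k. k \<ge> 1 \<and> (\<Sum>x\<in>I. prob (U k x)) < \<eta>) sequentially"
    using eventually_ge_at_top[of "1::nat"] by eventually_elim simp
  then obtain k where k: "k \<ge> 1" "(\<Sum>x\<in>I. prob (U k x)) < \<eta>"
    using eventually_happens[of _ sequentially] by auto
  have "prob {\<omega>. crossing (M * k) (0 :: int ^ 'd) \<omega>} \<le> prob (\<Union>x\<in>I. U k x)"
  proof (rule finite_measure_mono)
    show "{\<omega>. crossing (M * k) 0 \<omega>} \<subseteq> (\<Union>x\<in>I. U k x)"
    proof
      fix \<omega> :: "int ^ 'd \<Rightarrow> nat" assume "\<omega> \<in> {\<omega>. crossing (M * k) 0 \<omega>}"
      then have "crossing (M * k) 0 \<omega>" by simp
      then obtain a c where "\<forall>i. - int M \<le> a $ i \<and> a $ i \<le> 2 * int M" "\<forall>i. - int M \<le> c $ i \<and> c $ i \<le> 2 * int M"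
        "\<exists>i. int M - 1 \<le> \<bar>(c - a) $ i\<bar>" "site_time \<omega> (int k *s a) (int k *s c) \<le> 2 * real CARD('d) * real k"
        using crossing_imp_fast[OF M(1) k(1)] by blast
      then have "(a, c) \<in> I" "\<omega> \<in> U k (a, c)" by (auto simp: I_def A_def U_def)
      then show "\<omega> \<in> (\<Union>x\<in>I. U k x)" by blast
    qed
  qed (use finI U_meas in auto)
  also have "\<dots> \<le> (\<Sum>x\<in>I. prob (U k x))"
    by (rule finite_measure_subadditive_finite[OF finI]) (use U_meas in auto)
  finally have "prob {\<omega>. crossing (M * k) (0 :: int ^ 'd) \<omega>} \<le> \<eta>" using k by linarith
  then show ?thesis using that[of "M * k"] M k by simp
qed

section \<open>Semicontinuity of the rate and couplings\<close>

lemma prob_local_differ: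
  fixes \<pi> :: "('c :: countable \<times> 'c) pmf" and S :: "'v set"
  assumes "finite S"
  shows "{\<omega>. \<exists>u\<in>S. fst (\<omega> u) \<noteq> snd (\<omega> u)} \<in> sets (iid \<pi>)"
    and "measure (iid \<pi>) {\<omega>. \<exists>u\<in>S. fst (\<omega> u) \<noteq> snd (\<omega> u)}
      \<le> real (card S) * measure (measure_pmf \<pi>) {x. fst x \<noteq> snd x}"
proof -
  interpret prob_space "iid \<pi> :: ('v \<Rightarrow> 'c \<times> 'c) measure" by (rule prob_space_iid)
  interpret MP: product_prob_space "\<lambda>_::'v. measure_pmf \<pi>" UNIV by unfold_locales
  define A where "A u = {\<omega> :: 'v \<Rightarrow> 'c \<times> 'c. fst (\<omega> u) \<noteq> snd (\<omega> u)}" for u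
  have A: "A u \<in> events" for u unfolding A_def
    by (rule sets_local[where S="{u}"]) (auto simp: depends_on_def)
  have eq: "{\<omega>. \<exists>u\<in>S. fst (\<omega> u) \<noteq> snd (\<omega> u)} = (\<Union>u\<in>S. A u)" by (auto simp: A_def)
  show "{\<omega>. \<exists>u\<in>S. fst (\<omega> u) \<noteq> snd (\<omega> u)} \<in> events" unfolding eq using A assms by auto
  have "prob (A u) = measure (measure_pmf \<pi>) {x. fst x \<noteq> snd x}" for u
  proof -
    have "measure (measure_pmf \<pi>) {x. fst x \<noteq> snd x} = measure (distr (iid \<pi>) (measure_pmf \<pi>) (\<lambda>\<omega>. \<omega> u)) {x. fst x \<noteq> snd x}"
      unfolding iid_def by (subst MP.PiM_component) auto
    also have "\<dots> = prob (A u)"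
      by (subst measure_distr) (auto simp: iid_def A_def vimage_def space_PiM PiE_UNIV_domain)
    finally show ?thesis by simp
  qed
  then have "(\<Sum>u\<in>S. prob (A u)) = real (card S) * measure (measure_pmf \<pi>) {x. fst x \<noteq> snd x}" by simp
  moreover have "prob (\<Union>u\<in>S. A u) \<le> (\<Sum>u\<in>S. prob (A u))"
    by (rule finite_measure_subadditive_finite[OF assms]) (use A in auto)
  ultimately show "prob {\<omega>. \<exists>u\<in>S. fst (\<omega> u) \<noteq> snd (\<omega> u)} \<le> real (card S) * measure (measure_pmf \<pi>) {x. fst x \<noteq> snd x}"
    unfolding eq by simp
qed

text \<open>At a nearly optimal scale, and with paths confined to a finite set \<open>S\<close>, the two colorings give the same time unless they
  differ somewhere on \<open>S\<close>.\<close>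

lemma time_rate_upper_semi:
  fixes z :: "int ^ 'd"
  assumes "\<delta> > 0"
  shows "\<exists>\<epsilon>>0. \<forall>\<pi>. map_pmf snd \<pi> = Q \<and> measure (measure_pmf \<pi>) {x. fst x \<noteq> snd x} \<le> \<epsilon>
    \<longrightarrow> time_rate (map_pmf fst \<pi>) z \<le> time_rate Q z + \<delta>"
proof -
  obtain N where N: "N \<ge> 1" "mean_time Q (int N *s z) / real N < time_rate Q z + \<delta> / 3"
    using near_optimal_scale[of "\<delta> / 3" Q z] assms by auto
  define v where "v = int N *s z"
  obtain S where S: "finite S" "\<And>\<omega>. site_time \<omega> 0 v \<le> time_in S \<omega> 0 v" "\<And>\<omega>. time_in S \<omega> 0 v \<le> l1 v"
    "(\<integral>\<omega>. time_in S \<omega> 0 v \<partial>iid Q) < mean_time Q v + \<delta> / 3"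
    using local_approximation[of "\<delta> / 3" v Q] assms by auto
  define \<epsilon> where "\<epsilon> = (\<delta> / 3) / (1 + l1 v * real (card S))"
  have den: "0 < 1 + l1 v * real (card S)" by (intro add_pos_nonneg mult_nonneg_nonneg) auto
  have \<epsilon>: "\<epsilon> > 0" using assms den by (simp add: \<epsilon>_def)
  have "time_rate (map_pmf fst \<pi>) z \<le> time_rate Q z + \<delta>"
    if \<pi>: "map_pmf snd \<pi> = Q" "measure (measure_pmf \<pi>) {x. fst x \<noteq> snd x} \<le> \<epsilon>" for \<pi>
  proof -
    interpret prob_space "iid \<pi> :: (int ^ 'd \<Rightarrow> nat \<times> nat) measure" by (rule prob_space_iid)
    define D where "D = {\<omega> :: int ^ 'd \<Rightarrow> nat \<times> nat. \<exists>u\<in>S. fst (\<omega> u) \<noteq> snd (\<omega> u)}"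
    have D: "D \<in> events" "prob D \<le> real (card S) * \<epsilon>"
      using prob_local_differ[OF S(1), of \<pi>] mult_left_mono[OF \<pi>(2), of "real (card S)"] by (auto simp: D_def)
    have nn: "0 \<le> time_in S \<omega> 0 v" for \<omega> using S(2)[of \<omega>] site_time_nonneg order_trans by blast
    have meas: "(\<lambda>\<omega>. time_in S \<omega> 0 v) \<in> borel_measurable (iid Q)"
      by (rule borel_measurable_local[OF S(1)]) (auto simp: depends_on_def intro: time_in_cong)
    have meas': "(\<lambda>\<omega>. time_in S (\<lambda>u. snd (\<omega> u)) 0 v) \<in> borel_measurable (iid \<pi>)"
      using measurable_compose[OF measurable_recolor[of snd \<pi>], of "\<lambda>\<omega>. time_in S \<omega> 0 v" borel] meas \<pi>(1) by simp
    have int: "integrable (iid \<pi>) (\<lambda>\<omega>. time_in S (\<lambda>u. snd (\<omega> u)) 0 v)"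
      by (rule integrable_const_bound[where B="l1 v"]) (use S(3) nn meas' in auto)
    have pt: "site_time (\<lambda>u. fst (\<omega> u)) 0 v \<le> time_in S (\<lambda>u. snd (\<omega> u)) 0 v + l1 v * indicator D \<omega>" for \<omega>
    proof (cases "\<omega> \<in> D")
      case True
      then show ?thesis using site_time_le_l1[of "\<lambda>u. fst (\<omega> u)" 0 v] nn[of "\<lambda>u. snd (\<omega> u)"] by simp
    next
      case False
      then have "time_in S (\<lambda>u. fst (\<omega> u)) 0 v = time_in S (\<lambda>u. snd (\<omega> u)) 0 v"
        by (intro time_in_cong) (auto simp: D_def)
      then show ?thesis using S(2)[of "\<lambda>u. fst (\<omega> u)"] False by simp
    qed
    have intD: "integrable (iid \<pi>) (indicator D :: _ \<Rightarrow> real)"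
      by (rule integrable_real_indicator) (simp_all add: emeasure_eq_measure D)
    have "mean_time (map_pmf fst \<pi>) v \<le> expectation (\<lambda>\<omega>. time_in S (\<lambda>u. snd (\<omega> u)) 0 v + l1 v * indicator D \<omega>)"
      unfolding mean_time_map by (rule integral_mono[OF integrable_recolored _ pt]) (use int intD in simp)
    also have "\<dots> = expectation (\<lambda>\<omega>. time_in S (\<lambda>u. snd (\<omega> u)) 0 v) + l1 v * prob D"
      using int intD by simp
    also have "expectation (\<lambda>\<omega>. time_in S (\<lambda>u. snd (\<omega> u)) 0 v) = (\<integral>\<omega>. time_in S \<omega> 0 v \<partial>iid Q)"
    proof -
      have "(\<integral>\<omega>. time_in S \<omega> 0 v \<partial>iid Q) = (\<integral>\<omega>. time_in S \<omega> 0 v \<partial>distr (iid \<pi>) (iid (map_pmf snd \<pi>)) (\<lambda>\<omega> u. snd (\<omega> u)))"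
        by (simp only: \<pi>(1)[symmetric] distr_recolor)
      also have "\<dots> = expectation (\<lambda>\<omega>. time_in S (\<lambda>u. snd (\<omega> u)) 0 v)"
        by (rule integral_distr[OF measurable_recolor]) (simp add: \<pi>(1) meas)
      finally show ?thesis by simp
    qed
    also have "l1 v * prob D \<le> l1 v * (real (card S) * \<epsilon>)" using D(2) by (rule mult_left_mono) simp
    also have "l1 v * (real (card S) * \<epsilon>) \<le> \<delta> / 3"
    proof -
      have "l1 v * (real (card S) * \<epsilon>) \<le> (1 + l1 v * real (card S)) * \<epsilon>"
        using \<epsilon> by (simp add: algebra_simps)
      also have "\<dots> = \<delta> / 3"
      proof -
        have "X * (\<delta> / 3 / X) = \<delta> / 3" if "X > 0" for X :: real using that by simp
        from this[OF den] show ?thesis by (simp only: \<epsilon>_def)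
      qed
      finally show ?thesis .
    qed
    finally have "mean_time (map_pmf fst \<pi>) v \<le> mean_time Q v + 2 * \<delta> / 3" using S(4) by simp
    then have "mean_time (map_pmf fst \<pi>) v / real N \<le> (mean_time Q v + 2 * \<delta> / 3) / real N" by (rule divide_right_mono) simp
    also have "\<dots> \<le> mean_time Q v / real N + 2 * \<delta> / 3"
    proof -
      have "(2 * \<delta> / 3) / real N \<le> 2 * \<delta> / 3" using N assms by (simp add: field_simps)
      then show ?thesis by (simp add: add_divide_distrib)
    qed
    also have "\<dots> \<le> time_rate Q z + \<delta>" using N by (simp add: v_def)
    finally show ?thesis using time_rate_le_mean[OF N(1), of "map_pmf fst \<pi>" z] by (simp add: v_def)
  qed
  with \<epsilon> show ?thesis by blast
qed

text \<open>The order of the choices matters: the scale \<open>N\<close> depends on \<open>Q\<close> only, then \<open>r\<close> is taken large for this \<open>N\<close>, and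
  \<open>\<epsilon>\<close> is taken small for both. A coupled coloring has a crossing only if the coloring with law \<open>Q\<close> has one or the two differ
  in the neighbourhood.\<close>

lemma time_rate_lower_semi:
  fixes z :: "int ^ 'd"
  assumes "\<delta> > 0"
  shows "\<exists>\<epsilon>>0. \<forall>\<pi>. map_pmf snd \<pi> = Q \<and> measure (measure_pmf \<pi>) {x. fst x \<noteq> snd x} \<le> \<epsilon>
    \<longrightarrow> time_rate Q z \<le> time_rate (map_pmf fst \<pi>) z + \<delta>"
proof (cases "time_rate Q z > 0")
  case False
  have "time_rate Q z \<le> time_rate (map_pmf fst \<pi>) z + \<delta>" for \<pi> :: "(nat \<times> nat) pmf"
    using False assms time_rate_nonneg[of "map_pmf fst \<pi>" z] by simp
  then show ?thesis by (intro exI[of _ 1]) simp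
next
  case True
  define s where "s = card (near :: (int ^ 'd) set)"
  define \<zeta> where "\<zeta> = 1 / (8 * real s ^ 2)"
  have s: "real s \<ge> 1" using card_near_pos[where 'a='d] unfolding s_def by linarith
  have \<zeta>: "\<zeta> > 0" using s by (simp add: \<zeta>_def)
  have "\<zeta> ^ (s * 2) / 2 > 0" using \<zeta> by simp
  then obtain N where N: "N \<ge> 1" "measure (iid Q) {\<omega>. crossing N (0 :: int ^ 'd) \<omega>} \<le> \<zeta> ^ (s * 2) / 2"
    using crossing_unlikely[OF True] by blast
  obtain C :: nat where C: "2 * real s * l1 z + real s < real C" using reals_Archimedean2 by blast
  define m where "m = real (card {u :: int ^ 'd. block N u = 0})"
  obtain r0 :: nat where r0: "2 * m * real C / \<delta> \<le> real r0" using real_arch_simple by blast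
  define r where "r = Suc r0"
  have r: "r \<ge> 1" "2 * m * real C / real r \<le> \<delta>"
  proof -
    have "2 * m * real C \<le> real r0 * \<delta>" using r0 assms by (simp add: pos_divide_le_eq)
    also have "\<dots> \<le> real r * \<delta>" using assms by (intro mult_right_mono) (auto simp: r_def)
    finally show "2 * m * real C / real r \<le> \<delta>" by (simp add: r_def field_simps)
  qed (simp add: r_def)
  define L where "L = real (card (nbhd N (0 :: int ^ 'd)))"
  define \<epsilon> where "\<epsilon> = min (\<zeta> ^ (s * 2) / 2) (\<zeta> ^ (s * r)) / (1 + L)"
  have L: "L \<ge> 0" by (simp add: L_def)
  have \<epsilon>: "\<epsilon> > 0" using \<zeta> L by (simp add: \<epsilon>_def)
  have L\<epsilon>: "L * \<epsilon> \<le> \<zeta> ^ (s * 2) / 2" "L * \<epsilon> \<le> \<zeta> ^ (s * r)"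
  proof -
    have "L * \<epsilon> \<le> (1 + L) * \<epsilon>" using \<epsilon> by (simp add: algebra_simps)
    also have "\<dots> = min (\<zeta> ^ (s * 2) / 2) (\<zeta> ^ (s * r))" using L by (simp add: \<epsilon>_def)
    finally show "L * \<epsilon> \<le> \<zeta> ^ (s * 2) / 2" "L * \<epsilon> \<le> \<zeta> ^ (s * r)" by auto
  qed
  have "time_rate Q z \<le> time_rate (map_pmf fst \<pi>) z + \<delta>"
    if \<pi>: "map_pmf snd \<pi> = Q" "measure (measure_pmf \<pi>) {x. fst x \<noteq> snd x} \<le> \<epsilon>" for \<pi>
  proof -
    interpret prob_space "iid \<pi> :: (int ^ 'd \<Rightarrow> nat \<times> nat) measure" by (rule prob_space_iid)
    define D where "D = {\<omega> :: int ^ 'd \<Rightarrow> nat \<times> nat. \<exists>u\<in>nbhd N 0. fst (\<omega> u) \<noteq> snd (\<omega> u)}"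
    note fin = finite_nbhd[OF N(1), of "0 :: int ^ 'd"]
    have D_meas: "D \<in> events" unfolding D_def by (rule prob_local_differ(1)[OF fin])
    have "prob D \<le> L * measure (measure_pmf \<pi>) {x. fst x \<noteq> snd x}"
      unfolding D_def L_def by (rule prob_local_differ(2)[OF fin])
    also have "\<dots> \<le> L * \<epsilon>" using \<pi>(2) L by (rule mult_left_mono)
    finally have D: "prob D \<le> L * \<epsilon>" .
    define K where "K = {\<omega> :: int ^ 'd \<Rightarrow> nat \<times> nat. crossing N (0 :: int ^ 'd) (\<lambda>u. snd (\<omega> u))}"
    have crossing_sets: "{\<omega>. crossing N (0 :: int ^ 'd) \<omega>} \<in> sets (iid (map_pmf snd \<pi>))"
      by (rule sets_local[OF fin crossing_depends])
    have K_meas: "K \<in> events"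
      using measurable_sets[OF measurable_recolor crossing_sets] by (simp add: K_def vimage_def)
    have "measure (iid Q) {\<omega>. crossing N (0 :: int ^ 'd) \<omega>}
        = measure (distr (iid \<pi>) (iid (map_pmf snd \<pi>)) (\<lambda>\<omega> u. snd (\<omega> u))) {\<omega>. crossing N (0 :: int ^ 'd) \<omega>}"
      by (simp only: \<pi>(1)[symmetric] distr_recolor)
    also have "\<dots> = prob K"
      by (subst measure_distr[OF measurable_recolor crossing_sets]) (simp add: K_def vimage_def)
    finally have K: "prob K \<le> \<zeta> ^ (s * 2) / 2" using N(2) by simp
    have "time_rate (map_pmf snd \<pi>) z \<le> time_rate (map_pmf fst \<pi>) z
        + 2 * real (card {u :: int ^ 'd. block N u = 0}) * real C / real r"
    proof (rule rate_comparison[OF N(1) r(1)])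
      show "2 * real (card (near :: (int ^ 'd) set)) * l1 z + real (card (near :: (int ^ 'd) set)) < real C"
        using C by (simp add: s_def)
      have "prob {\<omega>. crossing N (0 :: int ^ 'd) (\<lambda>u. fst (\<omega> u))} \<le> prob (K \<union> D)"
      proof (rule finite_measure_mono)
        show "{\<omega>. crossing N (0 :: int ^ 'd) (\<lambda>u. fst (\<omega> u))} \<subseteq> K \<union> D"
        proof
          fix \<omega> :: "int ^ 'd \<Rightarrow> nat \<times> nat"
          assume c: "\<omega> \<in> {\<omega>. crossing N (0 :: int ^ 'd) (\<lambda>u. fst (\<omega> u))}"
          show "\<omega> \<in> K \<union> D"
          proof (cases "\<omega> \<in> D")
            case False
            then have "\<forall>u\<in>nbhd N 0. fst (\<omega> u) = snd (\<omega> u)" by (auto simp: D_def)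
            then have "crossing N 0 (\<lambda>u. fst (\<omega> u)) = crossing N 0 (\<lambda>u. snd (\<omega> u))"
              using crossing_depends[unfolded depends_on_def, rule_format, of N 0 "\<lambda>u. fst (\<omega> u)" "\<lambda>u. snd (\<omega> u)"] by blast
            then show ?thesis using c by (simp add: K_def)
          qed simp
        qed
      qed (use K_meas D_meas in auto)
      also have "\<dots> \<le> prob K + prob D" by (rule measure_Un_le[OF K_meas D_meas])
      also have "\<dots> \<le> \<zeta> ^ (s * 2)" using K D L\<epsilon>(1) by simp
      finally show "prob {\<omega>. crossing N (0 :: int ^ 'd) (\<lambda>u. fst (\<omega> u))}
          \<le> (1 / (8 * real (card (near :: (int ^ 'd) set)) ^ 2)) ^ (card (near :: (int ^ 'd) set) * 2)"
        by (simp add: s_def \<zeta>_def)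
      have "prob {\<omega>. \<exists>u :: int ^ 'd. block N u = 0 \<and> fst (\<omega> u) \<noteq> snd (\<omega> u)} \<le> prob D"
      proof (rule finite_measure_mono[OF _ D_meas])
        show "{\<omega>. \<exists>u :: int ^ 'd. block N u = 0 \<and> fst (\<omega> u) \<noteq> snd (\<omega> u)} \<subseteq> D"
          by (force simp: D_def nbhd_def)
      qed
      also have "\<dots> \<le> \<zeta> ^ (s * r)" using D L\<epsilon>(2) by simp
      finally show "prob {\<omega>. \<exists>u :: int ^ 'd. block N u = 0 \<and> fst (\<omega> u) \<noteq> snd (\<omega> u)}
          \<le> (1 / (8 * real (card (near :: (int ^ 'd) set)) ^ 2)) ^ (card (near :: (int ^ 'd) set) * r)"
        by (simp add: s_def \<zeta>_def)
    qed
    then show ?thesis using r(2) \<pi>(1) by (simp add: m_def)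
  qed
  with \<epsilon> show ?thesis by blast
qed

lemma pmf_expectation_sums:
  fixes P :: "nat pmf"
  assumes "\<And>x. 0 \<le> f x" "\<And>x. f x \<le> 1"
  shows "(\<lambda>x. pmf P x * f x) sums (\<integral>x. f x \<partial>measure_pmf P)"
proof -
  have int: "integrable (measure_pmf P) f"
    by (rule measure_pmf.integrable_const_bound[where B=1]) (use assms in auto)
  have "integrable (density (count_space UNIV) (\<lambda>x. ennreal (pmf P x))) f"
    using int by (simp only: measure_pmf_eq_density[symmetric])
  then have "integrable (count_space UNIV) (\<lambda>x. pmf P x * f x)"
    by (subst (asm) integrable_real_density) auto
  then have "(\<lambda>x. pmf P x * f x) sums (\<integral>x. pmf P x * f x \<partial>count_space UNIV)"
    by (rule sums_integral_count_space_nat)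
  also have "(\<integral>x. pmf P x * f x \<partial>count_space UNIV) = (\<integral>x. f x \<partial>density (count_space UNIV) (\<lambda>x. ennreal (pmf P x)))"
    by (subst integral_real_density) auto
  finally show ?thesis by (simp only: measure_pmf_eq_density[symmetric])
qed

lemma pmf_sums: "pmf (P :: nat pmf) sums 1"
  using pmf_expectation_sums[of "\<lambda>_. 1" P] by simp

lemma embed_pmf_nat:
  fixes f :: "nat \<Rightarrow> real"
  assumes "\<And>x. 0 \<le> f x" "f sums 1"
  shows "pmf (embed_pmf f) x = f x"
proof (rule pmf_embed_pmf[OF assms(1)])
  have "(\<integral>\<^sup>+x. ennreal (f x) \<partial>count_space UNIV) = (\<Sum>x. ennreal (f x))" by (rule nn_integral_count_space_nat)
  also have "\<dots> = 1" using assms by (subst suminf_ennreal_eq[OF _ assms(2)]) auto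
  finally show "(\<integral>\<^sup>+x. ennreal (f x) \<partial>count_space UNIV) = 1" .
qed

text \<open>The maximal coupling: draw \<open>x\<close> from \<open>P\<close>, keep it as second component with probability \<open>min (P x) (Q x) / P x\<close>, and otherwise draw the
  second component from the normalized excess of \<open>Q\<close> over \<open>P\<close>. The probability \<open>e\<close> of not keeping is the total
  excess.\<close>

lemma coupling_exists:
  fixes P Q :: "nat pmf"
  obtains \<pi> where "map_pmf fst \<pi> = P" "map_pmf snd \<pi> = Q"
    "measure (measure_pmf \<pi>) {x. fst x \<noteq> snd x} \<le> (\<Sum>x. pmf Q x - min (pmf P x) (pmf Q x))"
    "summable (\<lambda>x. pmf Q x - min (pmf P x) (pmf Q x))"
proof -
  define r where "r x = min (pmf P x) (pmf Q x)" for x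
  define k where "k x = r x / pmf P x" for x
  have r: "0 \<le> r x" "r x \<le> pmf P x" "r x \<le> pmf Q x" for x by (auto simp: r_def)
  have k: "0 \<le> k x" "k x \<le> 1" "pmf P x * k x = r x" for x
    using r[of x] by (auto simp: k_def divide_le_eq)
  define e where "e = (\<integral>x. 1 - k x \<partial>measure_pmf P)"
  have e_nn: "e \<ge> 0" unfolding e_def by (rule integral_nonneg_AE) (use k in auto)
  have "(\<lambda>x. pmf P x * (1 - k x)) sums e" unfolding e_def by (rule pmf_expectation_sums) (use k in auto)
  then have "(\<lambda>x. pmf P x - r x) sums e" by (simp add: right_diff_distrib k(3))
  from sums_diff[OF pmf_sums[of P] this] have "r sums (1 - e)" by simp
  from sums_diff[OF pmf_sums[of Q] this] have Qr: "(\<lambda>x. pmf Q x - r x) sums e" by simp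
  (* if e = 0 then B is never drawn *)
  define B where "B = (if e = 0 then Q else embed_pmf (\<lambda>x. (pmf Q x - r x) / e))"
  have B: "r y + pmf B y * e = pmf Q y" for y
  proof (cases "e = 0")
    case True
    have "pmf Q y - r y = 0"
    proof (rule ccontr)
      assume "pmf Q y - r y \<noteq> 0"
      then have "0 < (\<Sum>x. pmf Q x - r x)"
        using r Qr by (intro suminf_pos2[of _ y]) (auto simp: sums_iff less_le)
      then show False using Qr True by (simp add: sums_iff)
    qed
    then show ?thesis using True by simp
  next
    case False
    have "(\<lambda>x. (pmf Q x - r x) / e) sums (e / e)" using Qr by (rule sums_divide)
    then have "pmf B y = (pmf Q y - r y) / e"
      unfolding B_def using False r e_nn by (simp add: embed_pmf_nat)
    then show ?thesis using False by simp
  qed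
  define \<pi> where "\<pi> = bind_pmf P (\<lambda>x. bind_pmf (bernoulli_pmf (k x)) (\<lambda>b. if b then return_pmf (x, x) else map_pmf (Pair x) B))"
  have fst: "map_pmf fst \<pi> = P"
  proof -
    have "map_pmf fst (if b then return_pmf (x, x) else map_pmf (Pair x) B) = return_pmf x" for b x
      by (simp add: map_pmf_comp o_def map_pmf_const)
    then show ?thesis by (simp add: \<pi>_def map_bind_pmf bind_return_pmf')
  qed
  have snd: "map_pmf snd \<pi> = Q"
  proof (rule pmf_eqI)
    fix y
    have inner: "map_pmf snd (if b then return_pmf (x, x) else map_pmf (Pair x) B) = (if b then return_pmf x else B)" for b x
      by (simp add: map_pmf_comp o_def)
    have ind: "0 \<le> k x * indicator {y} x" "k x * indicator {y} x \<le> 1" for x using k[of x] by (auto simp: indicator_def)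
    have "pmf (map_pmf snd \<pi>) y = (\<integral>x. k x * indicator {y} x + (1 - k x) * pmf B y \<partial>measure_pmf P)"
    proof -
      have "pmf (bind_pmf (bernoulli_pmf (k x)) (\<lambda>b. if b then return_pmf x else B)) y
          = k x * indicator {y} x + (1 - k x) * pmf B y" for x
        unfolding pmf_bind using k[of x] by (simp add: indicator_def)
      then show ?thesis
        unfolding \<pi>_def map_bind_pmf inner by (subst pmf_bind) simp
    qed
    also have "\<dots> = (\<integral>x. k x * indicator {y} x \<partial>measure_pmf P) + e * pmf B y"
      unfolding e_def using k ind
      by (subst Bochner_Integration.integral_add)
         (auto intro!: measure_pmf.integrable_const_bound[where B=1] mult_le_one pmf_le_1)
    also have "(\<integral>x. k x * indicator {y} x \<partial>measure_pmf P) = r y"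
    proof -
      have "(\<lambda>x. pmf P x * (k x * indicator {y} x)) sums (\<integral>x. k x * indicator {y} x \<partial>measure_pmf P)"
        by (rule pmf_expectation_sums) (rule ind)+
      moreover have "(\<lambda>x. pmf P x * (k x * indicator {y} x)) = (\<lambda>x. if x = y then r x else 0)"
        by (auto simp: fun_eq_iff indicator_def k(3))
      ultimately show ?thesis using sums_single[of y r] sums_unique2 by metis
    qed
    finally show "pmf (map_pmf snd \<pi>) y = pmf Q y" using B[of y] by (simp add: mult.commute)
  qed
  have "emeasure (measure_pmf \<pi>) {x. fst x \<noteq> snd x} \<le> ennreal e"
  proof -
    have "emeasure (measure_pmf \<pi>) {x. fst x \<noteq> snd x} \<le> (\<integral>\<^sup>+x. ennreal (1 - k x) \<partial>measure_pmf P)"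
      unfolding \<pi>_def emeasure_bind_pmf
    proof (rule nn_integral_mono)
      fix x
      have "emeasure (measure_pmf (map_pmf (Pair x) B)) {x. fst x \<noteq> snd x} * ennreal (1 - k x) \<le> 1 * ennreal (1 - k x)"
        by (rule mult_right_mono) (auto simp: measure_pmf.emeasure_le_1)
      then show "(\<integral>\<^sup>+b. emeasure (measure_pmf (if b then return_pmf (x, x) else map_pmf (Pair x) B)) {x. fst x \<noteq> snd x} \<partial>measure_pmf (bernoulli_pmf (k x))) \<le> ennreal (1 - k x)"
        using k[of x] by simp
    qed
    also have "\<dots> = ennreal e" unfolding e_def
      by (rule nn_integral_eq_integral) (use k in \<open>auto intro!: measure_pmf.integrable_const_bound[where B=1]\<close>)
    finally show ?thesis .
  qed
  then have "measure (measure_pmf \<pi>) {x. fst x \<noteq> snd x} \<le> e"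
    using e_nn by (simp add: measure_pmf.emeasure_eq_measure)
  then show ?thesis using that[OF fst snd] Qr by (simp add: sums_iff r_def)
qed

section \<open>Real directions\<close>

lemma color_seqD:
  assumes "p \<in> color_seqs"
  shows "p 0 = 0" "0 \<le> p i" "p sums 1"
proof -
  show p0: "p 0 = 0" using assms by (simp add: color_seqs_def)
  show "0 \<le> p i" using assms p0 by (cases "i = 0") (auto simp: color_seqs_def)
  have "(p has_sum 1) {1..}" using assms by (simp add: color_seqs_def)
  also have "?this \<longleftrightarrow> (p has_sum 1) UNIV"
    by (rule has_sum_cong_neutral) (use p0 in \<open>auto simp: not_le\<close>)
  finally show "p sums 1" by (rule has_sum_imp_sums)
qed

lemma pmf_color_seq: "p \<in> color_seqs \<Longrightarrow> pmf (embed_pmf p) i = p i"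
  using color_seqD by (intro embed_pmf_nat) auto

text \<open>The color law lives on the positive integers and the mass function on all natural numbers, where 0 has mass 0.\<close>

lemma color_law_pmf:
  assumes "p \<in> color_seqs"
  shows "prob_space (color_law p)" "(\<lambda>x. x) \<in> measurable (color_law p) (measure_pmf (embed_pmf p))"
    "distr (color_law p) (measure_pmf (embed_pmf p)) (\<lambda>x. x) = measure_pmf (embed_pmf p)"
proof -
  show meas: "(\<lambda>x. x) \<in> measurable (color_law p) (measure_pmf (embed_pmf p))"
    by (rule measurableI) (auto simp: color_law_def space_point_measure sets_point_measure)
  show eq: "distr (color_law p) (measure_pmf (embed_pmf p)) (\<lambda>x. x) = measure_pmf (embed_pmf p)"
  proof (rule measure_eqI)
    fix A :: "nat set"
    have "emeasure (distr (color_law p) (measure_pmf (embed_pmf p)) (\<lambda>x. x)) A = emeasure (color_law p) (A \<inter> {1..})"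
      using meas by (subst emeasure_distr) (auto simp: color_law_def space_point_measure vimage_def)
    also have "\<dots> = (\<integral>\<^sup>+x. ennreal (p x) * indicator (A \<inter> {1..}) x \<partial>count_space {1..})"
      unfolding color_law_def point_measure_def by (subst emeasure_density) auto
    also have "\<dots> = (\<integral>\<^sup>+x. ennreal (p x) * indicator (A \<inter> {1..}) x * indicator {1..} x \<partial>count_space UNIV)"
      by (subst nn_integral_count_space_indicator) auto
    also have "\<dots> = (\<integral>\<^sup>+x. ennreal (pmf (embed_pmf p) x) * indicator A x \<partial>count_space UNIV)"
      using color_seqD(1)[OF assms] pmf_color_seq[OF assms]
      by (intro nn_integral_cong) (auto simp: indicator_def not_le)
    also have "\<dots> = emeasure (measure_pmf (embed_pmf p)) A"
      by (simp add: nn_integral_measure_pmf[symmetric])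
    finally show "emeasure (distr (color_law p) (measure_pmf (embed_pmf p)) (\<lambda>x. x)) A = emeasure (measure_pmf (embed_pmf p)) A" .
  qed simp
  have "emeasure (color_law p) (space (color_law p)) = emeasure (distr (color_law p) (measure_pmf (embed_pmf p)) (\<lambda>x. x)) UNIV"
    using meas by (subst emeasure_distr) auto
  then show "prob_space (color_law p)" unfolding eq
    using measure_pmf.emeasure_space_1[of "embed_pmf p"] by (intro prob_spaceI) simp
qed

lemma AE_coloring_measure:
  fixes R :: "(int ^ 'd \<Rightarrow> nat) \<Rightarrow> bool"
  assumes "p \<in> color_seqs" "AE \<omega> in iid (embed_pmf p). R \<omega>"
  shows "AE \<omega> in coloring_measure p. R \<omega>"
proof -
  note c = color_law_pmf[OF assms(1)]
  have eq: "distr (coloring_measure p) (iid (embed_pmf p)) (\<lambda>\<omega> (u :: int ^ 'd). \<omega> u) = iid (embed_pmf p)"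
    using distr_PiM_map[OF c(1,2)] unfolding c(3) by (simp add: coloring_measure_def iid_def)
  have "AE \<omega> in distr (coloring_measure p) (iid (embed_pmf p)) (\<lambda>\<omega> (u :: int ^ 'd). \<omega> u). R \<omega>"
    unfolding eq by (rule assms(2))
  moreover have "(\<lambda>\<omega> (u :: int ^ 'd). \<omega> u) \<in> measurable (coloring_measure p) (iid (embed_pmf p))"
    unfolding coloring_measure_def iid_def
  proof (rule measurable_PiM_single')
    fix u :: "int ^ 'd"
    have "(\<lambda>\<omega>. \<omega> u) \<in> measurable (PiM UNIV (\<lambda>_. color_law p)) (color_law p)"
      by (rule measurable_component_singleton) simp
    then show "(\<lambda>\<omega>. \<omega> u) \<in> measurable (PiM UNIV (\<lambda>_. color_law p)) (measure_pmf (embed_pmf p))"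
      using c(2) by (rule measurable_compose)
  qed (simp add: PiE_UNIV_domain)
  ultimately show ?thesis by (rule AE_distrD[rotated])
qed

lemma time_const_eq:
  fixes x :: "real ^ 'd"
  assumes "p \<in> color_seqs"
    and "AE \<omega> in iid (embed_pmf p). (\<lambda>n. passage_time \<omega> 0 (real n *\<^sub>R x) / real n) \<longlonglongrightarrow> c"
  shows "time_const p x = c"
  unfolding time_const_def
proof (rule the_equality)
  show AE: "AE \<omega> in coloring_measure p. (\<lambda>n. passage_time \<omega> 0 (real n *\<^sub>R x) / real n) \<longlonglongrightarrow> c"
    by (rule AE_coloring_measure) fact+
  fix c' assume "AE \<omega> in coloring_measure p. (\<lambda>n. passage_time \<omega> 0 (real n *\<^sub>R x) / real n) \<longlonglongrightarrow> c'"
  with AE have "AE \<omega> in coloring_measure p :: (int ^ 'd \<Rightarrow> nat) measure. c' = c"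
    by eventually_elim (rule LIMSEQ_unique)
  moreover have "prob_space (coloring_measure p :: (int ^ 'd \<Rightarrow> nat) measure)"
    unfolding coloring_measure_def by (rule prob_space_PiM) (rule color_law_pmf(1)[OF assms(1)])
  ultimately show "c' = c" by (simp add: prob_space.AE_const)
qed

lemma nearest_site_0 [simp]: "nearest_site 0 = 0"
  by (simp add: nearest_site_def vec_eq_iff)

lemma nearest_site_coord: "\<bar>real_of_int (nearest_site x $ i) - x $ i\<bar> \<le> 1 / 2"
  unfolding nearest_site_def vec_lambda_beta by (rule of_int_round_abs_le)

lemma l1_bound:
  assumes "\<And>i. \<bar>real_of_int (z $ i)\<bar> \<le> f i"
  shows "l1 z \<le> (\<Sum>i\<in>UNIV. f i)"
  unfolding l1_def using assms by (simp add: sum_mono)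

text \<open>Compare both sites with \<open>n x\<close>: each of the \<open>n div K\<close> multiples contributes a rounding error of at most \<open>1/2\<close> per
  coordinate, and the remainder \<open>n mod K\<close> at most \<open>K\<close> times the size of \<open>x\<close>.\<close>

lemma nearest_site_multiple:
  fixes x :: "real ^ 'd"
  assumes "K \<ge> 1"
  shows "l1 (nearest_site (real n *\<^sub>R x) - int (n div K) *s nearest_site (real K *\<^sub>R x))
    \<le> real CARD('d) / 2 + real K * (\<Sum>i\<in>UNIV. \<bar>x $ i\<bar>) + real (n div K) * real CARD('d) / 2"
proof -
  define j where "j = n div K"
  have "\<bar>real_of_int ((nearest_site (real n *\<^sub>R x) - int j *s nearest_site (real K *\<^sub>R x)) $ i)\<bar>
      \<le> 1 / 2 + real K * \<bar>x $ i\<bar> + real j / 2" for i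
  proof -
    have a: "\<bar>real_of_int (nearest_site (real n *\<^sub>R x) $ i) - real n * x $ i\<bar> \<le> 1 / 2"
      using nearest_site_coord[of "real n *\<^sub>R x" i] by simp
    have b: "real j * \<bar>real_of_int (nearest_site (real K *\<^sub>R x) $ i) - real K * x $ i\<bar> \<le> real j * (1 / 2)"
      using nearest_site_coord[of "real K *\<^sub>R x" i] by (intro mult_left_mono) auto
    have "real n = real j * real K + real (n mod K)" unfolding j_def by (metis div_mult_mod_eq of_nat_add of_nat_mult)
    moreover have "real (n mod K) \<le> real K" using assms by (simp add: less_imp_le)
    ultimately have "\<bar>(real n - real j * real K) * x $ i\<bar> \<le> real K * \<bar>x $ i\<bar>"
      by (simp add: abs_mult mult_right_mono)
    then have c: "\<bar>real n * x $ i - real j * (real K * x $ i)\<bar> \<le> real K * \<bar>x $ i\<bar>" by (simp add: algebra_simps)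
    have b': "\<bar>real j * (real K * x $ i) - real j * real_of_int (nearest_site (real K *\<^sub>R x) $ i)\<bar> \<le> real j / 2"
      using b by (simp add: abs_mult abs_minus_commute flip: right_diff_distrib)
    have "real_of_int ((nearest_site (real n *\<^sub>R x) - int j *s nearest_site (real K *\<^sub>R x)) $ i)
        = real_of_int (nearest_site (real n *\<^sub>R x) $ i) - real j * real_of_int (nearest_site (real K *\<^sub>R x) $ i)" by simp
    then show ?thesis using a b' c by linarith
  qed
  then have "l1 (nearest_site (real n *\<^sub>R x) - int j *s nearest_site (real K *\<^sub>R x))
      \<le> (\<Sum>i\<in>(UNIV :: 'd set). 1 / 2 + real K * \<bar>x $ i\<bar> + real j / 2)" by (rule l1_bound)
  also have "\<dots> = real CARD('d) / 2 + real K * (\<Sum>i\<in>UNIV. \<bar>x $ i\<bar>) + real j * real CARD('d) / 2"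
    by (simp add: sum.distrib sum_distrib_left)
  finally show ?thesis by (simp add: j_def)
qed

lemma l1_nearest_diff:
  "l1 (nearest_site x - nearest_site y) \<le> (\<Sum>i\<in>UNIV. \<bar>x $ i - y $ i\<bar>) + real CARD('d)"
  for x y :: "real ^ 'd"
proof -
  have "l1 (nearest_site x - nearest_site y) \<le> (\<Sum>i\<in>(UNIV :: 'd set). \<bar>x $ i - y $ i\<bar> + 1)"
  proof (rule l1_bound)
    fix i
    show "\<bar>real_of_int ((nearest_site x - nearest_site y) $ i)\<bar> \<le> \<bar>x $ i - y $ i\<bar> + 1"
    proof -
      have "real_of_int ((nearest_site x - nearest_site y) $ i)
          = real_of_int (nearest_site x $ i) - real_of_int (nearest_site y $ i)" by simp
      then show ?thesis using nearest_site_coord[of x i] nearest_site_coord[of y i] by linarith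
    qed
  qed
  then show ?thesis by (simp add: sum.distrib)
qed

text \<open>By \<open>nearest_site_multiple\<close>, \<open>T(0, n x) / n\<close> is eventually within \<open>d / K\<close> of \<open>a K\<close>, the normalized rate of the
  lattice vector nearest to \<open>K x\<close>, almost surely for all \<open>K\<close> at once. Hence \<open>a\<close> is a Cauchy sequence, and its limit is the limit of
  \<open>T(0, n x) / n\<close>.\<close>

lemma passage_time_rate:
  fixes x :: "real ^ 'd" and P :: "nat pmf"
  obtains c where "AE \<omega> in iid P. (\<lambda>n. passage_time \<omega> 0 (real n *\<^sub>R x) / real n) \<longlonglongrightarrow> c"
    "\<And>K. K \<ge> 1 \<Longrightarrow> \<bar>c - time_rate P (nearest_site (real K *\<^sub>R x)) / real K\<bar> \<le> real CARD('d) / real K"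
proof -
  interpret prob_space "iid P :: (int ^ 'd \<Rightarrow> nat) measure" by (rule prob_space_iid)
  define z where "z K = nearest_site (real K *\<^sub>R x)" for K :: nat
  define a where "a K = time_rate P (z K) / real K" for K
  define T where "T \<omega> n = passage_time \<omega> 0 (real n *\<^sub>R x) / real n" for \<omega> and n :: nat
  define d where "d = real CARD('d)"
  have d: "d > 0" by (simp add: d_def)
  have near: "eventually (\<lambda>n. \<bar>T \<omega> n - a K\<bar> < d / real K) sequentially"
    if K: "K \<ge> 1" and lim: "(\<lambda>j. site_time \<omega> 0 (int j *s z K) / real j) \<longlonglongrightarrow> time_rate P (z K)" for K \<omega>
  proof -
    define D where "D = d / 2 + real K * (\<Sum>i\<in>UNIV. \<bar>x $ i\<bar>)"
    define b where "b j = site_time \<omega> 0 (int j *s z K) / real j" for j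
    have divK: "filterlim (\<lambda>n. n div K) at_top sequentially"
      by (rule filterlim_div_at_top) (use K in simp)
    have "(\<lambda>n. b (n div K)) \<longlonglongrightarrow> time_rate P (z K)"
      using filterlim_compose[OF lim divK] by (simp add: b_def)
    moreover have ratio: "(\<lambda>n. real (n div K) / real n) \<longlonglongrightarrow> 1 / real K"
    proof -
      have "(\<lambda>n. 1 / real K - real (n mod K) / real n / real K) \<longlonglongrightarrow> 1 / real K - 0 / real K"
      proof (intro tendsto_intros)
        have "(\<lambda>n. real K / real n) \<longlonglongrightarrow> 0" by real_asymp
        then show "(\<lambda>n. real (n mod K) / real n) \<longlonglongrightarrow> 0"
          by (rule tendsto_sandwich[OF _ _ tendsto_const, rotated 2])
             (use K in \<open>auto intro!: always_eventually divide_right_mono simp: less_imp_le\<close>)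
      qed (use K in simp)
      moreover have "eventually (\<lambda>n. 1 / real K - real (n mod K) / real n / real K = real (n div K) / real n) sequentially"
        using eventually_gt_at_top[of 0]
      proof eventually_elim
        case (elim n)
        have "real n = real (n div K) * real K + real (n mod K)" by (metis div_mult_mod_eq of_nat_add of_nat_mult)
        then have "real n - real (n mod K) = real (n div K) * real K" by simp
        then have "(real n - real (n mod K)) / (real n * real K) = real (n div K) / real n" using K by simp
        then show ?case using K elim by (simp add: diff_divide_distrib)
      qed
      ultimately show ?thesis by (simp add: Lim_transform_eventually)
    qed
    ultimately have "(\<lambda>n. real (n div K) / real n * b (n div K)) \<longlonglongrightarrow> 1 / real K * time_rate P (z K)"
      by (intro tendsto_mult)
    then have "(\<lambda>n. real (n div K) / real n * b (n div K)) \<longlonglongrightarrow> a K" by (simp add: a_def)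
    then have "eventually (\<lambda>n. dist (real (n div K) / real n * b (n div K)) (a K) < d / (8 * real K)) sequentially"
      by (rule tendstoD) (use d K in simp)
    moreover have "eventually (\<lambda>n. D / real n < d / (8 * real K)) sequentially"
    proof -
      have "(\<lambda>n. D / real n) \<longlonglongrightarrow> 0" by real_asymp
      then show ?thesis by (rule order_tendstoD(2)) (use d K in simp)
    qed
    moreover have "eventually (\<lambda>n. real (n div K) / real n * d / 2 < d / (2 * real K) + d / (8 * real K)) sequentially"
    proof -
      have "(\<lambda>n. real (n div K) / real n * d / 2) \<longlonglongrightarrow> 1 / real K * d / 2" by (intro tendsto_intros ratio) simp
      then show ?thesis by (rule order_tendstoD(2)) (use d K in \<open>simp add: field_simps\<close>)
    qed
    ultimately show ?thesis using eventually_ge_at_top[of K]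
    proof eventually_elim
      case (elim n)
      have n: "n > 0" "n div K > 0" using K elim by (auto simp: div_greater_zero_iff)
      have "\<bar>passage_time \<omega> 0 (real n *\<^sub>R x) - site_time \<omega> 0 (int (n div K) *s z K)\<bar>
          \<le> l1 (nearest_site (real n *\<^sub>R x) - int (n div K) *s z K)"
        unfolding passage_time_def using site_time_perturb[of \<omega> 0 "nearest_site (real n *\<^sub>R x)" 0] by simp
      also have "\<dots> \<le> D + real (n div K) * d / 2"
        using nearest_site_multiple[OF K, of n x] by (simp add: D_def d_def z_def)
      finally have "\<bar>passage_time \<omega> 0 (real n *\<^sub>R x) - site_time \<omega> 0 (int (n div K) *s z K)\<bar> / real n
          \<le> (D + real (n div K) * d / 2) / real n" by (rule divide_right_mono) simp
      moreover have "real (n div K) / real n * b (n div K) = site_time \<omega> 0 (int (n div K) *s z K) / real n"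
        using n by (simp add: b_def)
      then have "T \<omega> n - real (n div K) / real n * b (n div K)
          = (passage_time \<omega> 0 (real n *\<^sub>R x) - site_time \<omega> 0 (int (n div K) *s z K)) / real n"
        by (simp only: T_def diff_divide_distrib)
      then have "\<bar>T \<omega> n - real (n div K) / real n * b (n div K)\<bar>
          = \<bar>passage_time \<omega> 0 (real n *\<^sub>R x) - site_time \<omega> 0 (int (n div K) *s z K)\<bar> / real n"
        by (simp only: abs_divide abs_of_nat)
      moreover have "(D + real (n div K) * d / 2) / real n = D / real n + real (n div K) / real n * d / 2"
        by (simp add: add_divide_distrib)
      ultimately have "\<bar>T \<omega> n - real (n div K) / real n * b (n div K)\<bar> \<le> D / real n + real (n div K) / real n * d / 2"
        by simp
      moreover have "d / (8 * real K) + (d / (2 * real K) + d / (8 * real K)) + d / (8 * real K) \<le> d / real K"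
        using d K by (simp add: field_simps)
      moreover have "\<bar>t - a\<bar> < M" if "\<bar>t - q\<bar> \<le> D' + r" "E + (h + E) + E \<le> M" "\<bar>q - a\<bar> < E" "D' < E" "r < h + E"
        for t a q D' r E h M :: real using that by linarith
      ultimately show ?case using elim(1-3) unfolding dist_real_def by blast
    qed
  qed
  have "AE \<omega> in iid P. \<forall>K. (\<lambda>j. site_time \<omega> 0 (int j *s z K) / real j) \<longlonglongrightarrow> time_rate P (z K)"
    unfolding AE_all_countable by (intro allI site_time_rate)
  then have AE: "AE \<omega> in iid P. \<forall>K\<ge>1. eventually (\<lambda>n. \<bar>T \<omega> n - a K\<bar> < d / real K) sequentially"
    by eventually_elim (use near in blast)
  (* one typical coloring suffices to compare the deterministic numbers a K and a L *)
  obtain \<omega>0 where \<omega>0: "\<forall>K\<ge>1. eventually (\<lambda>n. \<bar>T \<omega>0 n - a K\<bar> < d / real K) sequentially"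
  proof -
    have "\<exists>\<omega>. \<forall>K\<ge>1. eventually (\<lambda>n. \<bar>T \<omega> n - a K\<bar> < d / real K) sequentially"
    proof (rule ccontr)
      assume "\<not> ?thesis"
      then have no: "\<not> (\<forall>K\<ge>1. eventually (\<lambda>n. \<bar>T \<omega> n - a K\<bar> < d / real K) sequentially)" for \<omega> by blast
      have "AE \<omega> in iid P :: (int ^ 'd \<Rightarrow> nat) measure. False" using AE
        by eventually_elim (use no in blast)
      then show False by (simp add: AE_const)
    qed
    then show ?thesis using that by blast
  qed
  have dist_a: "\<bar>a K - a L\<bar> < d / real K + d / real L" if "K \<ge> 1" "L \<ge> 1" for K L
  proof -
    have "eventually (\<lambda>n. \<bar>T \<omega>0 n - a K\<bar> < d / real K \<and> \<bar>T \<omega>0 n - a L\<bar> < d / real L) sequentially"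
      using \<omega>0 that by (auto intro: eventually_conj)
    then obtain n where "\<bar>T \<omega>0 n - a K\<bar> < d / real K" "\<bar>T \<omega>0 n - a L\<bar> < d / real L"
      using eventually_happens[of _ sequentially] by auto
    then show ?thesis by linarith
  qed
  have small: "eventually (\<lambda>K. K \<ge> 1 \<and> d / real K < e) sequentially" if "e > 0" for e :: real
  proof -
    have "(\<lambda>K. d / real K) \<longlonglongrightarrow> 0" by real_asymp
    then have "eventually (\<lambda>K. d / real K < e) sequentially" by (rule order_tendstoD(2)) fact
    with eventually_ge_at_top[of "1::nat"] show ?thesis by eventually_elim simp
  qed
  have "Cauchy a"
  proof (rule metric_CauchyI)
    fix e :: real assume "e > 0"
    then obtain M where M: "\<And>K. K \<ge> M \<Longrightarrow> K \<ge> 1 \<and> d / real K < e / 2"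
      using small[of "e / 2"] by (auto simp: eventually_sequentially)
    have "dist (a K) (a L) < e" if "K \<ge> M" "L \<ge> M" for K L
      using dist_a[of K L] M[OF that(1)] M[OF that(2)] unfolding dist_real_def by linarith
    then show "\<exists>M. \<forall>m\<ge>M. \<forall>n\<ge>M. dist (a m) (a n) < e" by blast
  qed
  then obtain c where c: "a \<longlonglongrightarrow> c" using Cauchy_convergent_iff convergent_def by blast
  have ca: "\<bar>c - a K\<bar> \<le> d / real K" if K: "K \<ge> 1" for K
  proof (rule tendsto_le)
    show "(\<lambda>L. \<bar>a L - a K\<bar>) \<longlonglongrightarrow> \<bar>c - a K\<bar>" by (intro tendsto_intros c)
    have "(\<lambda>L. d / real K + d / real L) \<longlonglongrightarrow> d / real K + 0" by (intro tendsto_intros)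
    then show "(\<lambda>L. d / real K + d / real L) \<longlonglongrightarrow> d / real K" by simp
    show "eventually (\<lambda>L. \<bar>a L - a K\<bar> \<le> d / real K + d / real L) sequentially"
      using eventually_ge_at_top[of 1]
    proof eventually_elim
      case (elim L)
      then show ?case using dist_a[OF _ K, of L] by simp
    qed
  qed simp
  have "AE \<omega> in iid P. T \<omega> \<longlonglongrightarrow> c"
    using AE
  proof eventually_elim
    case (elim \<omega>)
    show ?case
    proof (rule tendstoI)
      fix e :: real assume "e > 0"
      then obtain K where K: "K \<ge> 1" "d / real K < e / 2"
        using small[of "e / 2"] eventually_happens[of _ sequentially] by auto
      from elim K(1) have "eventually (\<lambda>n. \<bar>T \<omega> n - a K\<bar> < d / real K) sequentially" by blast
      then show "eventually (\<lambda>n. dist (T \<omega> n) c < e) sequentially"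
      proof eventually_elim
        case (elim n)
        then show ?case using ca[OF K(1)] K(2) unfolding dist_real_def by linarith
      qed
    qed
  qed
  then show ?thesis using that[of c] ca unfolding T_def[abs_def] a_def z_def d_def by blast
qed

section \<open>Continuity of the time constant\<close>

lemma time_const_approx:
  fixes x :: "real ^ 'd"
  assumes "p \<in> color_seqs" "K \<ge> 1"
  shows "\<bar>time_const p x - time_rate (embed_pmf p) (nearest_site (real K *\<^sub>R x)) / real K\<bar> \<le> real CARD('d) / real K"
proof -
  obtain c where c: "AE \<omega> in iid (embed_pmf p). (\<lambda>n. passage_time \<omega> 0 (real n *\<^sub>R x) / real n) \<longlonglongrightarrow> c"
    "\<And>K. K \<ge> 1 \<Longrightarrow> \<bar>c - time_rate (embed_pmf p) (nearest_site (real K *\<^sub>R x)) / real K\<bar> \<le> real CARD('d) / real K"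
    using passage_time_rate[where P="embed_pmf p" and x=x] by blast
  show ?thesis unfolding time_const_eq[OF assms(1) c(1)] by (rule c(2)[OF assms(2)])
qed

lemma time_const_lipschitz:
  fixes x y :: "real ^ 'd"
  assumes "p \<in> color_seqs"
  shows "\<bar>time_const p x - time_const p y\<bar> \<le> real CARD('d) * dist x y"
proof -
  interpret prob_space "iid (embed_pmf p) :: (int ^ 'd \<Rightarrow> nat) measure" by (rule prob_space_iid)
  obtain c where c: "AE \<omega> in iid (embed_pmf p). (\<lambda>n. passage_time \<omega> 0 (real n *\<^sub>R x) / real n) \<longlonglongrightarrow> c"
    using passage_time_rate[where P="embed_pmf p" and x=x] by blast
  obtain c' where c': "AE \<omega> in iid (embed_pmf p). (\<lambda>n. passage_time \<omega> 0 (real n *\<^sub>R y) / real n) \<longlonglongrightarrow> c'"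
    using passage_time_rate[where P="embed_pmf p" and x=y] by blast
  define s where "s = (\<Sum>i\<in>(UNIV :: 'd set). \<bar>x $ i - y $ i\<bar>)"
  have le: "\<bar>passage_time \<omega> 0 (real n *\<^sub>R x) / real n - passage_time \<omega> 0 (real n *\<^sub>R y) / real n\<bar> \<le> s + real CARD('d) / real n"
    if n: "n \<ge> 1" for n and \<omega> :: "int ^ 'd \<Rightarrow> nat"
  proof -
    have "\<bar>passage_time \<omega> 0 (real n *\<^sub>R x) - passage_time \<omega> 0 (real n *\<^sub>R y)\<bar>
        \<le> l1 (nearest_site (real n *\<^sub>R x) - nearest_site (real n *\<^sub>R y))"
      unfolding passage_time_def using site_time_perturb[of \<omega> 0 "nearest_site (real n *\<^sub>R x)" 0] by simp
    also have "\<dots> \<le> (\<Sum>i\<in>UNIV. \<bar>(real n *\<^sub>R x) $ i - (real n *\<^sub>R y) $ i\<bar>) + real CARD('d)"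
      by (rule l1_nearest_diff)
    also have "(\<Sum>i\<in>UNIV. \<bar>(real n *\<^sub>R x) $ i - (real n *\<^sub>R y) $ i\<bar>) = real n * s"
      by (simp add: s_def sum_distrib_left abs_mult flip: right_diff_distrib)
    finally have "\<bar>passage_time \<omega> 0 (real n *\<^sub>R x) - passage_time \<omega> 0 (real n *\<^sub>R y)\<bar> / real n \<le> (real n * s + real CARD('d)) / real n"
      by (rule divide_right_mono) simp
    then show ?thesis using n by (simp add: add_divide_distrib flip: diff_divide_distrib)
  qed
  have "AE \<omega> in iid (embed_pmf p) :: (int ^ 'd \<Rightarrow> nat) measure. \<bar>c - c'\<bar> \<le> s"
    using c c'
  proof eventually_elim
    case (elim \<omega>)
    show ?case
    proof (rule tendsto_le)
      show "(\<lambda>n. \<bar>passage_time \<omega> 0 (real n *\<^sub>R x) / real n - passage_time \<omega> 0 (real n *\<^sub>R y) / real n\<bar>) \<longlonglongrightarrow> \<bar>c - c'\<bar>"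
        by (intro tendsto_intros elim)
      have "(\<lambda>n. s + real CARD('d) / real n) \<longlonglongrightarrow> s + 0" by (intro tendsto_intros)
      then show "(\<lambda>n. s + real CARD('d) / real n) \<longlonglongrightarrow> s" by simp
      show "eventually (\<lambda>n. \<bar>passage_time \<omega> 0 (real n *\<^sub>R x) / real n - passage_time \<omega> 0 (real n *\<^sub>R y) / real n\<bar>
          \<le> s + real CARD('d) / real n) sequentially"
        using eventually_ge_at_top[of 1] by eventually_elim (rule le)
    qed simp
  qed
  then have "\<bar>c - c'\<bar> \<le> s" by simp
  also have "s \<le> (\<Sum>i\<in>(UNIV :: 'd set). dist x y)"
    unfolding s_def
  proof (rule sum_mono)
    fix i show "\<bar>x $ i - y $ i\<bar> \<le> dist x y" using component_le_norm_cart[of "x - y" i] by (simp add: dist_norm)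
  qed
  finally show ?thesis unfolding time_const_eq[OF assms c] time_const_eq[OF assms c'] by simp
qed

text \<open>The total mass is 1 for both sequences, so closeness of finitely many coordinates controls the whole excess of \<open>q\<close> over
  \<open>p\<close>: what lies beyond the first \<open>n\<close> coordinates is at most the small tail of \<open>q\<close>.\<close>

lemma color_seqs_close:
  assumes q: "q \<in> color_seqs" and "\<epsilon> > 0"
  shows "\<exists>n \<delta>. \<delta> > 0 \<and> (\<forall>p\<in>color_seqs. (\<forall>i<n. \<bar>p i - q i\<bar> < \<delta>) \<longrightarrow>
     summable (\<lambda>x. q x - min (p x) (q x)) \<longrightarrow> (\<Sum>x. q x - min (p x) (q x)) \<le> \<epsilon>)"
proof -
  note Q = color_seqD[OF q]
  have "(\<lambda>n. \<Sum>i<n. q i) \<longlonglongrightarrow> 1" using Q(3) by (simp add: sums_def)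
  then have "eventually (\<lambda>n. 1 - \<epsilon> / 2 < (\<Sum>i<n. q i)) sequentially" by (rule order_tendstoD(1)) (use assms in simp)
  then obtain n where n: "1 - \<epsilon> / 2 < (\<Sum>i<n. q i)" using eventually_happens[of _ sequentially] by auto
  define \<delta> where "\<delta> = \<epsilon> / (2 * real (n + 1))"
  have "\<delta> > 0" using assms by (simp add: \<delta>_def)
  moreover have "(\<Sum>x. q x - min (p x) (q x)) \<le> \<epsilon>"
    if p: "p \<in> color_seqs" and close: "\<And>i. i < n \<Longrightarrow> \<bar>p i - q i\<bar> < \<delta>" and sm: "summable (\<lambda>x. q x - min (p x) (q x))" for p
  proof -
    let ?f = "\<lambda>x. q x - min (p x) (q x)"
    have "(\<Sum>x. ?f x) = (\<Sum>x. ?f (x + n)) + (\<Sum>x<n. ?f x)" by (rule suminf_split_initial_segment[OF sm])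
    also have "(\<Sum>x. ?f (x + n)) \<le> (\<Sum>x. q (x + n))"
    proof (rule suminf_le)
      show "?f (x + n) \<le> q (x + n)" for x using color_seqD(2)[OF p] Q(2) by (simp add: min_def)
      show "summable (\<lambda>x. ?f (x + n))" using sm by (rule summable_ignore_initial_segment)
      show "summable (\<lambda>x. q (x + n))" using Q(3) by (intro summable_ignore_initial_segment) (rule sums_summable)
    qed
    also have "(\<Sum>x. q (x + n)) = 1 - (\<Sum>i<n. q i)"
      using suminf_minus_initial_segment[of q n] Q(3) by (simp add: sums_iff)
    also have "\<dots> \<le> \<epsilon> / 2" using n by simp
    also have "(\<Sum>x<n. ?f x) \<le> (\<Sum>x<n. \<delta>)"
    proof (rule sum_mono)
      fix x assume "x \<in> {..<n}"
      then show "?f x \<le> \<delta>" using close[of x] \<open>\<delta> > 0\<close> by (auto simp: min_def abs_less_iff)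
    qed
    also have "(\<Sum>x<n. \<delta>) \<le> \<epsilon> / 2"
    proof -
      have "real n * \<epsilon> \<le> (real n + 1) * \<epsilon>" using assms by simp
      then show ?thesis by (simp add: \<delta>_def field_simps)
    qed
    finally show ?thesis by simp
  qed
  ultimately show ?thesis by (intro exI[of _ n] exI[of _ \<delta>] conjI ballI impI) simp_all
qed

lemma nearest_site_ball:
  fixes x :: "real ^ 'd"
  assumes "x \<in> cball 0 1"
  shows "nearest_site (real K *\<^sub>R x) \<in> {u. \<forall>i. - (int K + 1) \<le> u $ i \<and> u $ i \<le> int K + 1}"
proof (intro CollectI allI)
  fix i
  have "\<bar>x $ i\<bar> \<le> 1" using component_le_norm_cart[of x i] assms by simp
  then have "\<bar>real K * x $ i\<bar> \<le> real K * 1" by (simp only: abs_mult abs_of_nat) (rule mult_left_mono, auto)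
  moreover have "\<bar>real_of_int (nearest_site (real K *\<^sub>R x) $ i) - real K * x $ i\<bar> \<le> 1 / 2"
    using nearest_site_coord[of "real K *\<^sub>R x" i] by simp
  ultimately have "\<bar>real_of_int (nearest_site (real K *\<^sub>R x) $ i)\<bar> \<le> real K + 1" by linarith
  then show "- (int K + 1) \<le> nearest_site (real K *\<^sub>R x) $ i \<and> nearest_site (real K *\<^sub>R x) $ i \<le> int K + 1"
    by linarith
qed

text \<open>For fixed \<open>K\<close> the time constants on the ball are determined up to \<open>d / K\<close> by the rates of the finitely many lattice
  vectors in \<open>Z\<close>, and each of these is continuous by the two semicontinuity lemmas.\<close>

lemma time_const_uniform:
  assumes q: "q \<in> color_seqs" and "e > 0"
  shows "\<exists>n \<delta>. \<delta> > 0 \<and> (\<forall>p\<in>color_seqs. (\<forall>i<n. \<bar>p i - q i\<bar> < \<delta>) \<longrightarrow>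
     (\<forall>x\<in>cball (0 :: real ^ 'd) 1. \<bar>time_const q x - time_const p x\<bar> \<le> e))"
proof -
  define d where "d = real CARD('d)"
  obtain K0 :: nat where K0: "4 * d / e \<le> real K0" using real_arch_simple by blast
  define K where "K = Suc K0"
  have "4 * d \<le> real K0 * e" using K0 assms by (simp add: pos_divide_le_eq)
  also have "\<dots> \<le> real K * e" using assms by (simp add: K_def)
  finally have K: "K \<ge> 1" "d / real K \<le> e / 4" by (simp_all add: K_def field_simps)
  define Q where "Q = embed_pmf q"
  define Z where "Z = {u :: int ^ 'd. \<forall>i. - (int K + 1) \<le> u $ i \<and> u $ i \<le> int K + 1}"
  have finZ: "finite Z" unfolding Z_def by (rule finite_box)
  define good where "good z \<epsilon> \<longleftrightarrow> \<epsilon> > 0 \<and> (\<forall>\<pi>. map_pmf snd \<pi> = Q \<and> measure (measure_pmf \<pi>) {x. fst x \<noteq> snd x} \<le> \<epsilon>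
    \<longrightarrow> \<bar>time_rate (map_pmf fst \<pi>) z - time_rate Q z\<bar> \<le> e / 4)" for z :: "int ^ 'd" and \<epsilon> :: real
  have "\<exists>\<epsilon>>0. \<forall>\<pi>. map_pmf snd \<pi> = Q \<and> measure (measure_pmf \<pi>) {x. fst x \<noteq> snd x} \<le> \<epsilon>
    \<longrightarrow> \<bar>time_rate (map_pmf fst \<pi>) z - time_rate Q z\<bar> \<le> e / 4" for z :: "int ^ 'd"
  proof -
    have e4: "e / 4 > 0" using assms by simp
    obtain \<epsilon>1 where 1: "\<epsilon>1 > 0" "\<And>\<pi>. map_pmf snd \<pi> = Q \<and> measure (measure_pmf \<pi>) {x. fst x \<noteq> snd x} \<le> \<epsilon>1
      \<Longrightarrow> time_rate (map_pmf fst \<pi>) z \<le> time_rate Q z + e / 4" using time_rate_upper_semi[OF e4] by blast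
    obtain \<epsilon>2 where 2: "\<epsilon>2 > 0" "\<And>\<pi>. map_pmf snd \<pi> = Q \<and> measure (measure_pmf \<pi>) {x. fst x \<noteq> snd x} \<le> \<epsilon>2
      \<Longrightarrow> time_rate Q z \<le> time_rate (map_pmf fst \<pi>) z + e / 4" using time_rate_lower_semi[OF e4] by blast
    show ?thesis
    proof (intro exI[of _ "min \<epsilon>1 \<epsilon>2"] conjI allI impI)
      fix \<pi> assume "map_pmf snd \<pi> = Q \<and> measure (measure_pmf \<pi>) {x. fst x \<noteq> snd x} \<le> min \<epsilon>1 \<epsilon>2"
      then have \<pi>: "map_pmf snd \<pi> = Q" "measure (measure_pmf \<pi>) {x. fst x \<noteq> snd x} \<le> \<epsilon>1"
        "measure (measure_pmf \<pi>) {x. fst x \<noteq> snd x} \<le> \<epsilon>2" by auto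
      show "\<bar>time_rate (map_pmf fst \<pi>) z - time_rate Q z\<bar> \<le> e / 4"
        using 1(2)[OF conjI[OF \<pi>(1,2)]] 2(2)[OF conjI[OF \<pi>(1,3)]] by linarith
    qed (use 1 2 in simp)
  qed
  then have "\<forall>z. \<exists>\<epsilon>. good z \<epsilon>" unfolding good_def by simp
  from choice[OF this] obtain E where "\<forall>z. good z (E z)" ..
  then have E: "E z > 0" "map_pmf snd \<pi> = Q \<Longrightarrow> measure (measure_pmf \<pi>) {x. fst x \<noteq> snd x} \<le> E z
    \<Longrightarrow> \<bar>time_rate (map_pmf fst \<pi>) z - time_rate Q z\<bar> \<le> e / 4" for z \<pi>
    unfolding good_def by blast+
  (* the 1 is only there to make the set visibly nonempty *)
  define \<epsilon> where "\<epsilon> = Min (insert 1 (E ` Z))"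
  have \<epsilon>: "\<epsilon> > 0" "\<And>z. z \<in> Z \<Longrightarrow> \<epsilon> \<le> E z" using E(1) finZ by (auto simp: \<epsilon>_def)
  obtain n \<delta> where n\<delta>: "\<delta> > 0" "\<forall>p\<in>color_seqs. (\<forall>i<n. \<bar>p i - q i\<bar> < \<delta>) \<longrightarrow>
     summable (\<lambda>x. q x - min (p x) (q x)) \<longrightarrow> (\<Sum>x. q x - min (p x) (q x)) \<le> \<epsilon>"
    using color_seqs_close[OF q \<epsilon>(1)] by (elim exE conjE)
  have "\<bar>time_const q x - time_const p x\<bar> \<le> e"
    if p: "p \<in> color_seqs" and close: "\<And>i. i < n \<Longrightarrow> \<bar>p i - q i\<bar> < \<delta>" and x: "x \<in> cball 0 1" for p and x :: "real ^ 'd"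
  proof -
    obtain \<pi> where \<pi>: "map_pmf fst \<pi> = embed_pmf p" "map_pmf snd \<pi> = Q"
      "measure (measure_pmf \<pi>) {x. fst x \<noteq> snd x} \<le> (\<Sum>x. q x - min (p x) (q x))"
      "summable (\<lambda>x. q x - min (p x) (q x))"
      using coupling_exists[of "embed_pmf p" Q] unfolding Q_def pmf_color_seq[OF p] pmf_color_seq[OF q] by blast
    have le: "measure (measure_pmf \<pi>) {x. fst x \<noteq> snd x} \<le> \<epsilon>" using \<pi>(3) n\<delta>(2)[rule_format, OF p close \<pi>(4)] by linarith
    define z where "z = nearest_site (real K *\<^sub>R x)"
    have "z \<in> Z" unfolding z_def Z_def by (rule nearest_site_ball[OF x])
    then have "\<bar>time_rate (embed_pmf p) z - time_rate Q z\<bar> \<le> e / 4"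
      using E(2)[OF \<pi>(2), of z] \<epsilon>(2)[of z] le \<pi>(1) by simp
    then have "\<bar>time_rate (embed_pmf p) z - time_rate Q z\<bar> / real K \<le> (e / 4) / real K" by (rule divide_right_mono) simp
    also have "\<dots> \<le> e / 4" using K(1) assms by (simp add: divide_le_eq)
    finally have "\<bar>time_rate (embed_pmf p) z / real K - time_rate Q z / real K\<bar> \<le> e / 4"
      by (simp add: flip: diff_divide_distrib)
    moreover have "\<bar>time_const p x - time_rate (embed_pmf p) z / real K\<bar> \<le> d / real K"
      unfolding z_def d_def by (rule time_const_approx[OF p K(1)])
    moreover have "\<bar>time_const q x - time_rate Q z / real K\<bar> \<le> d / real K"
      unfolding z_def d_def Q_def by (rule time_const_approx[OF q K(1)])
    ultimately show ?thesis using K(2) assms(2) by linarith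
  qed
  with n\<delta>(1) show ?thesis by (intro exI[of _ n] exI[of _ \<delta>] conjI ballI impI) simp_all
qed

lemma restrict_time_const_cfunspace:
  assumes "p \<in> color_seqs"
  shows "restrict (time_const p) (cball (0 :: real ^ 'd) 1)
    \<in> mspace (cfunspace (top_of_set (cball 0 1)) euclidean_metric)"
proof -
  let ?f = "restrict (time_const p) (cball (0 :: real ^ 'd) 1)"
  have cont: "continuous_on (cball 0 1) (time_const p :: real ^ 'd \<Rightarrow> real)"
    unfolding continuous_on_iff
  proof (intro ballI allI impI)
    fix x :: "real ^ 'd" and e :: real assume "e > 0"
    have "dist (time_const p y) (time_const p x) < e" if "dist y x < e / real CARD('d)" for y :: "real ^ 'd"
    proof -
      have "real CARD('d) * dist y x < e" using that by (simp add: pos_less_divide_eq mult.commute)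
      then show ?thesis using time_const_lipschitz[OF assms, of y x] by (simp add: dist_real_def)
    qed
    then show "\<exists>d>0. \<forall>y\<in>cball 0 1. dist y x < d \<longrightarrow> dist (time_const p y) (time_const p x) < e"
      using \<open>e > 0\<close> by (intro exI[of _ "e / real CARD('d)"]) simp
  qed
  have "bounded (?f ` cball 0 1)"
  proof -
    have "compact (time_const p ` cball (0 :: real ^ 'd) 1)" by (rule compact_continuous_image[OF cont]) simp
    then show ?thesis by (simp add: compact_imp_bounded)
  qed
  moreover have "continuous_on (cball 0 1) ?f" by (rule continuous_on_eq[OF cont]) simp
  ultimately show ?thesis by (simp add: mbounded_iff_bounded)
qed

theorem theorem2p2:
  assumes "CARD('d::finite) \<ge> 2"
  shows "continuous_map
     (top_of_set color_seqs)
     (mtopology_of (cfunspace (top_of_set (cball (0 :: real ^ 'd) 1)) (euclidean_metric :: real metric)))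
     (\<lambda>p. restrict (time_const p) (cball 0 1))"
proof -
  let ?F = "cfunspace (top_of_set (cball (0 :: real ^ 'd) 1)) (euclidean_metric :: real metric)"
  let ?\<mu> = "\<lambda>p. restrict (time_const p) (cball (0 :: real ^ 'd) 1)"
  interpret F: Metric_space "mspace ?F" "mdist ?F" by (rule Metric_space_mspace_mdist)
  have "\<exists>U. openin (top_of_set color_seqs) U \<and> q \<in> U \<and> (\<forall>p\<in>U. ?\<mu> p \<in> F.mball (?\<mu> q) e)"
    if q: "q \<in> color_seqs" and "e > 0" for q e
  proof -
    obtain n \<delta> where n\<delta>: "\<delta> > 0" "\<forall>p\<in>color_seqs. (\<forall>i<n. \<bar>p i - q i\<bar> < \<delta>) \<longrightarrow>
      (\<forall>x\<in>cball (0 :: real ^ 'd) 1. \<bar>time_const q x - time_const p x\<bar> \<le> e / 2)"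
    proof -
      have "e / 2 > 0" using \<open>e > 0\<close> by simp
      from time_const_uniform[where 'd='d, OF q this] show ?thesis using that by (elim exE conjE)
    qed
    define V where "V = (\<Inter>i\<in>{..<n}. (\<lambda>p :: nat \<Rightarrow> real. p i) -` ball (q i) \<delta>)"
    have "open V" unfolding V_def
      by (intro open_INT ballI open_vimage continuous_on_product_coordinates) auto
    then have "openin (top_of_set color_seqs) (color_seqs \<inter> V)" by (simp add: openin_open_Int)
    moreover have "q \<in> color_seqs \<inter> V" using q n\<delta>(1) by (simp add: V_def)
    moreover have "?\<mu> p \<in> F.mball (?\<mu> q) e" if p: "p \<in> color_seqs \<inter> V" for p
    proof -
      have "\<forall>i<n. \<bar>p i - q i\<bar> < \<delta>"
        using p by (auto simp: V_def dist_real_def abs_minus_commute)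
      with n\<delta>(2) p have "\<forall>x\<in>cball (0 :: real ^ 'd) 1. \<bar>time_const q x - time_const p x\<bar> \<le> e / 2" by blast
      then have "mdist ?F (?\<mu> q) (?\<mu> p) \<le> e / 2"
        using \<open>e > 0\<close> by (intro mdist_cfunspace_le) (auto simp: dist_real_def)
      then have "mdist ?F (?\<mu> q) (?\<mu> p) < e" using \<open>e > 0\<close> by linarith
      moreover have "p \<in> color_seqs" using p by simp
      ultimately show ?thesis
        unfolding F.in_mball by (intro conjI restrict_time_const_cfunspace q)
    qed
    ultimately show ?thesis by blast
  qed
  then show ?thesis
    unfolding mtopology_of_def F.continuous_map_to_metric by simp
qed

end
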